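(* Let $\alpha>0$ be a real constant and let $(M^{2n+1},\varphi,\xi,\eta,g)$ be an almost contact metric manifold. Then $M^{2n+1}$ is a $CR$-integrable almost $\alpha$-Kenmotsu manifold if and only if there exists a linear connection $\widetilde\nabla$ such that the tensor fields $\varphi$, $g$, $\eta$ are parallel with respect to $\widetilde\nabla$ and the torsion $\widetilde T$ satisfies: a) $\widetilde T(X,Y)=0$ for any $X,Y\in\mathcal D$; b) $2\widetilde T(\xi,X)=\alpha(X+h'X)$ for any $X\in\mathcal D$; c) $\widetilde T_\xi$ is selfadjoint. The connection $\widetilde\nabla$ is invariant under $\mathcal D$-homothetic deformations and it is uniquely determined by $$\widetilde\nabla_XY=\nabla_XY+\alpha g(X+h'X,Y)\xi-\alpha\eta(Y)(X+h'X),$$ where $\nabla$ is the Levi-Civita connection of $g$.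
   Context: An almost contact metric manifold is a smooth manifold $M^{2n+1}$ with a $(1,1)$-tensor field $\varphi$, a vector field $\xi$, a $1$-form $\eta$ and a Riemannian metric $g$ satisfying $\varphi^2=-I+\eta\otimes\xi$, $\eta(\xi)=1$, $\varphi\xi=0$, $\eta\circ\varphi=0$, $g(\varphi X,\varphi Y)=g(X,Y)-\eta(X)\eta(Y)$. Put $\mathcal D=\ker\eta=\operatorname{Im}\varphi$ and $\Phi(X,Y)=g(X,\varphi Y)$. The structure is $CR$-integrable if the almost $CR$-structure $(\mathcal D,J)$, $J=\varphi|_{\mathcal D}$, is integrable. It is almost $\alpha$-Kenmotsu if $d\eta=0$ and $d\Phi=2\alpha\,\eta\wedge\Phi$. $\mathcal L$ is the Lie derivative and $h'=\frac{1}{2\alpha}(\mathcal L_\xi\varphi)\circ\varphi$. The torsion is normalized by $2\widetilde T(X,Y)=\widetilde\nabla_XY-\widetilde\nabla_YX-[X,Y]$, and $\widetilde T_\xi X=\widetilde T(\xi,X)$; selfadjoint is with respect to $g$. A $\mathcal D$-homothetic deformation with constant $\beta>0$ replaces $(\varphi,\xi,\eta,g)$ by $\bar\varphi=\varphi$, $\bar\xi=\frac1\beta\xi$, $\bar\eta=\beta\eta$, $\bar g=\beta g+\beta(\beta-1)\eta\otimes\eta$; it turns an almost $\alpha$-Kenmotsu structure into an almost $\frac{\alpha}{\beta}$-Kenmotsu one. Invariance of $\widetilde\nabla$ means that the connection associated in this way to $(\bar\varphi,\bar\xi,\bar\eta,\bar g)$ (with $\frac\alpha\beta$ in place of $\alpha$)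 equals the one associated to $(\varphi,\xi,\eta,g)$. *)

theory Defs
  imports "HOL-Analysis.Analysis" "HOL-Library.Function_Algebras"
begin

text \<open>
  Smooth manifolds are built on a Hausdorff, second countable type \<open>'a\<close> with a smooth atlas
  modelled on a Euclidean space \<open>'e\<close>; the dimension is \<open>DIM('e)\<close>.  Tangent vectors are derivations
  of the algebra of smooth functions.  Objects defined only on smooth functions or on smooth
  vector fields (tangent vectors, linear connections) are extended by zero, so that equality of
  these objects is HOL equality.
  Sums and products of functions, tangent vectors and vector fields are the pointwise ones of
  \<open>Function_Algebras\<close>.
\<close>

primrec Ck_on :: "nat \<Rightarrow> 'e::real_normed_vector set \<Rightarrow> ('e \<Rightarrow> 'b::real_normed_vector) \<Rightarrow> bool" where
  "Ck_on 0 S f \<longleftrightarrow> continuous_on S f"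
| "Ck_on (Suc k) S f \<longleftrightarrow>
     (\<forall>x\<in>S. f differentiable (at x)) \<and> (\<forall>v. Ck_on k S (\<lambda>x. frechet_derivative f (at x) v))"

text \<open>Only used for open \<open>S\<close>.\<close>

definition smooth_on :: "'e::real_normed_vector set \<Rightarrow> ('e \<Rightarrow> 'b::real_normed_vector) \<Rightarrow> bool" where
  "smooth_on S f \<longleftrightarrow> (\<forall>k. Ck_on k S f)"

type_synonym ('a, 'e) atlas = "('a set \<times> ('a \<Rightarrow> 'e)) set"

definition smooth_atlas ::
  "('a::{t2_space, second_countable_topology}, 'e::euclidean_space) atlas \<Rightarrow> bool" where
  "smooth_atlas A \<longleftrightarrow>
     (\<Union>(U, c)\<in>A. U) = UNIV \<and>
     (\<forall>(U, c)\<in>A. open U \<and> open (c ` U) \<and> homeomorphism U (c ` U) c (inv_into U c)) \<and>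
     (\<forall>(U, c)\<in>A. \<forall>(V, d)\<in>A. smooth_on (c ` (U \<inter> V)) (d \<circ> inv_into U c))"

definition smooth_functions ::
  "('a::{t2_space, second_countable_topology}, 'e::euclidean_space) atlas \<Rightarrow> ('a \<Rightarrow> real) set" where
  "smooth_functions A = {f. \<forall>(U, c)\<in>A. smooth_on (c ` U) (f \<circ> inv_into U c)}"

type_synonym 'a tvec = "('a \<Rightarrow> real) \<Rightarrow> real"
type_synonym 'a vfield = "'a \<Rightarrow> 'a tvec"

definition scale_tvec :: "real \<Rightarrow> 'a tvec \<Rightarrow> 'a tvec"  (infixr "*\<^sub>T" 75) where
  "a *\<^sub>T v = (\<lambda>f. a * v f)"

definition scale_vfield :: "('a \<Rightarrow> real) \<Rightarrow> 'a vfield \<Rightarrow> 'a vfield"  (infixr "*\<^sub>F" 75) where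
  "f *\<^sub>F X = (\<lambda>p. f p *\<^sub>T X p)"

abbreviation cscale_vfield :: "real \<Rightarrow> 'a vfield \<Rightarrow> 'a vfield"  (infixr "*\<^sub>C" 75) where
  "a *\<^sub>C X \<equiv> (\<lambda>_. a) *\<^sub>F X"

definition tangent_space ::
  "('a::{t2_space, second_countable_topology}, 'e::euclidean_space) atlas \<Rightarrow> 'a \<Rightarrow> 'a tvec set" where
  "tangent_space A p = {v.
     (\<forall>f\<in>smooth_functions A. \<forall>h\<in>smooth_functions A.
        v (f + h) = v f + v h \<and> v (f * h) = v f * h p + f p * v h) \<and>
     (\<forall>f\<in>smooth_functions A. \<forall>a. v (\<lambda>x. a * f x) = a * v f) \<and>
     (\<forall>f. f \<notin> smooth_functions A \<longrightarrow> v f = 0)}"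

definition deriv_along :: "'a vfield \<Rightarrow> ('a \<Rightarrow> real) \<Rightarrow> 'a \<Rightarrow> real" where
  "deriv_along X f = (\<lambda>p. X p f)"

definition vector_fields ::
  "('a::{t2_space, second_countable_topology}, 'e::euclidean_space) atlas \<Rightarrow> 'a vfield set" where
  "vector_fields A = {X. (\<forall>p. X p \<in> tangent_space A p) \<and>
     (\<forall>f\<in>smooth_functions A. deriv_along X f \<in> smooth_functions A)}"

definition bracket :: "'a vfield \<Rightarrow> 'a vfield \<Rightarrow> 'a vfield" where
  "bracket X Y = (\<lambda>p f. X p (deriv_along Y f) - Y p (deriv_along X f))"

text \<open>Pointwise evaluation of a \<open>(1,1)\<close>-tensor or a 1-form, and of a \<open>(0,2)\<close>-tensor, on vector fields.\<close>

definition app :: "('a \<Rightarrow> 'a tvec \<Rightarrow> 'b) \<Rightarrow> 'a vfield \<Rightarrow> 'a \<Rightarrow> 'b" where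
  "app t X = (\<lambda>p. t p (X p))"

definition app2 :: "('a \<Rightarrow> 'a tvec \<Rightarrow> 'a tvec \<Rightarrow> real) \<Rightarrow> 'a vfield \<Rightarrow> 'a vfield \<Rightarrow> 'a \<Rightarrow> real" where
  "app2 g X Y = (\<lambda>p. g p (X p) (Y p))"

definition endo_field ::
  "('a::{t2_space, second_countable_topology}, 'e::euclidean_space) atlas \<Rightarrow>
   ('a \<Rightarrow> 'a tvec \<Rightarrow> 'a tvec) \<Rightarrow> bool" where
  "endo_field A \<phi> \<longleftrightarrow>
     (\<forall>p. \<forall>v\<in>tangent_space A p. \<phi> p v \<in> tangent_space A p) \<and>
     (\<forall>p. \<forall>v\<in>tangent_space A p. \<forall>w\<in>tangent_space A p. \<phi> p (v + w) = \<phi> p v + \<phi> p w) \<and>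
     (\<forall>p a. \<forall>v\<in>tangent_space A p. \<phi> p (a *\<^sub>T v) = a *\<^sub>T \<phi> p v) \<and>
     (\<forall>X\<in>vector_fields A. app \<phi> X \<in> vector_fields A)"

definition one_form ::
  "('a::{t2_space, second_countable_topology}, 'e::euclidean_space) atlas \<Rightarrow>
   ('a \<Rightarrow> 'a tvec \<Rightarrow> real) \<Rightarrow> bool" where
  "one_form A \<eta> \<longleftrightarrow>
     (\<forall>p. \<forall>v\<in>tangent_space A p. \<forall>w\<in>tangent_space A p. \<eta> p (v + w) = \<eta> p v + \<eta> p w) \<and>
     (\<forall>p a. \<forall>v\<in>tangent_space A p. \<eta> p (a *\<^sub>T v) = a * \<eta> p v) \<and>
     (\<forall>X\<in>vector_fields A. app \<eta> X \<in> smooth_functions A)"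

definition riemannian_metric ::
  "('a::{t2_space, second_countable_topology}, 'e::euclidean_space) atlas \<Rightarrow>
   ('a \<Rightarrow> 'a tvec \<Rightarrow> 'a tvec \<Rightarrow> real) \<Rightarrow> bool" where
  "riemannian_metric A g \<longleftrightarrow>
     (\<forall>p. \<forall>u\<in>tangent_space A p. \<forall>v\<in>tangent_space A p. \<forall>w\<in>tangent_space A p.
        g p (u + v) w = g p u w + g p v w) \<and>
     (\<forall>p a. \<forall>v\<in>tangent_space A p. \<forall>w\<in>tangent_space A p. g p (a *\<^sub>T v) w = a * g p v w) \<and>
     (\<forall>p. \<forall>v\<in>tangent_space A p. \<forall>w\<in>tangent_space A p. g p v w = g p w v) \<and>
     (\<forall>p. \<forall>v\<in>tangent_space A p. v \<noteq> 0 \<longrightarrow> g p v v > 0) \<and>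
     (\<forall>X\<in>vector_fields A. \<forall>Y\<in>vector_fields A. app2 g X Y \<in> smooth_functions A)"

definition lie_endo ::
  "'a vfield \<Rightarrow> ('a \<Rightarrow> 'a tvec \<Rightarrow> 'a tvec) \<Rightarrow> 'a vfield \<Rightarrow> 'a vfield" where
  "lie_endo \<xi> \<phi> X = bracket \<xi> (app \<phi> X) - app \<phi> (bracket \<xi> X)"

text \<open>
  Exterior derivatives and wedge product without the factors 1/2 and 1/3.  The convention with
  these factors rescales \<open>d\<eta>\<close> by 1/2 and both \<open>d\<Phi>\<close> and \<open>\<eta> \<and> \<Phi>\<close> by 1/3, so the equations
  \<open>d\<eta> = 0\<close> and \<open>d\<Phi> = 2 \<alpha> \<eta> \<and> \<Phi>\<close> do not depend on the choice.
\<close>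

definition ext_deriv1 :: "('a vfield \<Rightarrow> 'a \<Rightarrow> real) \<Rightarrow> 'a vfield \<Rightarrow> 'a vfield \<Rightarrow> 'a \<Rightarrow> real" where
  "ext_deriv1 \<theta> X Y = deriv_along X (\<theta> Y) - deriv_along Y (\<theta> X) - \<theta> (bracket X Y)"

definition ext_deriv2 ::
  "('a vfield \<Rightarrow> 'a vfield \<Rightarrow> 'a \<Rightarrow> real) \<Rightarrow> 'a vfield \<Rightarrow> 'a vfield \<Rightarrow> 'a vfield \<Rightarrow> 'a \<Rightarrow> real" where
  "ext_deriv2 \<omega> X Y Z =
     deriv_along X (\<omega> Y Z) + deriv_along Y (\<omega> Z X) + deriv_along Z (\<omega> X Y)
     - \<omega> (bracket X Y) Z - \<omega> (bracket Y Z) X - \<omega> (bracket Z X) Y"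

definition wedge12 ::
  "('a vfield \<Rightarrow> 'a \<Rightarrow> real) \<Rightarrow> ('a vfield \<Rightarrow> 'a vfield \<Rightarrow> 'a \<Rightarrow> real) \<Rightarrow>
   'a vfield \<Rightarrow> 'a vfield \<Rightarrow> 'a vfield \<Rightarrow> 'a \<Rightarrow> real" where
  "wedge12 \<theta> \<omega> X Y Z = \<theta> X * \<omega> Y Z + \<theta> Y * \<omega> Z X + \<theta> Z * \<omega> X Y"

type_synonym 'a connection = "'a vfield \<Rightarrow> 'a vfield \<Rightarrow> 'a vfield"

definition linear_connection ::
  "('a::{t2_space, second_countable_topology}, 'e::euclidean_space) atlas \<Rightarrow> 'a connection \<Rightarrow> bool" where
  "linear_connection A D \<longleftrightarrow>
     (\<forall>X\<in>vector_fields A. \<forall>Y\<in>vector_fields A. D X Y \<in> vector_fields A) \<and>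
     (\<forall>X\<in>vector_fields A. \<forall>Y\<in>vector_fields A. \<forall>Z\<in>vector_fields A.
        D (X + Y) Z = D X Z + D Y Z \<and> D X (Y + Z) = D X Y + D X Z) \<and>
     (\<forall>f\<in>smooth_functions A. \<forall>X\<in>vector_fields A. \<forall>Y\<in>vector_fields A.
        D (f *\<^sub>F X) Y = f *\<^sub>F D X Y \<and>
        D X (f *\<^sub>F Y) = deriv_along X f *\<^sub>F Y + f *\<^sub>F D X Y) \<and>
     (\<forall>X Y. X \<notin> vector_fields A \<or> Y \<notin> vector_fields A \<longrightarrow> D X Y = 0)"

definition torsion :: "'a connection \<Rightarrow> 'a vfield \<Rightarrow> 'a vfield \<Rightarrow> 'a vfield" where
  "torsion D X Y = (1/2) *\<^sub>C (D X Y - D Y X - bracket X Y)"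

definition parallel_endo ::
  "('a::{t2_space, second_countable_topology}, 'e::euclidean_space) atlas \<Rightarrow> 'a connection \<Rightarrow>
   ('a \<Rightarrow> 'a tvec \<Rightarrow> 'a tvec) \<Rightarrow> bool" where
  "parallel_endo A D \<phi> \<longleftrightarrow>
     (\<forall>X\<in>vector_fields A. \<forall>Y\<in>vector_fields A. D X (app \<phi> Y) - app \<phi> (D X Y) = 0)"

definition parallel_form ::
  "('a::{t2_space, second_countable_topology}, 'e::euclidean_space) atlas \<Rightarrow> 'a connection \<Rightarrow>
   ('a \<Rightarrow> 'a tvec \<Rightarrow> real) \<Rightarrow> bool" where
  "parallel_form A D \<eta> \<longleftrightarrow>
     (\<forall>X\<in>vector_fields A. \<forall>Y\<in>vector_fields A. deriv_along X (app \<eta> Y) - app \<eta> (D X Y) = 0)"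

definition parallel_metric ::
  "('a::{t2_space, second_countable_topology}, 'e::euclidean_space) atlas \<Rightarrow> 'a connection \<Rightarrow>
   ('a \<Rightarrow> 'a tvec \<Rightarrow> 'a tvec \<Rightarrow> real) \<Rightarrow> bool" where
  "parallel_metric A D g \<longleftrightarrow>
     (\<forall>X\<in>vector_fields A. \<forall>Y\<in>vector_fields A. \<forall>Z\<in>vector_fields A.
        deriv_along X (app2 g Y Z) - app2 g (D X Y) Z - app2 g Y (D X Z) = 0)"

definition levi_civita ::
  "('a::{t2_space, second_countable_topology}, 'e::euclidean_space) atlas \<Rightarrow>
   ('a \<Rightarrow> 'a tvec \<Rightarrow> 'a tvec \<Rightarrow> real) \<Rightarrow> 'a connection" where
  "levi_civita A g = (THE D. linear_connection A D \<and> parallel_metric A D g \<and>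
     (\<forall>X\<in>vector_fields A. \<forall>Y\<in>vector_fields A. torsion D X Y = 0))"

definition almost_contact_metric ::
  "('a::{t2_space, second_countable_topology}, 'e::euclidean_space) atlas \<Rightarrow>
   ('a \<Rightarrow> 'a tvec \<Rightarrow> 'a tvec) \<Rightarrow> 'a vfield \<Rightarrow> ('a \<Rightarrow> 'a tvec \<Rightarrow> real) \<Rightarrow>
   ('a \<Rightarrow> 'a tvec \<Rightarrow> 'a tvec \<Rightarrow> real) \<Rightarrow> bool" where
  "almost_contact_metric A \<phi> \<xi> \<eta> g \<longleftrightarrow>
     endo_field A \<phi> \<and> \<xi> \<in> vector_fields A \<and> one_form A \<eta> \<and> riemannian_metric A g \<and>
     (\<forall>p. \<forall>v\<in>tangent_space A p. \<phi> p (\<phi> p v) = - v + \<eta> p v *\<^sub>T \<xi> p) \<and>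
     (\<forall>p. \<eta> p (\<xi> p) = 1) \<and>
     (\<forall>p. \<phi> p (\<xi> p) = 0) \<and>
     (\<forall>p. \<forall>v\<in>tangent_space A p. \<eta> p (\<phi> p v) = 0) \<and>
     (\<forall>p. \<forall>v\<in>tangent_space A p. \<forall>w\<in>tangent_space A p.
        g p (\<phi> p v) (\<phi> p w) = g p v w - \<eta> p v * \<eta> p w)"

text \<open>Sections of the distribution \<open>\<D> = ker \<eta>\<close>.\<close>

definition horizontal_fields ::
  "('a::{t2_space, second_countable_topology}, 'e::euclidean_space) atlas \<Rightarrow>
   ('a \<Rightarrow> 'a tvec \<Rightarrow> real) \<Rightarrow> 'a vfield set" where
  "horizontal_fields A \<eta> = {X \<in> vector_fields A. \<forall>p. \<eta> p (X p) = 0}"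

definition fundamental_form ::
  "('a \<Rightarrow> 'a tvec \<Rightarrow> 'a tvec) \<Rightarrow> ('a \<Rightarrow> 'a tvec \<Rightarrow> 'a tvec \<Rightarrow> real) \<Rightarrow>
   'a vfield \<Rightarrow> 'a vfield \<Rightarrow> 'a \<Rightarrow> real" where
  "fundamental_form \<phi> g X Y = app2 g X (app \<phi> Y)"

definition almost_kenmotsu ::
  "('a::{t2_space, second_countable_topology}, 'e::euclidean_space) atlas \<Rightarrow> real \<Rightarrow>
   ('a \<Rightarrow> 'a tvec \<Rightarrow> 'a tvec) \<Rightarrow> 'a vfield \<Rightarrow> ('a \<Rightarrow> 'a tvec \<Rightarrow> real) \<Rightarrow>
   ('a \<Rightarrow> 'a tvec \<Rightarrow> 'a tvec \<Rightarrow> real) \<Rightarrow> bool" where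
  "almost_kenmotsu A \<alpha> \<phi> \<xi> \<eta> g \<longleftrightarrow>
     almost_contact_metric A \<phi> \<xi> \<eta> g \<and>
     (\<forall>X\<in>vector_fields A. \<forall>Y\<in>vector_fields A. ext_deriv1 (app \<eta>) X Y = 0) \<and>
     (\<forall>X\<in>vector_fields A. \<forall>Y\<in>vector_fields A. \<forall>Z\<in>vector_fields A.
        ext_deriv2 (fundamental_form \<phi> g) X Y Z =
          (\<lambda>p. 2 * \<alpha> * wedge12 (app \<eta>) (fundamental_form \<phi> g) X Y Z p))"

text \<open>
  Integrability of \<open>(\<D>, J)\<close> with \<open>J = \<phi>\<close> on \<open>\<D>\<close>, i.e. involutivity of the complex bundle of the
  vectors \<open>X - i J X\<close>, in real form.  The first condition (applied to \<open>JX, Y\<close>) makes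
  \<open>[JX, Y] + [X, JY]\<close> a section of \<open>\<D>\<close>, so that \<open>\<phi>\<close> acts on it as \<open>J\<close>.
\<close>

definition CR_integrable ::
  "('a::{t2_space, second_countable_topology}, 'e::euclidean_space) atlas \<Rightarrow>
   ('a \<Rightarrow> 'a tvec \<Rightarrow> 'a tvec) \<Rightarrow> ('a \<Rightarrow> 'a tvec \<Rightarrow> real) \<Rightarrow> bool" where
  "CR_integrable A \<phi> \<eta> \<longleftrightarrow>
     (\<forall>X\<in>horizontal_fields A \<eta>. \<forall>Y\<in>horizontal_fields A \<eta>.
        bracket (app \<phi> X) (app \<phi> Y) - bracket X Y \<in> horizontal_fields A \<eta> \<and>
        bracket (app \<phi> X) (app \<phi> Y) - bracket X Y
          - app \<phi> (bracket (app \<phi> X) Y + bracket X (app \<phi> Y)) = 0)"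

definition h_prime ::
  "real \<Rightarrow> ('a \<Rightarrow> 'a tvec \<Rightarrow> 'a tvec) \<Rightarrow> 'a vfield \<Rightarrow> 'a vfield \<Rightarrow> 'a vfield" where
  "h_prime \<alpha> \<phi> \<xi> X = (1 / (2 * \<alpha>)) *\<^sub>C lie_endo \<xi> \<phi> (app \<phi> X)"

definition canonical_connection ::
  "('a::{t2_space, second_countable_topology}, 'e::euclidean_space) atlas \<Rightarrow> real \<Rightarrow>
   ('a \<Rightarrow> 'a tvec \<Rightarrow> 'a tvec) \<Rightarrow> 'a vfield \<Rightarrow> ('a \<Rightarrow> 'a tvec \<Rightarrow> real) \<Rightarrow>
   ('a \<Rightarrow> 'a tvec \<Rightarrow> 'a tvec \<Rightarrow> real) \<Rightarrow> 'a connection \<Rightarrow> bool" where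
  "canonical_connection A \<alpha> \<phi> \<xi> \<eta> g D \<longleftrightarrow>
     linear_connection A D \<and>
     parallel_endo A D \<phi> \<and> parallel_metric A D g \<and> parallel_form A D \<eta> \<and>
     (\<forall>X\<in>horizontal_fields A \<eta>. \<forall>Y\<in>horizontal_fields A \<eta>. torsion D X Y = 0) \<and>
     (\<forall>X\<in>horizontal_fields A \<eta>.
        2 *\<^sub>C torsion D \<xi> X = \<alpha> *\<^sub>C (X + h_prime \<alpha> \<phi> \<xi> X)) \<and>
     (\<forall>X\<in>vector_fields A. \<forall>Y\<in>vector_fields A.
        app2 g (torsion D \<xi> X) Y = app2 g X (torsion D \<xi> Y))"

text \<open>Components of the \<open>\<D>\<close>-homothetic deformation with constant \<open>\<beta>\<close>; \<open>\<phi>\<close> is unchanged.\<close>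

definition deformed_xi :: "real \<Rightarrow> 'a vfield \<Rightarrow> 'a vfield" where
  "deformed_xi \<beta> \<xi> = (1 / \<beta>) *\<^sub>C \<xi>"

definition deformed_eta :: "real \<Rightarrow> ('a \<Rightarrow> 'a tvec \<Rightarrow> real) \<Rightarrow> 'a \<Rightarrow> 'a tvec \<Rightarrow> real" where
  "deformed_eta \<beta> \<eta> = (\<lambda>p v. \<beta> * \<eta> p v)"

definition deformed_metric ::
  "real \<Rightarrow> ('a \<Rightarrow> 'a tvec \<Rightarrow> real) \<Rightarrow> ('a \<Rightarrow> 'a tvec \<Rightarrow> 'a tvec \<Rightarrow> real) \<Rightarrow>
   'a \<Rightarrow> 'a tvec \<Rightarrow> 'a tvec \<Rightarrow> real" where
  "deformed_metric \<beta> \<eta> g = (\<lambda>p v w. \<beta> * g p v w + \<beta> * (\<beta> - 1) * \<eta> p v * \<eta> p w)"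

end

theory Submission
  imports Defs
begin

text \<open>
  Write \<open>B X = X + h' X\<close>.  A connection with parallel \<open>g\<close> and \<open>\<eta>\<close> also has \<open>\<xi>\<close> parallel, and
  then conditions a)--c) say exactly that \<open>h'\<close> is symmetric and
  \<open>2 T(X, Y) = \<alpha> (\<eta>(X) B Y - \<eta>(Y) B X)\<close> for all \<open>X\<close>, \<open>Y\<close>.  Subtracting
  \<open>\<alpha> g(B X, Y) \<xi> - \<alpha> \<eta>(Y) B X\<close> therefore leaves a torsion-free metric connection, which is the
  Levi-Civita connection: this gives the formula and uniqueness.  With \<open>\<phi>\<close>, \<open>g\<close>, \<open>\<eta>\<close> parallel,
  \<open>d\<eta>\<close>, \<open>d\<Phi>\<close> and the bracket conditions of \<open>CR\<close>-integrability only involve the torsion and can be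
  read off.  The deformed structure has the same \<open>h'\<close> and the same torsion formula, hence the same
  connection.

  Conversely, for a \<open>CR\<close>-integrable almost \<open>\<alpha>\<close>-Kenmotsu structure, \<open>d\<Phi>(\<xi>, X, Y)\<close> computes the Lie
  derivative of \<open>g\<close> along \<open>\<xi>\<close>, which shows that \<open>h'\<close> is symmetric and that the connection defined
  by the formula has \<open>\<xi>\<close> parallel.  The tensor \<open>g((D\<^sub>X \<phi>) Y, Z)\<close> on \<open>\<D>\<close> is skew in \<open>Y\<close>, \<open>Z\<close>, has
  vanishing cyclic sum because \<open>d\<Phi>\<close> vanishes there, and satisfies the integrability identity, so it
  vanishes as in the case of Kaehler manifolds.

  This direction needs the existence of the Levi-Civita connection.  Since vector fields are
  derivations, Hadamard's lemma and cutoff functions are used to represent them locally in a frame;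
  a functional that is linear over the smooth functions is then represented by a vector field,
  obtained by a local Gram--Schmidt process, and Koszul's formula can be solved.
\<close>

section \<open>Smooth functions on Euclidean space\<close>

lemma frechet_derivative_cong_open:
  assumes "open S" "x \<in> S" "\<And>y. y \<in> S \<Longrightarrow> f y = g y"
  shows "frechet_derivative f (at x) = frechet_derivative g (at x)"
proof -
  have "(f has_derivative D) (at x) \<longleftrightarrow> (g has_derivative D) (at x)" for D
    using assms by (metis has_derivative_transform_within_open)
  then show ?thesis by (simp add: frechet_derivative_def)
qed

text \<open>The hypothesis \<open>cong\<close> is the invariance of \<open>Ck_on k\<close> under
  pointwise equality on \<open>S\<close>. It is assumed because the induction step of
  \<open>Ck_on_cong\<close> itself goes through this rule; \<open>Ck_on_SucI\<close> discharges it
  afterwards.\<close>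

lemma Ck_on_SucI_aux:
  assumes "open S" "\<And>x. x \<in> S \<Longrightarrow> (f has_derivative f' x) (at x)"
    and "\<And>v. Ck_on k S (\<lambda>x. f' x v)"
    and cong: "\<And>f g :: 'e::real_normed_vector \<Rightarrow> 'b::real_normed_vector.
      (\<And>x. x \<in> S \<Longrightarrow> f x = g x) \<Longrightarrow> Ck_on k S f \<Longrightarrow> Ck_on k S g"
  shows "Ck_on (Suc k) S (f :: 'e::real_normed_vector \<Rightarrow> 'b::real_normed_vector)"
proof -
  have eq: "frechet_derivative f (at x) = f' x" if "x \<in> S" for x
    using assms(2)[OF that] by (simp add: frechet_derivative_at[symmetric])
  have "Ck_on k S (\<lambda>x. frechet_derivative f (at x) v)" for v
    by (rule cong[OF _ assms(3)[of v]]) (simp add: eq)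
  then show ?thesis using assms(2) by (auto simp: differentiable_def)
qed

lemma Ck_on_cong:
  assumes "open S" "\<And>x. x \<in> S \<Longrightarrow> f x = g x" "Ck_on k S f"
  shows "Ck_on k S g"
  using assms(2,3)
proof (induction k arbitrary: f g)
  case 0
  then show ?case by (simp cong: continuous_on_cong)
next
  case (Suc k)
  have "(g has_derivative frechet_derivative f (at x)) (at x)" if "x \<in> S" for x
    using Suc.prems that assms(1)
    by (metis Ck_on.simps(2) frechet_derivative_works has_derivative_transform_within_open)
  then show ?case
    using Suc by (intro Ck_on_SucI_aux[OF assms(1), where f' = "\<lambda>x. frechet_derivative f (at x)"]) auto
qed

text \<open>Derivatives are unique, so an explicit formula \<open>f'\<close> may stand for
  \<open>frechet_derivative\<close> on the open set \<open>S\<close>. The closure properties below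
  are inductions on \<open>k\<close> through this rule.\<close>

lemma Ck_on_SucI:
  assumes "open S" "\<And>x. x \<in> S \<Longrightarrow> (f has_derivative f' x) (at x)"
    and "\<And>v. Ck_on k S (\<lambda>x. f' x v)"
  shows "Ck_on (Suc k) S f"
  using assms by (rule Ck_on_SucI_aux) (auto intro: Ck_on_cong[OF assms(1)])

lemma Ck_on_SucD:
  assumes "Ck_on (Suc k) S f" "x \<in> S"
  shows "(f has_derivative frechet_derivative f (at x)) (at x)"
  using assms by (auto simp: frechet_derivative_works)

lemma Ck_on_subset: "Ck_on k S f \<Longrightarrow> T \<subseteq> S \<Longrightarrow> Ck_on k T f"
  by (induction k arbitrary: f) (auto intro: continuous_on_subset)

lemma Ck_on_Suc_imp: "Ck_on (Suc k) S f \<Longrightarrow> Ck_on k S f"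
proof (induction k arbitrary: f)
  case 0
  then show ?case
    by (auto simp: continuous_on_eq_continuous_within intro!: differentiable_imp_continuous_within
        intro: differentiable_at_withinI)
next
  case (Suc k)
  then show ?case by (metis Ck_on.simps(2))
qed

lemma Ck_on_local:
  assumes "\<And>x. x \<in> S \<Longrightarrow> \<exists>T. open T \<and> x \<in> T \<and> Ck_on k T f"
  shows "Ck_on k S f"
  using assms
proof (induction k arbitrary: f)
  case 0
  have "continuous (at x within S) f" if "x \<in> S" for x
    using 0[OF that] by (metis Ck_on.simps(1) continuous_at_imp_continuous_at_within continuous_on_eq_continuous_at)
  then show ?case
    by (simp add: continuous_on_eq_continuous_within)
next
  case (Suc k)
  then show ?case by (meson Ck_on.simps(2))
qed

lemma Ck_on_const [simp]: "Ck_on k S (\<lambda>_. c)"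
proof (induction k arbitrary: c)
  case (Suc k)
  have "frechet_derivative (\<lambda>_. c) (at x) = (\<lambda>_. 0)" for x :: 'a
    by (simp add: frechet_derivative_const)
  with Suc show ?case by simp
qed simp

lemma Ck_on_bounded_linear_compose:
  assumes "open S" "bounded_linear L" "Ck_on k S f"
  shows "Ck_on k S (\<lambda>x. L (f x))"
  using assms(3)
proof (induction k arbitrary: f)
  case 0
  then show ?case using assms(2) by (simp add: bounded_linear.continuous_on)
next
  case (Suc k)
  show ?case
    by (rule Ck_on_SucI[OF assms(1), where f' = "\<lambda>x v. L (frechet_derivative f (at x) v)"])
      (use Suc Ck_on_SucD[OF Suc.prems] assms in
        \<open>auto intro: bounded_linear.has_derivative\<close>)
qed

lemma Ck_on_ident: "open S \<Longrightarrow> Ck_on k S (\<lambda>x. x)"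
  by (cases k) (auto intro!: Ck_on_SucI[where f' = "\<lambda>x v. v"])

lemma Ck_on_bounded_linear: "open S \<Longrightarrow> bounded_linear L \<Longrightarrow> Ck_on k S L"
  using Ck_on_bounded_linear_compose[OF _ _ Ck_on_ident, of S L k] by simp

lemma Ck_on_add:
  assumes "open S" "Ck_on k S f" "Ck_on k S g"
  shows "Ck_on k S (\<lambda>x. f x + g x)"
  using assms(2,3)
proof (induction k arbitrary: f g)
  case 0
  then show ?case by (simp add: continuous_on_add)
next
  case (Suc k)
  show ?case
    by (rule Ck_on_SucI[OF assms(1),
          where f' = "\<lambda>x v. frechet_derivative f (at x) v + frechet_derivative g (at x) v"])
      (use Suc Ck_on_SucD[OF Suc.prems(1)] Ck_on_SucD[OF Suc.prems(2)] in
        \<open>auto intro: has_derivative_add\<close>)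
qed

lemma Ck_on_sum:
  assumes "open S" "\<And>i. i \<in> I \<Longrightarrow> Ck_on k S (f i)"
  shows "Ck_on k S (\<lambda>x. \<Sum>i\<in>I. f i x)"
  using assms(2) by (induction I rule: infinite_finite_induct) (auto intro: Ck_on_add assms(1))

lemma Ck_on_scaleR:
  assumes "open S" "Ck_on k S f" "Ck_on k S g"
  shows "Ck_on k S (\<lambda>x. f x *\<^sub>R g x)"
  using assms(2,3)
proof (induction k arbitrary: f g)
  case 0
  then show ?case by (simp add: continuous_on_scaleR)
next
  case (Suc k)
  show ?case
  proof (rule Ck_on_SucI[OF assms(1), where f' =
        "\<lambda>x v. f x *\<^sub>R frechet_derivative g (at x) v + frechet_derivative f (at x) v *\<^sub>R g x"])
    \<comment> \<open>The product rule returns \<open>f\<close> and \<open>g\<close>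
      undifferentiated, so they are also needed at level \<open>k\<close>, whence
      \<open>Ck_on_Suc_imp\<close>.\<close>
    show "Ck_on k S (\<lambda>x. f x *\<^sub>R frechet_derivative g (at x) v + frechet_derivative f (at x) v *\<^sub>R g x)" for v
      using Suc.prems Suc.prems[THEN Ck_on_Suc_imp] by (intro Ck_on_add assms(1) Suc.IH) auto
  qed (use Ck_on_SucD[OF Suc.prems(1)] Ck_on_SucD[OF Suc.prems(2)] in
        \<open>auto intro: has_derivative_scaleR\<close>)
qed

lemma Ck_on_mult:
  fixes f g :: "'e::real_normed_vector \<Rightarrow> real"
  shows "open S \<Longrightarrow> Ck_on k S f \<Longrightarrow> Ck_on k S g \<Longrightarrow> Ck_on k S (\<lambda>x. f x * g x)"
  using Ck_on_scaleR[of S k f g] by simp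

text \<open>In a basis of the Euclidean middle space the chain rule becomes a finite sum of
  components of the derivative of \<tau> times partial derivatives of \<open>f\<close> composed with
  \<tau>. The induction hypothesis applies to these composites.\<close>

lemma Ck_on_compose:
  fixes \<tau> :: "'d::real_normed_vector \<Rightarrow> 'e::euclidean_space"
  assumes "open S" "Ck_on k S \<tau>" "\<tau> ` S \<subseteq> T" "Ck_on k T f"
  shows "Ck_on k S (\<lambda>x. f (\<tau> x))"
  using assms(2,4)
proof (induction k arbitrary: f)
  case 0
  then show ?case using assms(3) by (auto intro: continuous_on_compose2)
next
  case (Suc k)
  let ?df = "\<lambda>x. frechet_derivative f (at x)" and ?dt = "\<lambda>x. frechet_derivative \<tau> (at x)"
  show ?case
  proof (rule Ck_on_SucI[OF assms(1), where f' = "\<lambda>x v. \<Sum>b\<in>Basis. (?dt x v \<bullet> b) *\<^sub>R ?df (\<tau> x) b"])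
    fix x assume x: "x \<in> S"
    have df: "(f has_derivative ?df (\<tau> x)) (at (\<tau> x))"
      using Ck_on_SucD[OF Suc.prems(2)] x assms(3) by auto
    have "((\<lambda>x. f (\<tau> x)) has_derivative (\<lambda>v. ?df (\<tau> x) (?dt x v))) (at x)"
      by (rule has_derivative_compose[OF Ck_on_SucD[OF Suc.prems(1) x] df])
    moreover have "?df (\<tau> x) w = (\<Sum>b\<in>Basis. (w \<bullet> b) *\<^sub>R ?df (\<tau> x) b)" for w
    proof -
      interpret linear "?df (\<tau> x)" using df by (simp add: has_derivative_linear)
      have "?df (\<tau> x) w = ?df (\<tau> x) (\<Sum>b\<in>Basis. (w \<bullet> b) *\<^sub>R b)" by (simp add: euclidean_representation)
      then show ?thesis by (simp add: sum scaleR)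
    qed
    ultimately show "((\<lambda>x. f (\<tau> x)) has_derivative (\<lambda>v. \<Sum>b\<in>Basis. (?dt x v \<bullet> b) *\<^sub>R ?df (\<tau> x) b)) (at x)"
      by (metis (no_types, lifting) has_derivative_eq_rhs ext)
  next
    fix v
    have "Ck_on k S (\<lambda>x. ?dt x v \<bullet> b)" for b
      using Suc.prems(1) by (intro Ck_on_bounded_linear_compose[OF assms(1) bounded_linear_inner_left]) simp
    moreover have "Ck_on k S (\<lambda>x. ?df (\<tau> x) b)" for b
      by (rule Suc.IH[OF Ck_on_Suc_imp[OF Suc.prems(1)]]) (use Suc.prems(2) in simp)
    ultimately show "Ck_on k S (\<lambda>x. \<Sum>b\<in>Basis. (?dt x v \<bullet> b) *\<^sub>R ?df (\<tau> x) b)"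
      by (intro Ck_on_sum Ck_on_scaleR assms(1))
  qed
qed

text \<open>The derivative is a multiple of the square of the function itself, so the product rule
  closes the induction.\<close>

lemma Ck_on_inverse_real: "Ck_on k (- {0}) (\<lambda>x::real. inverse x)"
proof (induction k)
  case (Suc k)
  show ?case
  proof (rule Ck_on_SucI[where f' = "\<lambda>x v. (- v) * (inverse x * inverse x)"])
    show "Ck_on k (- {0::real}) (\<lambda>x. - v * (inverse x * inverse x))" for v
      by (intro Ck_on_mult Ck_on_const Suc) auto
    show "(inverse has_derivative (\<lambda>v. - v * (inverse x * inverse x))) (at x)"
      if "x \<in> - {0}" for x :: real
      using that by (auto intro!: derivative_eq_intros)
  qed auto
qed (auto intro!: continuous_intros)

text \<open>The family \<open>exp (-1/x) / x ^ m\<close> is closed under differentiation up to linear combinations.\<close>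

definition exp_flat :: "nat \<Rightarrow> real \<Rightarrow> real" where
  "exp_flat m x = (if x > 0 then exp (- inverse x) * inverse x ^ m else 0)"

lemma exp_flat_pos: "x > 0 \<Longrightarrow> exp_flat m x > 0" and exp_flat_nonneg: "exp_flat m x \<ge> 0"
  and exp_flat_eq_0: "x \<le> 0 \<Longrightarrow> exp_flat m x = 0"
  by (auto simp: exp_flat_def)

lemma exp_flat_deriv:
  "(exp_flat m has_real_derivative exp_flat (m + 2) x - of_nat m * exp_flat (m + 1) x) (at x)"
proof -
  consider "x > 0" | "x < 0" | "x = 0" by linarith
  then show ?thesis
  proof cases
    case 1
    have "((\<lambda>x. exp (- inverse x) * inverse x ^ m) has_real_derivative
        exp_flat (m + 2) x - of_nat m * exp_flat (m + 1) x) (at x)"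
      using 1 by (auto intro!: derivative_eq_intros simp: exp_flat_def algebra_simps)
        (cases m; simp)
    then show ?thesis
      by (rule has_field_derivative_transform_within_open[of _ _ _ "{0<..}"])
        (use 1 in \<open>auto simp: exp_flat_def\<close>)
  next
    case 2
    have "((\<lambda>x. 0) has_real_derivative exp_flat (m + 2) x - of_nat m * exp_flat (m + 1) x) (at x)"
      using 2 by (simp add: exp_flat_def)
    then show ?thesis
      by (rule has_field_derivative_transform_within_open[of _ _ _ "{..<0}"])
        (use 2 in \<open>auto simp: exp_flat_def\<close>)
  next
    case 3
    \<comment> \<open>The right difference quotient at 0 is \<open>exp_flat m y / y\<close>; with
      \<open>y = inverse t\<close> it becomes \<open>t ^ Suc m / exp t\<close>.\<close>
    have "((\<lambda>t::real. t ^ Suc m / exp t) \<longlongrightarrow> 0) at_top"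
      by (rule tendsto_power_div_exp_0)
    then have "((\<lambda>t. exp_flat m (inverse t) / inverse t) \<longlongrightarrow> 0) at_top"
      by (rule Lim_transform_eventually)
        (auto intro!: eventually_mono[OF eventually_gt_at_top[of 0]] simp: exp_flat_def exp_minus field_simps)
    then have "((\<lambda>y. exp_flat m y / y) \<longlongrightarrow> 0) (at_right 0)"
      by (simp add: filterlim_at_right_to_top)
    moreover have "((\<lambda>y. exp_flat m y / y) \<longlongrightarrow> 0) (at_left 0)"
      by (rule Lim_transform_eventually[of "\<lambda>_. 0"])
        (auto simp: eventually_at_left_field exp_flat_def intro!: exI[of _ "-1"])
    ultimately show ?thesis
      using 3 by (simp add: has_field_derivative_iff filterlim_at_split exp_flat_def[of _ 0])
  qed
qed

lemma Ck_on_exp_flat: "Ck_on k UNIV (exp_flat m)"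
proof (induction k arbitrary: m)
  case 0
  show ?case using exp_flat_deriv by (auto intro!: DERIV_continuous_on)
next
  case (Suc k)
  show ?case
  proof (rule Ck_on_SucI[where f' = "\<lambda>x v. (exp_flat (m + 2) x + (- of_nat m) * exp_flat (m + 1) x) * v"])
    show "(exp_flat m has_derivative (\<lambda>v. (exp_flat (m + 2) x + - real m * exp_flat (m + 1) x) * v)) (at x)" for x
      using exp_flat_deriv[of m x] by (simp add: has_field_derivative_def)
    show "Ck_on k UNIV (\<lambda>x. (exp_flat (m + 2) x + - real m * exp_flat (m + 1) x) * v)" for v
      by (intro Ck_on_mult Ck_on_add Ck_on_const Suc) auto
  qed auto
qed

section \<open>Smooth maps on open sets\<close>

lemma smooth_onI: "(\<And>k. Ck_on k S f) \<Longrightarrow> smooth_on S f"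
  and smooth_onD: "smooth_on S f \<Longrightarrow> Ck_on k S f"
  by (auto simp: smooth_on_def)

lemma smooth_on_cong:
  assumes "open S" "smooth_on S f" "\<And>x. x \<in> S \<Longrightarrow> f x = g x"
  shows "smooth_on S g"
  using assms Ck_on_cong unfolding smooth_on_def by blast

lemma smooth_on_const [simp]: "smooth_on S (\<lambda>_. c)"
  by (simp add: smooth_on_def)

lemma smooth_on_subset: "smooth_on S f \<Longrightarrow> T \<subseteq> S \<Longrightarrow> smooth_on T f"
  by (meson Ck_on_subset smooth_on_def)

lemma smooth_on_local:
  assumes "\<And>x. x \<in> S \<Longrightarrow> \<exists>T. open T \<and> x \<in> T \<and> smooth_on T f"
  shows "smooth_on S f"
  using assms Ck_on_local unfolding smooth_on_def by metis

lemma smooth_on_bounded_linear: "open S \<Longrightarrow> bounded_linear L \<Longrightarrow> smooth_on S L"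
  by (simp add: Ck_on_bounded_linear smooth_on_def)

lemma smooth_on_add: "open S \<Longrightarrow> smooth_on S f \<Longrightarrow> smooth_on S g \<Longrightarrow> smooth_on S (\<lambda>x. f x + g x)"
  by (simp add: smooth_on_def Ck_on_add)

lemma smooth_on_mult:
  fixes f g :: "'e::real_normed_vector \<Rightarrow> real"
  shows "open S \<Longrightarrow> smooth_on S f \<Longrightarrow> smooth_on S g \<Longrightarrow> smooth_on S (\<lambda>x. f x * g x)"
  by (simp add: smooth_on_def Ck_on_mult)

lemma smooth_on_diff:
  fixes f g :: "'e::real_normed_vector \<Rightarrow> real"
  assumes "open S" "smooth_on S f" "smooth_on S g"
  shows "smooth_on S (\<lambda>x. f x - g x)"
  using smooth_on_add[OF assms(1,2) smooth_on_mult[OF assms(1) smooth_on_const[of _ "-1"] assms(3)]]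
  by simp

lemma smooth_on_sum:
  "open S \<Longrightarrow> (\<And>i. i \<in> I \<Longrightarrow> smooth_on S (f i)) \<Longrightarrow> smooth_on S (\<lambda>x. \<Sum>i\<in>I. f i x)"
  by (simp add: smooth_on_def Ck_on_sum)

lemma smooth_on_compose:
  fixes \<tau> :: "'d::real_normed_vector \<Rightarrow> 'e::euclidean_space"
  assumes "open S" "smooth_on S \<tau>" "\<tau> ` S \<subseteq> T" "smooth_on T f"
  shows "smooth_on S (\<lambda>x. f (\<tau> x))"
  by (intro smooth_onI Ck_on_compose[OF assms(1) smooth_onD[OF assms(2)] assms(3) smooth_onD[OF assms(4)]])

lemma smooth_on_inverse:
  fixes f :: "'e::real_normed_vector \<Rightarrow> real"
  assumes "open S" "smooth_on S f" "\<And>x. x \<in> S \<Longrightarrow> f x \<noteq> 0"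
  shows "smooth_on S (\<lambda>x. inverse (f x))"
  by (rule smooth_on_compose[where f = inverse and T = "- {0}"])
    (use assms Ck_on_inverse_real in \<open>auto simp: smooth_on_def\<close>)

lemma smooth_on_frechet_derivative:
  "smooth_on S f \<Longrightarrow> smooth_on S (\<lambda>x. frechet_derivative f (at x) v)"
  by (metis Ck_on.simps(2) smooth_on_def)

lemma smooth_on_has_derivative:
  "smooth_on S f \<Longrightarrow> x \<in> S \<Longrightarrow> (f has_derivative frechet_derivative f (at x)) (at x)"
  using Ck_on_SucD smooth_on_def by blast

lemma smooth_on_continuous: "smooth_on S f \<Longrightarrow> continuous_on S f"
  by (metis Ck_on.simps(1) smooth_on_def)


lemma smooth_bump:
  fixes a :: "'e::euclidean_space"
  assumes "r > 0"
  shows "\<exists>b. smooth_on UNIV b \<and> (\<forall>x\<in>ball a r. b x = (1::real)) \<and> (\<forall>x. x \<notin> ball a (2 * r) \<longrightarrow> b x = 0)"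
proof -
  \<comment> \<open>The bump is \<open>u / (u + w)\<close>. Here \<open>u\<close> is positive
    exactly on the open ball of radius \<open>2 * r\<close> and \<open>w\<close> exactly outside the
    closed ball of radius \<open>r\<close>, so the denominator never vanishes. The squared distance
    \<open>s\<close> is a polynomial, hence smooth also at \<open>a\<close>.\<close>
  define s where "s x = (x - a) \<bullet> (x - a)" for x
  define u where "u x = exp_flat 0 (4 * r\<^sup>2 - s x)" for x
  define w where "w x = exp_flat 0 (s x - r\<^sup>2)" for x
  have comp: "smooth_on UNIV (\<lambda>x. x \<bullet> i :: real)" for i :: 'e
    by (intro smooth_on_bounded_linear bounded_linear_inner_left) simp
  have lin: "smooth_on UNIV (\<lambda>x. x \<bullet> i + - (a \<bullet> i))" for i
    by (rule smooth_on_add[OF open_UNIV comp smooth_on_const])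
  have s_eq: "s = (\<lambda>x. \<Sum>i\<in>Basis. (x \<bullet> i + - (a \<bullet> i)) * (x \<bullet> i + - (a \<bullet> i)))"
    unfolding s_def by (subst euclidean_inner) (simp add: inner_diff_left)
  have s: "smooth_on UNIV s"
    unfolding s_eq by (rule smooth_on_sum[OF open_UNIV], rule smooth_on_mult[OF open_UNIV lin lin])
  have flat: "smooth_on UNIV (exp_flat 0)" by (simp add: smooth_on_def Ck_on_exp_flat)
  have u: "smooth_on UNIV u"
  proof -
    have "smooth_on UNIV (\<lambda>x. exp_flat 0 (4 * r\<^sup>2 + (-1) * s x))"
      by (rule smooth_on_compose[OF _ _ _ flat]) (auto intro!: smooth_on_diff s)
    then show ?thesis by (simp add: u_def[abs_def])
  qed
  have w: "smooth_on UNIV w"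
  proof -
    have "smooth_on UNIV (\<lambda>x. exp_flat 0 (s x + (- r\<^sup>2)))"
      by (rule smooth_on_compose[OF _ _ _ flat]) (auto intro!: smooth_on_diff s)
    then show ?thesis by (simp add: w_def[abs_def])
  qed
  have pos: "u x + w x > 0" for x
  proof (cases "s x < 4 * r\<^sup>2")
    case True
    then show ?thesis using exp_flat_pos[of "4 * r\<^sup>2 - s x" 0] exp_flat_nonneg[of 0 "s x - r\<^sup>2"]
      by (simp add: u_def w_def)
  next
    case False
    moreover have "r\<^sup>2 > 0" using assms by simp
    ultimately have "s x - r\<^sup>2 > 0" by linarith
    then show ?thesis using exp_flat_pos[of "s x - r\<^sup>2" 0] exp_flat_nonneg[of 0 "4 * r\<^sup>2 - s x"]
      by (simp add: u_def w_def)
  qed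
  have sn: "s x = (dist a x)\<^sup>2" for x
    unfolding s_def by (metis dist_commute dist_norm power2_norm_eq_inner)
  show ?thesis
  proof (intro exI[of _ "\<lambda>x. u x * inverse (u x + w x)"] conjI ballI allI impI)
    show "smooth_on UNIV (\<lambda>x. u x * inverse (u x + w x))"
      by (intro smooth_on_mult smooth_on_inverse smooth_on_add u w) (use pos in \<open>auto simp: less_imp_neq\<close>,
          metis less_irrefl)
  next
    fix x assume "x \<in> ball a r"
    then have "s x < r\<^sup>2" by (simp add: sn power_strict_mono)
    then have "w x = 0" by (simp add: w_def exp_flat_eq_0)
    then show "u x * inverse (u x + w x) = 1" using pos[of x] by simp
  next
    fix x assume "x \<notin> ball a (2 * r)"
    then have "(2 * r)\<^sup>2 \<le> s x" using assms unfolding sn by (intro power_mono) auto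
    then have "u x = 0" by (simp add: u_def exp_flat_eq_0)
    then show "u x * inverse (u x + w x) = 0" by simp
  qed
qed

text \<open>Differentiation under the integral sign. Each differentiation in \<open>x\<close>
  produces one more factor \<open>t\<close> from the inner map, so the induction has to carry the
  power \<open>t ^ m\<close>.\<close>

lemma Ck_on_segment_integral:
  fixes G :: "'e::euclidean_space \<Rightarrow> real"
  assumes "open S" "convex S" "a \<in> S" "smooth_on S G"
  shows "Ck_on k S (\<lambda>x. integral {0..1} (\<lambda>t. t ^ m * G (a + t *\<^sub>R (x - a))))"
proof -
  have seg: "a + t *\<^sub>R (x - a) \<in> S" if "x \<in> S" "t \<in> {0..1}" for x t
  proof -
    have "(1 - t) *\<^sub>R a + t *\<^sub>R x \<in> S"
      using assms(2,3) that by (intro convexD) auto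
    then show ?thesis by (simp add: algebra_simps)
  qed
  have cont: "continuous_on (S \<times> {0..1}) (\<lambda>(x, t). t ^ j * H (a + t *\<^sub>R (x - a)))"
    if "smooth_on S H" for H :: "'e \<Rightarrow> real" and j
  proof -
    have "continuous_on (S \<times> {0..1}) (\<lambda>z. H (a + snd z *\<^sub>R (fst z - a)))"
      by (rule continuous_on_compose2[OF smooth_on_continuous[OF that]])
        (auto intro!: continuous_intros seg)
    then show ?thesis by (auto simp: split_beta intro!: continuous_intros)
  qed
  show ?thesis
    using assms(4)
  proof (induction k arbitrary: G m)
    case 0
    show ?case using integral_continuous_on_param[of S 0 1 "\<lambda>x t. t ^ m * G (a + t *\<^sub>R (x - a))"]
        cont[OF 0] by simp
  next
    case (Suc k)
    let ?D = "\<lambda>y. frechet_derivative G (at y)"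
    have D: "(G has_derivative ?D y) (at y)" if "y \<in> S" for y
      by (rule smooth_on_has_derivative[OF Suc.prems that])
    have bl: "blinfun_apply (Blinfun (?D y)) = ?D y" if "y \<in> S" for y
      using D[OF that] by (intro bounded_linear_Blinfun_apply has_derivative_bounded_linear)
    \<comment> \<open>The Leibniz rule wants the derivative of the integrand as a continuous family
      of bounded linear maps; continuity is then checked on basis vectors, where it reduces to
      \<open>cont\<close>.\<close>
    define fx where "fx x t = t ^ Suc m *\<^sub>R Blinfun (?D (a + t *\<^sub>R (x - a)))" for x and t :: real
    have fx_apply: "blinfun_apply (fx x t) v = t ^ Suc m * ?D (a + t *\<^sub>R (x - a)) v"
      if "x \<in> S" "t \<in> {0..1}" for x t v
      using bl[OF seg[OF that]] by (simp add: fx_def blinfun.scaleR_left)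
    have contfx: "continuous_on (S \<times> {0..1}) (\<lambda>(x, t). fx x t)"
    proof (rule continuous_on_blinfun_componentwise)
      fix i :: 'e assume "i \<in> Basis"
      have "continuous_on (S \<times> {0..1}) (\<lambda>(x, t). t ^ Suc m * ?D (a + t *\<^sub>R (x - a)) i)"
        by (rule cont[OF smooth_on_frechet_derivative[OF Suc.prems]])
      then show "continuous_on (S \<times> {0..1}) (\<lambda>z. blinfun_apply (case z of (x, t) \<Rightarrow> fx x t) i)"
        by (rule continuous_on_cong[THEN iffD1, rotated 2]) (auto simp: fx_apply)
    qed
    have contx: "continuous_on {0..1} (f x)"
      if "continuous_on (S \<times> {0..1}) (\<lambda>(x, t). f x t)" "x \<in> S" for x
        and f :: "'e \<Rightarrow> real \<Rightarrow> 'b::topological_space"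
    proof -
      have "continuous_on {0..1::real} (\<lambda>t. (x, t))"
        by (intro continuous_on_Pair continuous_on_const continuous_on_id)
      from continuous_on_compose2[OF that(1) this] that(2) show ?thesis by auto
    qed
    show ?case
    proof (rule Ck_on_SucI[OF assms(1), where f' = "\<lambda>x v. integral {0..1} (\<lambda>t. t ^ Suc m * ?D (a + t *\<^sub>R (x - a)) v)"])
      fix x assume x: "x \<in> S"
      have "((\<lambda>x. integral (cbox 0 1) (\<lambda>t. t ^ m * G (a + t *\<^sub>R (x - a)))) has_derivative
          integral (cbox 0 1) (fx x)) (at x within S)"
      proof (rule leibniz_rule)
        show "((\<lambda>x. t ^ m * G (a + t *\<^sub>R (x - a))) has_derivative blinfun_apply (fx x t)) (at x within S)"
          if "x \<in> S" "t \<in> cbox 0 1" for x t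
        proof -
          have s: "a + t *\<^sub>R (x - a) \<in> S" using seg that by simp
          have "((\<lambda>x. a + t *\<^sub>R (x - a)) has_derivative (\<lambda>v. t *\<^sub>R v)) (at x)"
            by (auto intro!: derivative_eq_intros)
          then have "((\<lambda>x. G (a + t *\<^sub>R (x - a))) has_derivative (\<lambda>v. ?D (a + t *\<^sub>R (x - a)) (t *\<^sub>R v))) (at x)"
            using has_derivative_compose[where f = "\<lambda>x. a + t *\<^sub>R (x - a)" and g = G] D[OF s] by blast
          then have "((\<lambda>x. t ^ m * G (a + t *\<^sub>R (x - a))) has_derivative
              (\<lambda>v. t ^ m * ?D (a + t *\<^sub>R (x - a)) (t *\<^sub>R v))) (at x)"
            by (rule has_derivative_mult_right)
          moreover have "(\<lambda>v. t ^ m * ?D (a + t *\<^sub>R (x - a)) (t *\<^sub>R v)) = blinfun_apply (fx x t)"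
            using that fx_apply[of x t] linear_scale[OF has_derivative_linear[OF D[OF s]]] by auto
          ultimately show ?thesis by (simp add: has_derivative_at_withinI)
        qed
        show "(\<lambda>t. t ^ m * G (a + t *\<^sub>R (x - a))) integrable_on cbox 0 1" if "x \<in> S" for x
          using contx[OF cont[OF Suc.prems] that] by (simp add: integrable_continuous_real)
      qed (use contfx x assms(2) in auto)
      moreover have "blinfun_apply (integral (cbox 0 1) (fx x)) =
          (\<lambda>v. integral {0..1} (\<lambda>t. t ^ Suc m * ?D (a + t *\<^sub>R (x - a)) v))"
      proof
        fix v
        have "fx x integrable_on {0..1}"
          using contx[OF contfx x] by (simp add: integrable_continuous_real)
        then have "blinfun_apply (integral (cbox 0 1) (fx x)) v = integral {0..1} (\<lambda>t. fx x t v)"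
          by (simp add: blinfun_apply_integral)
        also have "\<dots> = integral {0..1} (\<lambda>t. t ^ Suc m * ?D (a + t *\<^sub>R (x - a)) v)"
          using x by (intro integral_cong) (simp add: fx_apply)
        finally show "blinfun_apply (integral (cbox 0 1) (fx x)) v =
            integral {0..1} (\<lambda>t. t ^ Suc m * ?D (a + t *\<^sub>R (x - a)) v)" .
      qed
      ultimately show "((\<lambda>x. integral {0..1} (\<lambda>t. t ^ m * G (a + t *\<^sub>R (x - a)))) has_derivative
          (\<lambda>v. integral {0..1} (\<lambda>t. t ^ Suc m * ?D (a + t *\<^sub>R (x - a)) v))) (at x)"
        using at_within_open[OF x assms(1)] by simp
    next
      show "Ck_on k S (\<lambda>x. integral {0..1} (\<lambda>t. t ^ Suc m * ?D (a + t *\<^sub>R (x - a)) v))" for v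
        by (rule Suc.IH[OF smooth_on_frechet_derivative[OF Suc.prems]])
    qed
  qed
qed

text \<open>Integrate the derivative of \<open>f\<close> along the segment from \<open>a\<close> to
  \<open>x\<close> and expand the direction \<open>x - a\<close> in the basis: \<open>h i\<close> is
  the integral of the partial derivative in direction \<open>i\<close>.\<close>

lemma Hadamard:
  fixes f :: "'e::euclidean_space \<Rightarrow> real"
  assumes "open S" "convex S" "a \<in> S" "smooth_on S f"
  obtains h where "\<And>i. smooth_on S (h i)" "\<And>i. h i a = frechet_derivative f (at a) i"
    "\<And>x. x \<in> S \<Longrightarrow> f x = f a + (\<Sum>i\<in>Basis. ((x - a) \<bullet> i) * h i x)"
proof -
  let ?D = "\<lambda>y. frechet_derivative f (at y)"
  define h where "h i x = integral {0..1} (\<lambda>t. ?D (a + t *\<^sub>R (x - a)) i)" for i x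
  have "smooth_on S (h i)" for i
    using Ck_on_segment_integral[OF assms(1-3) smooth_on_frechet_derivative[OF assms(4)], of _ 0 i]
    by (simp add: smooth_on_def h_def[abs_def])
  moreover have "h i a = ?D a i" for i
    by (simp add: h_def)
  moreover have "f x = f a + (\<Sum>i\<in>Basis. ((x - a) \<bullet> i) * h i x)" if x: "x \<in> S" for x
  proof -
    have seg: "a + t *\<^sub>R (x - a) \<in> S" if "t \<in> {0..1}" for t
    proof -
      have "(1 - t) *\<^sub>R a + t *\<^sub>R x \<in> S"
        using assms(2,3) that x by (intro convexD) auto
      then show ?thesis by (simp add: algebra_simps)
    qed
    have D: "(f has_derivative ?D y) (at y)" if "y \<in> S" for y
      by (rule smooth_on_has_derivative[OF assms(4) that])
    have "((\<lambda>t. f (a + t *\<^sub>R (x - a))) has_vector_derivative ?D (a + t *\<^sub>R (x - a)) (x - a)) (at t within {0..1})"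
      if t: "t \<in> {0..1}" for t
    proof -
      have "((\<lambda>t. a + t *\<^sub>R (x - a)) has_derivative (\<lambda>s. s *\<^sub>R (x - a))) (at t within {0..1})"
        by (auto intro!: derivative_eq_intros)
      then have "((\<lambda>t. f (a + t *\<^sub>R (x - a))) has_derivative (\<lambda>s. ?D (a + t *\<^sub>R (x - a)) (s *\<^sub>R (x - a))))
          (at t within {0..1})"
        using has_derivative_compose[where f = "\<lambda>t. a + t *\<^sub>R (x - a)" and g = f] D[OF seg[OF t]] by blast
      then show ?thesis
        unfolding has_vector_derivative_def
        using linear_scale[OF has_derivative_linear[OF D[OF seg[OF t]]]] by simp
    qed
    then have ftc: "((\<lambda>t. ?D (a + t *\<^sub>R (x - a)) (x - a)) has_integral (f x - f a)) {0..1}"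
      using fundamental_theorem_of_calculus[of 0 1 "\<lambda>t. f (a + t *\<^sub>R (x - a))"] by simp
    have "continuous_on {0..1} (\<lambda>t. ?D (a + t *\<^sub>R (x - a)) i)" for i
      by (rule continuous_on_compose2[OF smooth_on_continuous[OF smooth_on_frechet_derivative[OF assms(4)]]])
        (auto intro!: continuous_intros seg)
    then have "((\<lambda>t. ?D (a + t *\<^sub>R (x - a)) i) has_integral h i x) {0..1}" for i
      by (simp add: h_def integrable_continuous_real integrable_integral)
    then have "((\<lambda>t. \<Sum>i\<in>Basis. ((x - a) \<bullet> i) * ?D (a + t *\<^sub>R (x - a)) i) has_integral
        (\<Sum>i\<in>Basis. ((x - a) \<bullet> i) * h i x)) {0..1}"
      by (intro has_integral_sum has_integral_mult_right) auto
    moreover have "(\<Sum>i\<in>Basis. ((x - a) \<bullet> i) * ?D (a + t *\<^sub>R (x - a)) i) = ?D (a + t *\<^sub>R (x - a)) (x - a)"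
      if "t \<in> {0..1}" for t
    proof -
      interpret linear "?D (a + t *\<^sub>R (x - a))" by (rule has_derivative_linear[OF D[OF seg[OF that]]])
      have "?D (a + t *\<^sub>R (x - a)) (x - a) = ?D (a + t *\<^sub>R (x - a)) (\<Sum>i\<in>Basis. ((x - a) \<bullet> i) *\<^sub>R i)"
        by (simp only: euclidean_representation)
      then show ?thesis by (simp add: sum scaleR)
    qed
    ultimately have "((\<lambda>t. ?D (a + t *\<^sub>R (x - a)) (x - a)) has_integral (\<Sum>i\<in>Basis. ((x - a) \<bullet> i) * h i x)) {0..1}"
      by (rule has_integral_eq[rotated])
    from has_integral_unique[OF this ftc] show ?thesis by simp
  qed
  ultimately show ?thesis by (rule that)
qed

section \<open>Cutoff functions and tangent vectors\<close>

locale smooth_manifold =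
  fixes A :: "('a::{t2_space, second_countable_topology}, 'e::euclidean_space) atlas"
  assumes atlas: "smooth_atlas A"
begin

abbreviation "S \<equiv> smooth_functions A"
abbreviation "\<Gamma> \<equiv> vector_fields A"
abbreviation "T p \<equiv> tangent_space A p"

lemma chart:
  assumes "(U, c) \<in> A"
  shows chart_open: "open U" and chart_open_image: "open (c ` U)"
    and chart_homeo: "homeomorphism U (c ` U) c (inv_into U c)"
  using atlas assms unfolding smooth_atlas_def by blast+

lemma chart_inj: "(U, c) \<in> A \<Longrightarrow> inj_on c U"
  by (meson chart_homeo homeomorphism_apply1 inj_on_inverseI)

lemma chart_inv: "(U, c) \<in> A \<Longrightarrow> q \<in> U \<Longrightarrow> inv_into U c (c q) = q"
  by (simp add: chart_inj)

lemma chart_continuous: "(U, c) \<in> A \<Longrightarrow> continuous_on U c"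
  and chart_inv_continuous: "(U, c) \<in> A \<Longrightarrow> continuous_on (c ` U) (inv_into U c)"
  using chart_homeo by (blast intro: homeomorphism_cont1 homeomorphism_cont2)+

lemma chart_image_open:
  assumes "(U, c) \<in> A" "open N" "N \<subseteq> U"
  shows "open (c ` N)"
proof -
  have "c ` N = c ` U \<inter> inv_into U c -` N"
  proof (intro equalityI subsetI)
    fix x assume "x \<in> c ` N"
    then obtain q where "q \<in> N" "x = c q" by blast
    then show "x \<in> c ` U \<inter> inv_into U c -` N"
      using assms(3) chart_inv[OF assms(1), of q] by auto
  next
    fix x assume "x \<in> c ` U \<inter> inv_into U c -` N"
    then obtain q where "q \<in> U" "x = c q" "inv_into U c x \<in> N" by blast
    then show "x \<in> c ` N" using chart_inv[OF assms(1), of q] by auto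
  qed
  then show ?thesis
    using continuous_open_preimage[OF chart_inv_continuous chart_open_image] assms by simp
qed

lemma chart_ex:
  obtains U c where "(U, c) \<in> A" "p \<in> U"
proof -
  have "p \<in> (\<Union>(U, c)\<in>A. U)" using atlas by (simp add: smooth_atlas_def)
  with that show thesis by auto
qed

lemma chart_transition:
  assumes "(U, c) \<in> A" "(V, d) \<in> A"
  shows "smooth_on (c ` (U \<inter> V)) (d \<circ> inv_into U c)"
  using atlas assms unfolding smooth_atlas_def by blast

lemma smooth_functionsI:
  assumes "\<And>U c p. (U, c) \<in> A \<Longrightarrow> p \<in> U \<Longrightarrow>
    \<exists>N. open N \<and> p \<in> N \<and> N \<subseteq> U \<and> smooth_on (c ` N) (\<lambda>x. f (inv_into U c x))"
  shows "f \<in> S"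
proof -
  have "smooth_on (c ` U) (f \<circ> inv_into U c)" if "(U, c) \<in> A" for U c
  proof (rule smooth_on_local)
    fix x assume "x \<in> c ` U"
    then obtain p where p: "p \<in> U" "x = c p" by auto
    obtain N where "open N" "p \<in> N" "N \<subseteq> U" "smooth_on (c ` N) (\<lambda>x. f (inv_into U c x))"
      using assms[OF \<open>(U, c) \<in> A\<close> p(1)] by blast
    then show "\<exists>T. open T \<and> x \<in> T \<and> smooth_on T (f \<circ> inv_into U c)"
      using chart_image_open[OF \<open>(U, c) \<in> A\<close>] p by (intro exI[of _ "c ` N"]) (auto simp: o_def)
  qed
  then show ?thesis by (auto simp: smooth_functions_def)
qed

lemma smooth_functionsD:
  "f \<in> S \<Longrightarrow> (U, c) \<in> A \<Longrightarrow> smooth_on (c ` U) (\<lambda>x. f (inv_into U c x))"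
  by (auto simp: smooth_functions_def o_def)

lemma smooth_functions_local:
  assumes "\<And>p. \<exists>h\<in>S. \<forall>\<^sub>F q in nhds p. f q = h q"
  shows "f \<in> S"
proof (rule smooth_functionsI)
  fix U c p assume Uc: "(U, c) \<in> A" "p \<in> U"
  obtain h M where h: "h \<in> S" "open M" "p \<in> M" "\<And>q. q \<in> M \<Longrightarrow> f q = h q"
    using assms[of p] unfolding eventually_nhds by blast
  have N: "open (U \<inter> M)" using chart_open[OF Uc(1)] h(2) by blast
  have "smooth_on (c ` (U \<inter> M)) (\<lambda>x. h (inv_into U c x))"
    using smooth_functionsD[OF h(1) Uc(1)] by (rule smooth_on_subset) auto
  then have "smooth_on (c ` (U \<inter> M)) (\<lambda>x. f (inv_into U c x))"
    by (rule smooth_on_cong[OF chart_image_open[OF Uc(1) N], rotated])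
      (use h(4) chart_inv[OF Uc(1)] in auto)
  then show "\<exists>N. open N \<and> p \<in> N \<and> N \<subseteq> U \<and> smooth_on (c ` N) (\<lambda>x. f (inv_into U c x))"
    using N Uc h by (intro exI[of _ "U \<inter> M"]) auto
qed

lemma smooth_const [simp]: "(\<lambda>_. a) \<in> S"
  by (auto simp: smooth_functions_def o_def)

lemma smooth_0 [simp]: "0 \<in> S" and smooth_1 [simp]: "1 \<in> S"
  by (simp_all add: zero_fun_def one_fun_def)

lemma smooth_add [simp]: "f \<in> S \<Longrightarrow> h \<in> S \<Longrightarrow> f + h \<in> S"
  unfolding smooth_functions_def
  by (auto simp: o_def chart_open_image intro!: smooth_on_add)

lemma smooth_mult [simp]: "f \<in> S \<Longrightarrow> h \<in> S \<Longrightarrow> f * h \<in> S"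
  unfolding smooth_functions_def
  by (auto simp: o_def chart_open_image intro!: smooth_on_mult)

lemma smooth_cmult [simp]: "f \<in> S \<Longrightarrow> (\<lambda>x. a * f x) \<in> S"
  using smooth_mult[OF smooth_const[of a]] by (simp add: times_fun_def)

lemma smooth_uminus [simp]: "f \<in> S \<Longrightarrow> - f \<in> S"
  using smooth_cmult[of f "-1"] by (simp add: fun_Compl_def)

lemma smooth_diff [simp]: "f \<in> S \<Longrightarrow> h \<in> S \<Longrightarrow> f - h \<in> S"
  using smooth_add[OF _ smooth_uminus] by simp

lemma smooth_sum [simp]: "(\<And>i. i \<in> I \<Longrightarrow> f i \<in> S) \<Longrightarrow> (\<Sum>i\<in>I. f i) \<in> S"
  by (induction I rule: infinite_finite_induct) auto

lemma smooth_continuous: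
  assumes "f \<in> S"
  shows "isCont f p"
proof -
  obtain U c where Uc: "(U, c) \<in> A" "p \<in> U" by (rule chart_ex)
  have "continuous_on U (\<lambda>q. f (inv_into U c (c q)))"
    by (rule continuous_on_compose2[OF smooth_on_continuous[OF smooth_functionsD[OF assms Uc(1)]]])
      (auto intro: chart_continuous Uc)
  then have "continuous_on U f"
    by (rule continuous_on_cong[THEN iffD1, rotated 2]) (auto simp: chart_inv Uc)
  then show ?thesis using Uc chart_open continuous_on_eq_continuous_at by blast
qed

text \<open>A bump in the chart vanishes outside a compact set \<open>K\<close> inside
  \<open>N\<close>. The last clause turns a function given only in the chart into a global smooth
  function: points outside \<open>N\<close> lie in the open complement of \<open>K\<close>, where
  the extension is constantly 0.\<close>

lemma cutoff:
  assumes Uc: "(U, c) \<in> A" and N: "open N" "p \<in> N" "N \<subseteq> U"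
  obtains \<rho> where "\<rho> \<in> S" "\<forall>\<^sub>F q in nhds p. \<rho> q = 1" "\<And>q. q \<notin> N \<Longrightarrow> \<rho> q = 0"
    "\<And>F. smooth_on (c ` N) F \<Longrightarrow> (\<lambda>q. if q \<in> N then \<rho> q * F (c q) else 0) \<in> S"
proof -
  have W: "open (c ` N)" "c p \<in> c ` N" using chart_image_open[OF Uc] N by auto
  then obtain e where e: "e > 0" "cball (c p) e \<subseteq> c ` N" using open_contains_cball by meson
  define r where "r = e / 2"
  have r: "r > 0" "cball (c p) (2 * r) \<subseteq> c ` N" using e by (auto simp: r_def)
  obtain b where b: "smooth_on UNIV b" "\<And>x. x \<in> ball (c p) r \<Longrightarrow> b x = (1::real)"
      "\<And>x. x \<notin> ball (c p) (2 * r) \<Longrightarrow> b x = 0"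
    using smooth_bump[OF r(1)] by blast
  define K where "K = inv_into U c ` cball (c p) (2 * r)"
  have "compact K" unfolding K_def
    by (rule compact_continuous_image[OF continuous_on_subset[OF chart_inv_continuous[OF Uc]]])
      (use r N in auto)
  \<comment> \<open>Here the Hausdorff property enters: a compact subset of a chart is closed in the
    whole manifold.\<close>
  then have K: "closed K" by (rule compact_imp_closed)
  have KN: "K \<subseteq> N" unfolding K_def using r(2) chart_inv[OF Uc] N(3) by (force simp: subset_iff)
  define \<rho> where "\<rho> q = (if q \<in> N then b (c q) else 0)" for q
  have \<rho>0: "\<rho> q = 0" if "q \<notin> K" for q
  proof (cases "q \<in> N")
    case True
    then have "c q \<notin> cball (c p) (2 * r)"
      using that chart_inv[OF Uc] N(3) unfolding K_def by (metis image_eqI subsetD)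
    then show ?thesis using b(3)[of "c q"] by (simp add: \<rho>_def)
  qed (simp add: \<rho>_def)
  have main: "(\<lambda>q. if q \<in> N then \<rho> q * F (c q) else 0) \<in> S" if F: "smooth_on (c ` N) F" for F
  proof (rule smooth_functionsI)
    fix V d q assume Vd: "(V, d) \<in> A" "q \<in> V"
    let ?f = "\<lambda>q. if q \<in> N then \<rho> q * F (c q) else 0"
    show "\<exists>M. open M \<and> q \<in> M \<and> M \<subseteq> V \<and> smooth_on (d ` M) (\<lambda>x. ?f (inv_into V d x))"
    proof (cases "q \<in> N")
      case True
      let ?M = "V \<inter> N" and ?\<tau> = "\<lambda>x. c (inv_into V d x)"
      have M: "open ?M" using chart_open[OF Vd(1)] N(1) by blast
      have dM: "open (d ` ?M)" using chart_image_open[OF Vd(1) M] by simp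
      have \<tau>: "smooth_on (d ` ?M) ?\<tau>"
        by (rule smooth_on_subset[OF chart_transition[OF Vd(1) Uc, unfolded o_def]]) (use N(3) in auto)
      have \<tau>N: "?\<tau> ` (d ` ?M) \<subseteq> c ` N" using chart_inv[OF Vd(1)] by auto
      have "smooth_on (d ` ?M) (\<lambda>x. b (?\<tau> x))"
        by (rule smooth_on_compose[OF dM \<tau> _ b(1)]) simp
      moreover have "smooth_on (d ` ?M) (\<lambda>x. F (?\<tau> x))"
        by (rule smooth_on_compose[OF dM \<tau> \<tau>N F])
      ultimately have "smooth_on (d ` ?M) (\<lambda>x. b (?\<tau> x) * F (?\<tau> x))"
        by (rule smooth_on_mult[OF dM])
      then have "smooth_on (d ` ?M) (\<lambda>x. ?f (inv_into V d x))"
        by (rule smooth_on_cong[OF dM]) (auto simp: \<rho>_def chart_inv[OF Vd(1)])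
      then show ?thesis using M Vd(2) True by (intro exI[of _ ?M]) auto
    next
      case False
      let ?M = "V - K"
      have M: "open ?M" using chart_open[OF Vd(1)] K by blast
      have "smooth_on (d ` ?M) (\<lambda>x. ?f (inv_into V d x))"
        by (rule smooth_on_cong[OF chart_image_open[OF Vd(1) M] smooth_on_const[of _ 0]])
          (auto simp: \<rho>0 chart_inv[OF Vd(1)])
      then show ?thesis using M Vd(2) False KN by (intro exI[of _ ?M]) auto
    qed
  qed
  show ?thesis
  proof (rule that)
    have "(\<lambda>q. if q \<in> N then \<rho> q * 1 else 0) = \<rho>" by (auto simp: \<rho>_def)
    with main[OF smooth_on_const[of _ 1]] show "\<rho> \<in> S" by simp
    have "open (N \<inter> c -` ball (c p) r)"
      using continuous_open_preimage[OF continuous_on_subset[OF chart_continuous[OF Uc] N(3)] N(1)] by simp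
    then show "\<forall>\<^sub>F q in nhds p. \<rho> q = 1"
      unfolding eventually_nhds using N(2) r(1) b(2)
      by (intro exI[of _ "N \<inter> c -` ball (c p) r"]) (auto simp: \<rho>_def)
    show "\<rho> q = 0" if "q \<notin> N" for q using that by (simp add: \<rho>_def)
  qed (rule main)
qed

lemma bump_ex:
  assumes "open N" "p \<in> N"
  obtains \<rho> where "\<rho> \<in> S" "\<forall>\<^sub>F q in nhds p. \<rho> q = 1" "\<And>q. q \<notin> N \<Longrightarrow> \<rho> q = 0"
proof -
  obtain U c where Uc: "(U, c) \<in> A" "p \<in> U" by (rule chart_ex)
  have "open (U \<inter> N)" "p \<in> U \<inter> N" using Uc chart_open assms by auto
  then obtain \<rho> where "\<rho> \<in> S" "\<forall>\<^sub>F q in nhds p. \<rho> q = 1" "\<And>q. q \<notin> U \<inter> N \<Longrightarrow> \<rho> q = 0"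
    using cutoff[OF Uc(1)] by (metis inf_le1)
  then show ?thesis using that by blast
qed

text \<open>Tangent vectors act on globally smooth functions only. Local expressions in a chart
  therefore have to be replaced by global functions with the same germ.\<close>

lemma extend_germ:
  assumes Uc: "(U, c) \<in> A" and N: "open N" "p \<in> N" "N \<subseteq> U" and F: "smooth_on (c ` N) F"
  obtains f where "f \<in> S" "\<forall>\<^sub>F q in nhds p. f q = F (c q)"
proof -
  obtain \<rho> where \<rho>: "\<forall>\<^sub>F q in nhds p. \<rho> q = 1"
    "\<And>F. smooth_on (c ` N) F \<Longrightarrow> (\<lambda>q. if q \<in> N then \<rho> q * F (c q) else 0) \<in> S"
    using cutoff[OF Uc N] by metis
  have "\<forall>\<^sub>F q in nhds p. (if q \<in> N then \<rho> q * F (c q) else 0) = F (c q)"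
    using \<rho>(1) eventually_nhds_in_open[OF N(1,2)] by eventually_elim simp
  then show ?thesis using \<rho>(2)[OF F] that by blast
qed

text \<open>By continuity \<open>f\<close> stays nonzero near \<open>p\<close>; the reciprocal is
  smooth there and its germ extends.\<close>

lemma local_inverse:
  assumes "f \<in> S" "f p \<noteq> 0"
  obtains h where "h \<in> S" "\<forall>\<^sub>F q in nhds p. h q * f q = 1"
proof -
  obtain U c where Uc: "(U, c) \<in> A" "p \<in> U" by (rule chart_ex)
  have "\<forall>\<^sub>F q in nhds p. f q \<noteq> 0"
    using smooth_continuous[OF assms(1)] assms(2)
    by (metis isCont_def t1_space_nhds tendsto_at_iff_tendsto_nhds tendsto_imp_eventually_ne)
  then obtain M where M: "open M" "p \<in> M" "\<And>q. q \<in> M \<Longrightarrow> f q \<noteq> 0"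
    unfolding eventually_nhds by blast
  let ?N = "U \<inter> M"
  have N: "open ?N" "p \<in> ?N" "?N \<subseteq> U" using Uc chart_open M by auto
  have "smooth_on (c ` ?N) (\<lambda>x. inverse (f (inv_into U c x)))"
    by (rule smooth_on_inverse[OF chart_image_open[OF Uc(1) N(1,3)]
            smooth_on_subset[OF smooth_functionsD[OF assms(1) Uc(1)]]])
      (use M chart_inv[OF Uc(1)] in auto)
  then obtain h where h: "h \<in> S" "\<forall>\<^sub>F q in nhds p. h q = inverse (f (inv_into U c (c q)))"
    using extend_germ[OF Uc(1) N] by blast
  have "\<forall>\<^sub>F q in nhds p. h q * f q = 1"
    using h(2) eventually_nhds_in_open[OF N(1,2)]
    by eventually_elim (use M(3) chart_inv[OF Uc(1)] in auto)
  then show ?thesis using h(1) that by blast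
qed

end

section \<open>Tangent vectors, vector fields and local frames\<close>

lemma scale_tvec_apply [simp]: "(a *\<^sub>T v) f = a * v f"
  by (simp add: scale_tvec_def)

lemma scale_vfield_apply [simp]: "(f *\<^sub>F X) p = f p *\<^sub>T X p"
  by (simp add: scale_vfield_def)

lemma deriv_along_apply: "deriv_along X f p = X p f"
  by (simp add: deriv_along_def)

lemma sum_apply: "(\<Sum>i\<in>I. F i) p = (\<Sum>i\<in>I. F i p)"
  by (induction I rule: infinite_finite_induct) auto

lemma deriv_along_0 [simp]: "deriv_along 0 f = 0"
  and deriv_along_plus [simp]: "deriv_along (X + Y) f = deriv_along X f + deriv_along Y f"
  and deriv_along_minus [simp]: "deriv_along (X - Y) f = deriv_along X f - deriv_along Y f"
  and deriv_along_scale [simp]: "deriv_along (h *\<^sub>F X) f = h * deriv_along X f"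
  by (auto simp: deriv_along_def)

context smooth_manifold
begin

lemma tangentI:
  assumes "\<And>f h. f \<in> S \<Longrightarrow> h \<in> S \<Longrightarrow> v (f + h) = v f + v h"
    "\<And>f h. f \<in> S \<Longrightarrow> h \<in> S \<Longrightarrow> v (f * h) = v f * h p + f p * v h"
    "\<And>f a. f \<in> S \<Longrightarrow> v (\<lambda>x. a * f x) = a * v f"
    "\<And>f. f \<notin> S \<Longrightarrow> v f = 0"
  shows "v \<in> T p"
  using assms by (auto simp: tangent_space_def)

lemma
  assumes "v \<in> T p"
  shows tangent_add: "f \<in> S \<Longrightarrow> h \<in> S \<Longrightarrow> v (f + h) = v f + v h"
    and tangent_mult: "f \<in> S \<Longrightarrow> h \<in> S \<Longrightarrow> v (f * h) = v f * h p + f p * v h"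
    and tangent_cmult: "f \<in> S \<Longrightarrow> v (\<lambda>x. a * f x) = a * v f"
    and tangent_nonsmooth: "f \<notin> S \<Longrightarrow> v f = 0"
  using assms by (auto simp: tangent_space_def)

lemma tangent_zero [simp]: "0 \<in> T p"
  by (auto intro!: tangentI)

lemma tangent_plus [simp]: "v \<in> T p \<Longrightarrow> w \<in> T p \<Longrightarrow> v + w \<in> T p"
  by (rule tangentI) (auto simp: tangent_add tangent_mult tangent_cmult tangent_nonsmooth algebra_simps)

lemma tangent_scale [simp]: "v \<in> T p \<Longrightarrow> a *\<^sub>T v \<in> T p"
  by (rule tangentI) (auto simp: tangent_add tangent_mult tangent_cmult tangent_nonsmooth algebra_simps)

lemma tangent_uminus [simp]: "v \<in> T p \<Longrightarrow> - v \<in> T p"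
proof -
  have "- v = (-1) *\<^sub>T v" by auto
  then show "v \<in> T p \<Longrightarrow> - v \<in> T p" by (simp only: tangent_scale)
qed

lemma tangent_minus [simp]: "v \<in> T p \<Longrightarrow> w \<in> T p \<Longrightarrow> v - w \<in> T p"
  using tangent_plus[OF _ tangent_uminus] by simp

lemma tangent_sum: "(\<And>i. i \<in> I \<Longrightarrow> v i \<in> T p) \<Longrightarrow> (\<Sum>i\<in>I. v i) \<in> T p"
  by (induction I rule: infinite_finite_induct) auto

lemma tangent_const:
  assumes "v \<in> T p"
  shows "v (\<lambda>_. a) = 0"
proof -
  have "v (1 * 1) = v 1 + v 1" by (subst tangent_mult[OF assms]) auto
  then have "v 1 = 0" by simp
  moreover have "(\<lambda>_. a) = (\<lambda>x. a * (1 :: 'a \<Rightarrow> real) x)" by auto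
  ultimately show ?thesis using tangent_cmult[OF assms, of 1 a] by simp
qed

lemma tangent_fun_0: "v \<in> T p \<Longrightarrow> v 0 = 0"
  using tangent_const[of v p 0] by (simp add: zero_fun_def)

lemma tangent_diff:
  assumes "v \<in> T p" "f \<in> S" "h \<in> S"
  shows "v (f - h) = v f - v h"
  using tangent_add[OF assms(1) smooth_diff[OF assms(2,3)] assms(3)] by simp

lemma tangent_fun_sum:
  assumes "v \<in> T p"
  shows "(\<And>i. i \<in> I \<Longrightarrow> f i \<in> S) \<Longrightarrow> v (\<Sum>i\<in>I. f i) = (\<Sum>i\<in>I. v (f i))"
  by (induction I rule: infinite_finite_induct) (auto simp: tangent_add[OF assms] tangent_fun_0[OF assms])

text \<open>With a cutoff \<rho> supported where the functions agree,
  \<open>\<rho> * (f - h)\<close> is 0. The Leibniz rule at \<open>p\<close>, where \<rho> is 1 and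
  \<open>f - h\<close> vanishes, leaves \<open>v f - v h = 0\<close>.\<close>

lemma tangent_local:
  assumes v: "v \<in> T p" and f: "f \<in> S" "h \<in> S" and eq: "\<forall>\<^sub>F q in nhds p. f q = h q"
  shows "v f = v h"
proof -
  obtain N where N: "open N" "p \<in> N" "\<And>q. q \<in> N \<Longrightarrow> f q = h q"
    using eq unfolding eventually_nhds by blast
  obtain \<rho> where \<rho>: "\<rho> \<in> S" "\<forall>\<^sub>F q in nhds p. \<rho> q = 1" "\<And>q. q \<notin> N \<Longrightarrow> \<rho> q = 0"
    using bump_ex[OF N(1,2)] by blast
  have "\<rho> * (f - h) = 0"
  proof
    fix q show "(\<rho> * (f - h)) q = 0 q" by (cases "q \<in> N") (auto simp: N \<rho>)
  qed
  moreover have "\<rho> p = 1" using \<rho>(2) by (rule eventually_nhds_x_imp_x)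
  ultimately have "v f - v h = 0"
    using tangent_mult[OF v \<rho>(1) smooth_diff[OF f]] N(2,3) by (simp add: tangent_diff[OF v f] tangent_fun_0[OF v])
  then show ?thesis by simp
qed

lemma vf_tangent [simp]: "X \<in> \<Gamma> \<Longrightarrow> X p \<in> T p"
  and vf_smooth [simp]: "X \<in> \<Gamma> \<Longrightarrow> f \<in> S \<Longrightarrow> deriv_along X f \<in> S"
  by (auto simp: vector_fields_def)

lemma vfI: "(\<And>p. X p \<in> T p) \<Longrightarrow> (\<And>f. f \<in> S \<Longrightarrow> deriv_along X f \<in> S) \<Longrightarrow> X \<in> \<Gamma>"
  unfolding vector_fields_def by blast

lemma vf_0 [simp]: "0 \<in> \<Gamma>"
  and vf_plus [simp]: "X \<in> \<Gamma> \<Longrightarrow> Y \<in> \<Gamma> \<Longrightarrow> X + Y \<in> \<Gamma>"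
  and vf_minus [simp]: "X \<in> \<Gamma> \<Longrightarrow> Y \<in> \<Gamma> \<Longrightarrow> X - Y \<in> \<Gamma>"
  and vf_scale [simp]: "f \<in> S \<Longrightarrow> X \<in> \<Gamma> \<Longrightarrow> f *\<^sub>F X \<in> \<Gamma>"
  by (auto intro!: vfI)

lemma vf_uminus [simp]: "X \<in> \<Gamma> \<Longrightarrow> - X \<in> \<Gamma>"
  using vf_minus[OF vf_0] by simp

lemma vf_sum: "(\<And>i. i \<in> I \<Longrightarrow> X i \<in> \<Gamma>) \<Longrightarrow> (\<Sum>i\<in>I. X i) \<in> \<Gamma>"
  by (induction I rule: infinite_finite_induct) auto

lemma deriv_along_add: "X \<in> \<Gamma> \<Longrightarrow> f \<in> S \<Longrightarrow> h \<in> S \<Longrightarrow> deriv_along X (f + h) = deriv_along X f + deriv_along X h"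
  and deriv_along_diff: "X \<in> \<Gamma> \<Longrightarrow> f \<in> S \<Longrightarrow> h \<in> S \<Longrightarrow> deriv_along X (f - h) = deriv_along X f - deriv_along X h"
  and deriv_along_mult: "X \<in> \<Gamma> \<Longrightarrow> f \<in> S \<Longrightarrow> h \<in> S \<Longrightarrow>
      deriv_along X (f * h) = deriv_along X f * h + f * deriv_along X h"
  and deriv_along_cmult: "X \<in> \<Gamma> \<Longrightarrow> f \<in> S \<Longrightarrow> deriv_along X (\<lambda>x. a * f x) = (\<lambda>x. a * deriv_along X f x)"
  and deriv_along_const: "X \<in> \<Gamma> \<Longrightarrow> deriv_along X (\<lambda>_. a) = 0"
  by (auto simp: deriv_along_def fun_eq_iff tangent_add[OF vf_tangent] tangent_diff[OF vf_tangent]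
      tangent_mult[OF vf_tangent] tangent_cmult[OF vf_tangent] tangent_const[OF vf_tangent])

lemma deriv_along_fun_0 [simp]: "X \<in> \<Gamma> \<Longrightarrow> deriv_along X 0 = 0"
  using deriv_along_const[of X 0] by (simp add: zero_fun_def)

lemma deriv_along_bracket:
  "deriv_along (bracket X Y) f = deriv_along X (deriv_along Y f) - deriv_along Y (deriv_along X f)"
  by (auto simp: deriv_along_def bracket_def)

lemma vf_bracket [simp]:
  assumes X: "X \<in> \<Gamma>" and Y: "Y \<in> \<Gamma>"
  shows "bracket X Y \<in> \<Gamma>"
proof (rule vfI)
  fix p
  have eq: "bracket X Y p f = deriv_along X (deriv_along Y f) p - deriv_along Y (deriv_along X f) p" for f
    by (simp add: bracket_def deriv_along_def)
  show "bracket X Y p \<in> T p"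
  proof (rule tangentI)
    fix f h assume fh: "f \<in> S" "h \<in> S"
    show "bracket X Y p (f + h) = bracket X Y p f + bracket X Y p h"
      using fh X Y by (simp add: eq deriv_along_add)
    show "bracket X Y p (f * h) = bracket X Y p f * h p + f p * bracket X Y p h"
      using fh X Y by (simp add: eq deriv_along_add deriv_along_mult algebra_simps)
  next
    fix f :: "'a \<Rightarrow> real" and a assume f: "f \<in> S"
    show "bracket X Y p (\<lambda>x. a * f x) = a * bracket X Y p f"
      using f X Y by (simp add: eq deriv_along_cmult algebra_simps)
  next
    \<comment> \<open>On a nonsmooth argument both inner derivatives are the zero function, so the
      extension by zero passes to the bracket.\<close>
    fix f :: "'a \<Rightarrow> real" assume f: "f \<notin> S"
    then have "deriv_along X f = 0" "deriv_along Y f = 0"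
      using X Y by (auto simp: deriv_along_def tangent_nonsmooth[OF vf_tangent])
    then show "bracket X Y p f = 0" using X Y
      by (simp add: eq deriv_along_apply tangent_fun_0[OF vf_tangent])
  qed
  show "deriv_along (bracket X Y) f \<in> S" if "f \<in> S" for f
    using that X Y by (simp add: deriv_along_bracket)
qed

text \<open>The frame consists of coordinate fields and coordinate functions, both multiplied by a
  cutoff. Hadamard's lemma at each \<open>q\<close> near \<open>p\<close> gives the expansion
  \<open>f = f q + \<Sum> (x i - x i q) * k i\<close> with \<open>k i q = E i q f\<close>; applying
  a derivation at \<open>q\<close> expresses it through the frame.\<close>

lemma local_frame:
  obtains E x where "\<And>i. E i \<in> \<Gamma>" "\<And>i. x i \<in> S"
    "\<forall>\<^sub>F q in nhds p. \<forall>v\<in>T q. v = (\<Sum>i\<in>(Basis :: 'e set). v (x i) *\<^sub>T E i q)"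
    "\<And>i j. i \<in> Basis \<Longrightarrow> j \<in> Basis \<Longrightarrow> E i p (x j) = (if i = j then 1 else 0)"
proof -
  obtain U c where Uc: "(U, c) \<in> A" "p \<in> U" by (rule chart_ex)
  note oU = chart_open[OF Uc(1)] and inv = chart_inv[OF Uc(1)]
  obtain \<rho> where \<rho>: "\<rho> \<in> S" "\<forall>\<^sub>F q in nhds p. \<rho> q = 1" "\<And>q. q \<notin> U \<Longrightarrow> \<rho> q = 0"
    "\<And>F. smooth_on (c ` U) F \<Longrightarrow> (\<lambda>q. if q \<in> U then \<rho> q * F (c q) else 0) \<in> S"
    using cutoff[OF Uc(1) oU Uc(2) subset_refl] by blast
  define L where "L f = (\<lambda>x. f (inv_into U c x))" for f :: "'a \<Rightarrow> real"
  have L: "smooth_on (c ` U) (L f)" if "f \<in> S" for f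
    unfolding L_def using smooth_functionsD[OF that Uc(1)] .
  have D: "(L f has_derivative frechet_derivative (L f) (at (c q))) (at (c q))" if "f \<in> S" "q \<in> U" for f q
    using smooth_on_has_derivative[OF L[OF that(1)]] that(2) by blast
  \<comment> \<open>The value 0 on nonsmooth functions is the normalization in
    \<open>tangent_space\<close>; the cutoff makes the field smooth when extended by 0 outside
    \<open>U\<close>.\<close>
  define E where "E i q f = (if q \<in> U \<and> f \<in> S then \<rho> q * frechet_derivative (L f) (at (c q)) i else 0)" for i q f
  define x where "x i q = (if q \<in> U then \<rho> q * (c q \<bullet> i) else 0)" for i :: 'e and q
  have x: "x i \<in> S" for i
    unfolding x_def
    by (rule \<rho>(4)[OF smooth_on_bounded_linear[OF chart_open_image[OF Uc(1)] bounded_linear_inner_left]])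
  have E: "E i \<in> \<Gamma>" for i
  proof (rule vfI)
    fix f assume f: "f \<in> S"
    have "deriv_along (E i) f = (\<lambda>q. if q \<in> U then \<rho> q * frechet_derivative (L f) (at (c q)) i else 0)"
      using f by (auto simp: deriv_along_def E_def)
    then show "deriv_along (E i) f \<in> S"
      using \<rho>(4)[OF smooth_on_frechet_derivative[OF L[OF f]]] by simp
  next
    fix q
    show "E i q \<in> T q"
    proof (cases "q \<in> U")
      case True
      show ?thesis
      proof (rule tangentI)
        fix f h assume fh: "f \<in> S" "h \<in> S"
        note Df = D[OF fh(1) True] and Dh = D[OF fh(2) True]
        have "L (f + h) = (\<lambda>x. L f x + L h x)" by (auto simp: L_def)
        then have "(L (f + h) has_derivative (\<lambda>w. frechet_derivative (L f) (at (c q)) w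
            + frechet_derivative (L h) (at (c q)) w)) (at (c q))"
          using has_derivative_add[OF Df Dh] by simp
        from frechet_derivative_at[OF this, symmetric]
        show "E i q (f + h) = E i q f + E i q h"
          using fh True by (simp add: E_def algebra_simps)
        have "L (f * h) = (\<lambda>x. L f x * L h x)" by (auto simp: L_def)
        then have "(L (f * h) has_derivative (\<lambda>w. L f (c q) * frechet_derivative (L h) (at (c q)) w
            + frechet_derivative (L f) (at (c q)) w * L h (c q))) (at (c q))"
          using has_derivative_mult[OF Df Dh] by simp
        from frechet_derivative_at[OF this, symmetric]
        show "E i q (f * h) = E i q f * h q + f q * E i q h"
          using fh True by (simp add: E_def L_def inv algebra_simps)
      next
        fix f :: "'a \<Rightarrow> real" and a assume f: "f \<in> S"
        have "L (\<lambda>x. a * f x) = (\<lambda>x. a * L f x)" by (auto simp: L_def)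
        then have "(L (\<lambda>x. a * f x) has_derivative (\<lambda>w. a * frechet_derivative (L f) (at (c q)) w)) (at (c q))"
          using has_derivative_mult_right[OF D[OF f True], of a] by simp
        from frechet_derivative_at[OF this, symmetric]
        show "E i q (\<lambda>x. a * f x) = a * E i q f"
          using f True by (simp add: E_def)
      qed (simp add: E_def)
    next
      case False
      then have "E i q = 0" by (auto simp: E_def)
      then show ?thesis by simp
    qed
  qed
  obtain M where M: "open M" "p \<in> M" "M \<subseteq> U" "\<And>q. q \<in> M \<Longrightarrow> \<rho> q = 1"
  proof -
    have "\<forall>\<^sub>F q in nhds p. \<rho> q = 1 \<and> q \<in> U"
      using \<rho>(2) eventually_nhds_in_open[OF oU Uc(2)] by eventually_elim simp
    then show thesis using that unfolding eventually_nhds by (metis subsetI)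
  qed
  have cM: "open (c ` M)" by (rule chart_image_open[OF Uc(1) M(1,3)])
  have Dx: "frechet_derivative (L (x j)) (at (c q)) i = i \<bullet> j" if "q \<in> M" for i j q
  proof -
    have "frechet_derivative (L (x j)) (at (c q)) = frechet_derivative (\<lambda>y. y \<bullet> j) (at (c q))"
      by (rule frechet_derivative_cong_open[OF cM]) (use that M inv in \<open>auto simp: L_def x_def subset_iff\<close>)
    also have "\<dots> = (\<lambda>y. y \<bullet> j)"
      by (rule frechet_derivative_at[symmetric]) (auto intro!: derivative_eq_intros)
    finally show ?thesis by simp
  qed
  have rep: "v f = (\<Sum>i\<in>Basis. v (x i) * E i q f)" if q: "q \<in> M" and v: "v \<in> T q" for q v f
  proof (cases "f \<in> S")
    case False
    then show ?thesis using tangent_nonsmooth[OF v] by (simp add: E_def)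
  next
    case f: True
    obtain e where e: "e > 0" "ball (c q) e \<subseteq> c ` M"
      using cM q open_contains_ball by blast
    have sm: "smooth_on (ball (c q) e) (L f)"
      by (rule smooth_on_subset[OF L[OF f]]) (use e M in blast)
    obtain h where h: "\<And>i. smooth_on (ball (c q) e) (h i)" "\<And>i. h i (c q) = frechet_derivative (L f) (at (c q)) i"
      "\<And>y. y \<in> ball (c q) e \<Longrightarrow> L f y = L f (c q) + (\<Sum>i\<in>Basis. ((y - c q) \<bullet> i) * h i y)"
      by (rule Hadamard[OF _ _ _ sm]) (use e in auto)
    define N where "N = M \<inter> c -` ball (c q) e"
    have N: "open N" "q \<in> N" "N \<subseteq> U"
      using continuous_open_preimage[OF continuous_on_subset[OF chart_continuous[OF Uc(1)] M(3)] M(1)] q M e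
      by (auto simp: N_def)
    have "c ` N \<subseteq> ball (c q) e" by (auto simp: N_def)
    then have "\<exists>k\<in>S. \<forall>\<^sub>F y in nhds q. k y = h i (c y)" for i
      using extend_germ[OF Uc(1) N smooth_on_subset[OF h(1)]] by metis
    then obtain k where k: "\<And>i. k i \<in> S" "\<And>i. \<forall>\<^sub>F y in nhds q. k i y = h i (c y)"
      by metis
    \<comment> \<open>The terms of Hadamard's expansion as global functions, so that
      \<open>v\<close> can be applied; near \<open>q\<close> their sum is \<open>f\<close> minus its
      value at \<open>q\<close>.\<close>
    define u where "u i = (x i - (\<lambda>_. x i q)) * k i" for i
    have u: "u i \<in> S" for i using x k by (simp add: u_def)
    have "\<forall>\<^sub>F y in nhds q. \<forall>i\<in>Basis. k i y = h i (c y)"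
      using k(2) by (simp add: eventually_ball_finite_distrib)
    then have "\<forall>\<^sub>F y in nhds q. f y = ((\<lambda>_. f q) + (\<Sum>i\<in>Basis. u i)) y"
      using eventually_nhds_in_open[OF N(1,2)]
    proof eventually_elim
      case (elim y)
      then have y: "y \<in> M" "c y \<in> ball (c q) e" by (auto simp: N_def)
      have "f y = L f (c y)" using y M inv by (auto simp: L_def)
      also have "\<dots> = f q + (\<Sum>i\<in>Basis. (c y \<bullet> i - c q \<bullet> i) * h i (c y))"
        using h(3)[OF y(2)] q M inv by (auto simp: L_def inner_diff_left)
      also have "(\<Sum>i\<in>Basis. (c y \<bullet> i - c q \<bullet> i) * h i (c y)) = (\<Sum>i\<in>Basis. u i y)"
        by (rule sum.cong) (use elim y q M in \<open>auto simp: u_def x_def\<close>)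
      finally show ?case by (simp add: sum_apply)
    qed
    then have "v f = v ((\<lambda>_. f q) + (\<Sum>i\<in>Basis. u i))"
      by (rule tangent_local[OF v f, rotated]) (intro smooth_add smooth_const smooth_sum u)
    also have "\<dots> = (\<Sum>i\<in>Basis. v (u i))"
      by (simp only: tangent_add[OF v smooth_const smooth_sum[OF u]] tangent_const[OF v]
          tangent_fun_sum[OF v u] add_0)
    also have "\<dots> = (\<Sum>i\<in>Basis. v (x i) * E i q f)"
    proof (rule sum.cong)
      fix i :: 'e assume "i \<in> Basis"
      have "k i q = h i (c q)" using k(2) by (rule eventually_nhds_x_imp_x)
      then have "k i q = E i q f" using q M f by (auto simp: E_def h(2))
      \<comment> \<open>The first factor of \<open>u i\<close> vanishes at \<open>q\<close>, so the
        Leibniz rule leaves one term.\<close>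
      then show "v (u i) = v (x i) * E i q f"
        using x k by (simp add: u_def tangent_mult[OF v] tangent_diff[OF v] tangent_const[OF v])
    qed simp
    finally show ?thesis .
  qed
  show ?thesis
  proof (rule that[OF E x])
    show "\<forall>\<^sub>F q in nhds p. \<forall>v\<in>T q. v = (\<Sum>i\<in>(Basis :: 'e set). v (x i) *\<^sub>T E i q)"
      using eventually_nhds_in_open[OF M(1,2)]
    proof eventually_elim
      case (elim q)
      then show ?case using rep by (auto simp: sum_apply fun_eq_iff)
    qed
    show "E i p (x j) = (if i = j then 1 else 0)" if "i \<in> Basis" "j \<in> Basis" for i j
      using that M x Dx[OF M(2)] by (auto simp: E_def inner_Basis)
  qed
qed

end

section \<open>The Riesz lemma and the Levi-Civita connection\<close>

lemma bracket_anticommute: "bracket Y X = - bracket X Y"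
  by (auto simp: bracket_def fun_eq_iff)

context smooth_manifold
begin

text \<open>Vector fields vanish on nonsmooth functions by convention, so only smooth test functions
  matter.\<close>

lemma vf_eqI:
  assumes "X \<in> \<Gamma>" "Y \<in> \<Gamma>" "\<And>f. f \<in> S \<Longrightarrow> deriv_along X f = deriv_along Y f"
  shows "X = Y"
proof (intro ext)
  fix p f
  show "X p f = Y p f"
  proof (cases "f \<in> S")
    case True
    then show ?thesis using assms(3)[OF True] by (metis deriv_along_apply)
  next
    case False
    then show ?thesis using assms(1,2) by (simp add: tangent_nonsmooth[OF vf_tangent])
  qed
qed

lemma bracket_add_left: "X \<in> \<Gamma> \<Longrightarrow> Y \<in> \<Gamma> \<Longrightarrow> Z \<in> \<Gamma> \<Longrightarrow> bracket (X + Y) Z = bracket X Z + bracket Y Z"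
  by (rule vf_eqI) (auto simp: deriv_along_bracket deriv_along_add)

lemma bracket_add_right: "X \<in> \<Gamma> \<Longrightarrow> Y \<in> \<Gamma> \<Longrightarrow> Z \<in> \<Gamma> \<Longrightarrow> bracket Z (X + Y) = bracket Z X + bracket Z Y"
  by (rule vf_eqI) (auto simp: deriv_along_bracket deriv_along_add)

lemma bracket_scale_right:
  "f \<in> S \<Longrightarrow> X \<in> \<Gamma> \<Longrightarrow> Y \<in> \<Gamma> \<Longrightarrow> bracket X (f *\<^sub>F Y) = deriv_along X f *\<^sub>F Y + f *\<^sub>F bracket X Y"
  by (rule vf_eqI) (auto simp: deriv_along_bracket deriv_along_mult algebra_simps)

lemma bracket_scale_left:
  "f \<in> S \<Longrightarrow> X \<in> \<Gamma> \<Longrightarrow> Y \<in> \<Gamma> \<Longrightarrow> bracket (f *\<^sub>F X) Y = f *\<^sub>F bracket X Y - deriv_along Y f *\<^sub>F X"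
  by (rule vf_eqI) (auto simp: deriv_along_bracket deriv_along_mult algebra_simps)

text \<open>A one-form in module language: a homomorphism from vector fields to functions over the
  smooth functions, with no pointwise values given. That it acts pointwise is derived in
  \<open>smooth_linear_local\<close>.\<close>

definition smooth_linear :: "('a vfield \<Rightarrow> 'a \<Rightarrow> real) \<Rightarrow> bool" where
  "smooth_linear K \<longleftrightarrow> (\<forall>X\<in>\<Gamma>. K X \<in> S) \<and> (\<forall>X\<in>\<Gamma>. \<forall>Y\<in>\<Gamma>. K (X + Y) = K X + K Y) \<and>
     (\<forall>f\<in>S. \<forall>X\<in>\<Gamma>. K (f *\<^sub>F X) = f * K X)"

lemma smooth_linear_sum:
  assumes K: "smooth_linear K" and X: "\<And>i. i \<in> I \<Longrightarrow> X i \<in> \<Gamma>"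
  shows "K (\<Sum>i\<in>I. X i) = (\<Sum>i\<in>I. K (X i))"
proof -
  have "K (0 *\<^sub>F 0) = 0 * K 0" using K unfolding smooth_linear_def by (metis smooth_0 vf_0)
  moreover have "0 *\<^sub>F (0 :: 'a vfield) = 0" by (auto simp: fun_eq_iff)
  ultimately have K0: "K 0 = 0" by simp
  show ?thesis
    using X
  proof (induction I rule: infinite_finite_induct)
    case (insert i I)
    have "K (X i + (\<Sum>i\<in>I. X i)) = K (X i) + K (\<Sum>i\<in>I. X i)"
      using K insert vf_sum[of I X] unfolding smooth_linear_def by blast
    moreover have "K (\<Sum>i\<in>I. X i) = (\<Sum>i\<in>I. K (X i))" using insert by blast
    ultimately show ?case by (simp only: sum.insert[OF insert.hyps])
  qed (simp_all add: K0)
qed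

text \<open>Tensoriality. For a cutoff \<rho> supported where the frame represents tangent vectors,
  \<open>\<rho> *\<^sub>F Z\<close> is globally the combination of the \<open>E i\<close> with the
  smooth coefficients \<open>\<rho> * deriv_along Z (x i)\<close>. Apply \<open>K\<close> and
  evaluate at \<open>p\<close>, where \<rho> is 1.\<close>

lemma smooth_linear_local:
  assumes K: "smooth_linear K" and E: "\<And>i. E i \<in> \<Gamma>" and x: "\<And>i. x i \<in> S"
    and frame: "\<forall>\<^sub>F q in nhds p. \<forall>v\<in>T q. v = (\<Sum>i\<in>I. v (x i) *\<^sub>T E i q)"
    and K0: "\<And>i. i \<in> I \<Longrightarrow> K (E i) p = 0" and Z: "Z \<in> \<Gamma>"
  shows "K Z p = 0"
proof -
  obtain M where M: "open M" "p \<in> M" "\<And>q v. q \<in> M \<Longrightarrow> v \<in> T q \<Longrightarrow> v = (\<Sum>i\<in>I. v (x i) *\<^sub>T E i q)"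
    using frame unfolding eventually_nhds by blast
  obtain \<rho> where \<rho>: "\<rho> \<in> S" "\<forall>\<^sub>F q in nhds p. \<rho> q = 1" "\<And>q. q \<notin> M \<Longrightarrow> \<rho> q = 0"
    using bump_ex[OF M(1,2)] by blast
  have \<rho>p: "\<rho> p = 1" using \<rho>(2) by (rule eventually_nhds_x_imp_x)
  let ?f = "\<lambda>i. \<rho> * deriv_along Z (x i)"
  have f: "?f i \<in> S" for i using \<rho> x Z by simp
  have "\<rho> *\<^sub>F Z = (\<Sum>i\<in>I. ?f i *\<^sub>F E i)"
  proof (intro ext)
    fix q h
    show "(\<rho> *\<^sub>F Z) q h = (\<Sum>i\<in>I. ?f i *\<^sub>F E i) q h"
    proof (cases "q \<in> M")
      case True
      have "Z q h = (\<Sum>i\<in>I. Z q (x i) * E i q h)"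
        using fun_cong[OF M(3)[OF True vf_tangent[OF Z]], of h] by (simp only: sum_apply scale_tvec_apply)
      then show ?thesis by (simp add: sum_apply deriv_along_apply sum_distrib_left mult.assoc)
    next
      case False
      then show ?thesis using \<rho>(3) by (simp add: sum_apply)
    qed
  qed
  then have "K (\<rho> *\<^sub>F Z) = (\<Sum>i\<in>I. K (?f i *\<^sub>F E i))"
    using smooth_linear_sum[OF K, of I "\<lambda>i. ?f i *\<^sub>F E i"] f E vf_scale by metis
  moreover have "K (\<rho> *\<^sub>F Z) = \<rho> * K Z" and "\<And>i. K (?f i *\<^sub>F E i) = ?f i * K (E i)"
    using K f \<rho>(1) Z E unfolding smooth_linear_def by blast+
  ultimately have "\<rho> p * K Z p = (\<Sum>i\<in>I. ?f i p * K (E i) p)"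
    by (metis (no_types, lifting) sum.cong sum_apply times_fun_apply)
  then show ?thesis using K0 \<rho>p by simp
qed

end

section \<open>Riemannian metrics and the representation of one-forms\<close>

locale riemannian_manifold = smooth_manifold A
  for A :: "('a::{t2_space, second_countable_topology}, 'e::euclidean_space) atlas" +
  fixes g :: "'a \<Rightarrow> 'a tvec \<Rightarrow> 'a tvec \<Rightarrow> real"
  assumes metric: "riemannian_metric A g"
begin

abbreviation "G \<equiv> app2 g"

lemma
  assumes "u \<in> T p" "v \<in> T p"
  shows g_add_left: "w \<in> T p \<Longrightarrow> g p (u + v) w = g p u w + g p v w"
    and g_scale_left: "g p (a *\<^sub>T u) v = a * g p u v"
    and g_sym: "g p u v = g p v u"
  using metric assms unfolding riemannian_metric_def by blast+

lemma g_pos: "v \<in> T p \<Longrightarrow> v \<noteq> 0 \<Longrightarrow> g p v v > 0"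
  using metric unfolding riemannian_metric_def by blast

lemma
  assumes "u \<in> T p" "v \<in> T p"
  shows g_add_right: "w \<in> T p \<Longrightarrow> g p w (u + v) = g p w u + g p w v"
    and g_scale_right: "g p u (a *\<^sub>T v) = a * g p u v"
  using assms g_add_left[OF assms] g_scale_left[of v p u] g_sym by (metis tangent_plus, metis tangent_scale)

lemma g_minus_left: "u \<in> T p \<Longrightarrow> v \<in> T p \<Longrightarrow> w \<in> T p \<Longrightarrow> g p (u - v) w = g p u w - g p v w"
  using g_add_left[of "u - v" p v w] by simp

lemma g_zero_left: "w \<in> T p \<Longrightarrow> g p 0 w = 0"
  using g_minus_left[of 0 p 0 w] by simp

lemma g_zero_right: "w \<in> T p \<Longrightarrow> g p w 0 = 0"
  using g_zero_left g_sym[of w p 0] by simp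

lemma g_sum_right:
  "w \<in> T p \<Longrightarrow> (\<And>i. i \<in> I \<Longrightarrow> v i \<in> T p) \<Longrightarrow> g p w (\<Sum>i\<in>I. v i) = (\<Sum>i\<in>I. g p w (v i))"
  by (induction I rule: infinite_finite_induct) (auto simp: g_zero_right g_add_right tangent_sum)

lemma G_apply: "G X Y p = g p (X p) (Y p)"
  by (simp add: app2_def)

lemma G_smooth [simp]: "X \<in> \<Gamma> \<Longrightarrow> Y \<in> \<Gamma> \<Longrightarrow> G X Y \<in> S"
  using metric by (simp add: riemannian_metric_def)

lemma G_sym: "X \<in> \<Gamma> \<Longrightarrow> Y \<in> \<Gamma> \<Longrightarrow> G X Y = G Y X"
  by (simp add: app2_def g_sym[OF vf_tangent vf_tangent])

lemma
  assumes "X \<in> \<Gamma>" "Y \<in> \<Gamma>" "Z \<in> \<Gamma>"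
  shows G_add_left: "G (X + Y) Z = G X Z + G Y Z"
    and G_add_right: "G Z (X + Y) = G Z X + G Z Y"
    and G_minus_left: "G (X - Y) Z = G X Z - G Y Z"
    and G_scale_left: "G (f *\<^sub>F X) Z = f * G X Z"
    and G_scale_right: "G Z (f *\<^sub>F X) = f * G Z X"
  using assms by (auto simp: app2_def fun_eq_iff g_add_left g_add_right g_minus_left g_scale_left g_scale_right)

lemma G_minus_right: "X \<in> \<Gamma> \<Longrightarrow> Y \<in> \<Gamma> \<Longrightarrow> Z \<in> \<Gamma> \<Longrightarrow> G Z (X - Y) = G Z X - G Z Y"
  using G_minus_left[of X Y Z] G_sym[of Z] by simp

lemmas G_linear = G_add_left G_add_right G_minus_left G_minus_right G_scale_left G_scale_right

lemma G_smooth_linear: "W \<in> \<Gamma> \<Longrightarrow> smooth_linear (G W)"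
  by (auto simp: smooth_linear_def G_linear)

lemma G_definite:
  assumes "X \<in> \<Gamma>" "G X X p = 0"
  shows "X p = 0"
  using g_pos[OF vf_tangent[OF assms(1)], of p] assms(2) by (auto simp: G_apply)

text \<open>Definiteness, with the difference of the two fields as test field. Identities between
  vector fields are reduced by this rule to scalar ones.\<close>

lemma G_eqI:
  assumes "X \<in> \<Gamma>" "Y \<in> \<Gamma>" "\<And>Z. Z \<in> \<Gamma> \<Longrightarrow> G X Z = G Y Z"
  shows "X = Y"
proof -
  have "G (X - Y) (X - Y) = 0"
    using assms by (simp add: G_minus_left)
  then have "(X - Y) p = 0" for p
    using G_definite[of "X - Y" p] assms by simp
  then show ?thesis by (auto simp: fun_eq_iff)
qed

text \<open>
  Gram--Schmidt.  Independence at \<open>p\<close> suffices because only \<open>G N (E j) p > 0\<close> is needed for the new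
  orthogonal vector field \<open>N\<close>.
\<close>

lemma local_dual:
  assumes "finite I" "\<And>i. i \<in> I \<Longrightarrow> E i \<in> \<Gamma>"
    and "\<And>c :: 'i \<Rightarrow> real. (\<Sum>i\<in>I. c i *\<^sub>T E i p) = 0 \<Longrightarrow> \<forall>i\<in>I. c i = 0"
    and "\<And>i. i \<in> I \<Longrightarrow> k i \<in> S"
  shows "\<exists>W\<in>\<Gamma>. (\<exists>c. W p = (\<Sum>i\<in>I. c i *\<^sub>T E i p)) \<and> (\<forall>\<^sub>F q in nhds p. \<forall>i\<in>I. G W (E i) q = k i q)"
  using assms
proof (induction I arbitrary: k)
  case empty
  show ?case by (intro bexI[of _ 0]) auto
next
  case (insert j I)
  have indep: "\<forall>i\<in>I. c i = 0" if "(\<Sum>i\<in>I. c i *\<^sub>T E i p) = 0" for c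
  proof -
    define d where "d = c(j := 0)"
    have "(\<Sum>i\<in>I. d i *\<^sub>T E i p) = 0"
      using insert.hyps that by (subst sum.cong[where h = "\<lambda>i. c i *\<^sub>T E i p"]) (auto simp: d_def)
    then have "(\<Sum>i\<in>insert j I. d i *\<^sub>T E i p) = 0"
      using insert.hyps by (simp add: d_def fun_eq_iff)
    then have "\<forall>i\<in>I. d i = 0" using insert.prems(2) by blast
    then show ?thesis using insert.hyps by (auto simp: d_def split: if_splits)
  qed
  have E: "E j \<in> \<Gamma>" "\<And>i. i \<in> I \<Longrightarrow> E i \<in> \<Gamma>" using insert.prems(1) by auto
  note IH = insert.IH[OF E(2) indep]
  obtain W c where W: "W \<in> \<Gamma>" "W p = (\<Sum>i\<in>I. c i *\<^sub>T E i p)" "\<forall>\<^sub>F q in nhds p. \<forall>i\<in>I. G W (E i) q = k i q"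
    using IH[of k] insert.prems(3) by blast
  \<comment> \<open>Near \<open>p\<close>, \<open>P\<close> has the same products with the
    \<open>E i\<close> as \<open>E j\<close>, so \<open>N\<close> is orthogonal to them. The
    induction also records values at \<open>p\<close> as combinations: thus \<open>N p\<close> has
    coefficient 1 at \<open>E j p\<close> and cannot vanish.\<close>
  obtain P d where P: "P \<in> \<Gamma>" "P p = (\<Sum>i\<in>I. d i *\<^sub>T E i p)"
      "\<forall>\<^sub>F q in nhds p. \<forall>i\<in>I. G P (E i) q = G (E j) (E i) q"
    using IH[of "\<lambda>i. G (E j) (E i)"] E G_smooth by blast
  define N where "N = E j - P"
  have N: "N \<in> \<Gamma>" using E P by (simp add: N_def)
  have Np: "N p = (\<Sum>i\<in>insert j I. (if i = j then 1 else - d i) *\<^sub>T E i p)"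
  proof
    fix f
    have "(\<Sum>i\<in>I. (if i = j then 1 else - d i) * E i p f) = (\<Sum>i\<in>I. - (d i * E i p f))"
      using insert.hyps by (intro sum.cong) auto
    moreover have "P p f = (\<Sum>i\<in>I. d i * E i p f)"
      by (simp only: P(2) sum_apply scale_tvec_apply)
    ultimately show "N p f = (\<Sum>i\<in>insert j I. (if i = j then 1 else - d i) *\<^sub>T E i p) f"
      using insert.hyps by (simp add: N_def sum_apply sum_negf)
  qed
  have "N p \<noteq> 0"
  proof
    assume "N p = 0"
    then have "\<forall>i\<in>insert j I. (if i = j then 1 else - d i) = 0"
      by (intro insert.prems(2)) (simp only: Np)
    then show False by simp
  qed
  then have "g p (N p) (N p) > 0" using N by (intro g_pos) auto
  have NE: "\<forall>\<^sub>F q in nhds p. \<forall>i\<in>I. G N (E i) q = 0"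
    using P(3) by eventually_elim (use E P in \<open>simp add: N_def G_minus_left\<close>)
  have "\<forall>i\<in>I. G N (E i) p = 0" using NE by (rule eventually_nhds_x_imp_x)
  then have "g p (N p) (P p) = 0"
    unfolding P(2) using N E by (subst g_sum_right) (auto simp: g_scale_right G_apply)
  \<comment> \<open>Since \<open>N\<close> is orthogonal to \<open>P\<close> at \<open>p\<close>,
    its product with \<open>E j\<close> there is its own square norm, hence positive.\<close>
  moreover have "E j = N + P" by (simp add: N_def)
  ultimately have "G N (E j) p > 0"
    using \<open>g p (N p) (N p) > 0\<close> N P(1) by (simp add: G_apply g_add_right)
  then obtain s where s: "s \<in> S" "\<forall>\<^sub>F q in nhds p. s q * G N (E j) q = 1"
    using local_inverse[of "G N (E j)" p] N E by auto
  \<comment> \<open>The multiple of \<open>N\<close> that corrects the product with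
    \<open>E j\<close> to \<open>k j\<close>; orthogonality keeps the other products.\<close>
  define f where "f = s * (k j - G W (E j))"
  have f: "f \<in> S" using s insert.prems(3) W E by (simp add: f_def)
  show ?case
  proof (intro bexI[of _ "W + f *\<^sub>F N"] conjI)
    show "W + f *\<^sub>F N \<in> \<Gamma>" using W f N by simp
    define c' where "c' i = (if i = j then 0 else c i) + f p * (if i = j then 1 else - d i)" for i
    have "(\<Sum>i\<in>insert j I. c' i *\<^sub>T E i p) =
        (\<Sum>i\<in>insert j I. (if i = j then 0 else c i) *\<^sub>T E i p) + f p *\<^sub>T N p"
      unfolding Np by (auto simp: fun_eq_iff sum_apply c'_def algebra_simps sum.distrib sum_distrib_left)
    also have "(\<Sum>i\<in>insert j I. (if i = j then 0 else c i) *\<^sub>T E i p) = W p"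
    proof -
      have "(\<Sum>i\<in>I. (if i = j then 0 else c i) *\<^sub>T E i p) = (\<Sum>i\<in>I. c i *\<^sub>T E i p)"
        using insert.hyps by (intro sum.cong) auto
      then show ?thesis using insert.hyps by (simp add: W(2) fun_eq_iff)
    qed
    finally have "(W + f *\<^sub>F N) p = (\<Sum>i\<in>insert j I. c' i *\<^sub>T E i p)"
      unfolding plus_fun_apply[of W] scale_vfield_apply by (rule sym)
    then show "\<exists>c. (W + f *\<^sub>F N) p = (\<Sum>i\<in>insert j I. c i *\<^sub>T E i p)" by blast
    show "\<forall>\<^sub>F q in nhds p. \<forall>i\<in>insert j I. G (W + f *\<^sub>F N) (E i) q = k i q"
      using W(3) NE s(2)
    proof eventually_elim
      case (elim q)
      have "G (W + f *\<^sub>F N) (E j) q = G W (E j) q + (s q * G N (E j) q) * (k j q - G W (E j) q)"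
        using W N f E by (simp add: G_linear) (simp add: f_def algebra_simps)
      then have "G (W + f *\<^sub>F N) (E j) q = k j q" using elim(3) by simp
      moreover have "G (W + f *\<^sub>F N) (E i) q = k i q" if "i \<in> I" for i
        using W N f E that elim by (simp add: G_linear)
      ultimately show ?case by blast
    qed
  qed
qed

text \<open>Near each point a field with the prescribed products with a frame exists by
  \<open>local_dual\<close>, and by tensoriality it then represents \<open>K\<close> on all fields.
  Definiteness makes local representatives agree, so they glue to a global one.\<close>

lemma Riesz:
  assumes K: "smooth_linear K"
  shows "\<exists>W\<in>\<Gamma>. \<forall>Z\<in>\<Gamma>. G W Z = K Z"
proof -
  have loc: "\<exists>W\<in>\<Gamma>. \<forall>\<^sub>F q in nhds p. \<forall>Z\<in>\<Gamma>. G W Z q = K Z q" for p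
  proof -
    obtain E x where E: "\<And>i. E i \<in> \<Gamma>" and x: "\<And>i. x i \<in> S"
      and frame: "\<forall>\<^sub>F q in nhds p. \<forall>v\<in>T q. v = (\<Sum>i\<in>(Basis :: 'e set). v (x i) *\<^sub>T E i q)"
      and dual: "\<And>i j. i \<in> Basis \<Longrightarrow> j \<in> Basis \<Longrightarrow> E i p (x j) = (if i = j then 1 else 0)"
      using local_frame[of p] by blast
    have "\<forall>j\<in>Basis. c j = 0" if "(\<Sum>i\<in>Basis. c i *\<^sub>T E i p) = 0" for c
    proof
      fix j :: 'e assume j: "j \<in> Basis"
      have "0 = (\<Sum>i\<in>Basis. c i *\<^sub>T E i p) (x j)" using that by simp
      also have "\<dots> = (\<Sum>i\<in>Basis. if i = j then c i else 0)"
        unfolding sum_apply by (rule sum.cong) (use dual j in auto)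
      also have "\<dots> = c j" using j by simp
      finally show "c j = 0" by simp
    qed
    moreover have "K (E i) \<in> S" for i using K E by (simp add: smooth_linear_def)
    ultimately obtain W where W: "W \<in> \<Gamma>" "\<forall>\<^sub>F q in nhds p. \<forall>i\<in>Basis. G W (E i) q = K (E i) q"
      using local_dual[of "Basis :: 'e set" E p "\<lambda>i. K (E i)"] E by auto
    have lin: "smooth_linear (\<lambda>Z. G W Z - K Z)"
      using K G_smooth_linear[OF W(1)] by (simp add: smooth_linear_def algebra_simps)
    \<comment> \<open>Tensoriality is applied at every \<open>q\<close> near \<open>p\<close>, and
      for this the frame must represent vectors on a neighbourhood of \<open>q\<close>.\<close>
    have "\<forall>\<^sub>F q in nhds p. \<forall>\<^sub>F q in nhds q. \<forall>v\<in>T q. v = (\<Sum>i\<in>(Basis :: 'e set). v (x i) *\<^sub>T E i q)"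
      using frame by (simp add: eventually_eventually)
    then have "\<forall>\<^sub>F q in nhds p. \<forall>Z\<in>\<Gamma>. G W Z q = K Z q"
      using W(2)
    proof eventually_elim
      case (elim q)
      have "(G W (E i) - K (E i)) q = 0" if "i \<in> Basis" for i using elim(2) that by simp
      note vanish = smooth_linear_local[where K = "\<lambda>Z. G W Z - K Z" and I = Basis and p = q
          and E = E and x = x, OF lin E x elim(1) this]
      show ?case
      proof
        fix Z assume "Z \<in> \<Gamma>"
        then have "(G W Z - K Z) q = 0" by (rule vanish[rotated])
        then show "G W Z q = K Z q" by simp
      qed
    qed
    then show ?thesis using W(1) by blast
  qed
  then have "\<forall>p. \<exists>W. W \<in> \<Gamma> \<and> (\<forall>\<^sub>F q in nhds p. \<forall>Z\<in>\<Gamma>. G W Z q = K Z q)" by blast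
  from choice[OF this] obtain V
    where V: "\<And>p. V p \<in> \<Gamma>" "\<And>p. \<forall>\<^sub>F q in nhds p. \<forall>Z\<in>\<Gamma>. G (V p) Z q = K Z q" by blast
  \<comment> \<open>At each point take the value of the representative chosen for that point;
    \<open>W_eq\<close> shows that near \<open>p\<close> it coincides with the smooth field
    \<open>V p\<close>.\<close>
  define W where "W q = V q q" for q
  have VK: "G (V q) Z q = K Z q" if "Z \<in> \<Gamma>" for q Z
    using eventually_nhds_x_imp_x[OF V(2)] that by blast
  have W_eq: "\<forall>\<^sub>F q in nhds p. W q = V p q" for p
    using V(2)[of p]
  proof eventually_elim
    case (elim q)
    have "G (V q - V p) (V q - V p) q = 0"
      using elim VK V(1) by (simp add: G_minus_left)
    then have "(V q - V p) q = 0" by (rule G_definite[OF vf_minus[OF V(1) V(1)]])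
    then show ?case by (simp add: W_def)
  qed
  have "W \<in> \<Gamma>"
  proof (rule vfI)
    show "W p \<in> T p" for p using V(1) by (simp add: W_def)
    show "deriv_along W f \<in> S" if f: "f \<in> S" for f
    proof (rule smooth_functions_local)
      fix p
      show "\<exists>h\<in>S. \<forall>\<^sub>F q in nhds p. deriv_along W f q = h q"
        using W_eq[of p] V(1) f
        by (intro bexI[of _ "deriv_along (V p) f"]) (auto simp: deriv_along_apply elim: eventually_mono)
    qed
  qed
  moreover have "G W Z = K Z" if "Z \<in> \<Gamma>" for Z
    using VK[OF that] by (auto simp: fun_eq_iff G_apply W_def)
  ultimately show ?thesis by blast
qed

end

section \<open>Koszul's formula and the Levi-Civita connection\<close>

lemma torsion_eq_0_iff: "torsion D X Y = 0 \<longleftrightarrow> D X Y - D Y X = bracket X Y"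
  unfolding torsion_def fun_eq_iff by auto

lemma double_cancel: "2 * f = 2 * h \<Longrightarrow> f = h" for f h :: "'a \<Rightarrow> real"
  by (simp add: fun_eq_iff)

context smooth_manifold
begin

lemma
  assumes "linear_connection A D"
  shows conn_vf: "X \<in> \<Gamma> \<Longrightarrow> Y \<in> \<Gamma> \<Longrightarrow> D X Y \<in> \<Gamma>"
    and conn_add_left: "X \<in> \<Gamma> \<Longrightarrow> Y \<in> \<Gamma> \<Longrightarrow> Z \<in> \<Gamma> \<Longrightarrow> D (X + Y) Z = D X Z + D Y Z"
    and conn_add_right: "X \<in> \<Gamma> \<Longrightarrow> Y \<in> \<Gamma> \<Longrightarrow> Z \<in> \<Gamma> \<Longrightarrow> D X (Y + Z) = D X Y + D X Z"
    and conn_scale_left: "f \<in> S \<Longrightarrow> X \<in> \<Gamma> \<Longrightarrow> Y \<in> \<Gamma> \<Longrightarrow> D (f *\<^sub>F X) Y = f *\<^sub>F D X Y"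
    and conn_scale_right: "f \<in> S \<Longrightarrow> X \<in> \<Gamma> \<Longrightarrow> Y \<in> \<Gamma> \<Longrightarrow> D X (f *\<^sub>F Y) = deriv_along X f *\<^sub>F Y + f *\<^sub>F D X Y"
    and conn_outside: "X \<notin> \<Gamma> \<or> Y \<notin> \<Gamma> \<Longrightarrow> D X Y = 0"
  using assms unfolding linear_connection_def by blast+

end

context riemannian_manifold
begin

lemma parallel_metricD:
  assumes "parallel_metric A D g" "X \<in> \<Gamma>" "Y \<in> \<Gamma>" "Z \<in> \<Gamma>"
  shows "deriv_along X (G Y Z) = G (D X Y) Z + G Y (D X Z)"
proof -
  have "deriv_along X (G Y Z) - G (D X Y) Z - G Y (D X Z) = 0"
    using assms unfolding parallel_metric_def by blast
  then show ?thesis by (simp only: diff_diff_eq right_minus_eq)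
qed

lemma G_uminus_left: "X \<in> \<Gamma> \<Longrightarrow> Z \<in> \<Gamma> \<Longrightarrow> G (- X) Z = - G X Z"
  using G_minus_left[of 0 X Z] G_minus_left[of X X Z] by simp

text \<open>The right side of Koszul's formula; for the Levi-Civita connection it is
  \<open>2 * G (D X Y) Z\<close>.\<close>

definition koszul :: "'a vfield \<Rightarrow> 'a vfield \<Rightarrow> 'a vfield \<Rightarrow> 'a \<Rightarrow> real" where
  "koszul X Y Z = deriv_along X (G Y Z) + deriv_along Y (G X Z) - deriv_along Z (G X Y)
     + G (bracket X Y) Z - G (bracket X Z) Y - G (bracket Y Z) X"

lemmas vf_expand = G_linear deriv_along_add deriv_along_mult
  bracket_add_left bracket_add_right bracket_scale_left bracket_scale_right

lemma koszul_smooth: "X \<in> \<Gamma> \<Longrightarrow> Y \<in> \<Gamma> \<Longrightarrow> Z \<in> \<Gamma> \<Longrightarrow> koszul X Y Z \<in> S"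
  by (simp add: koszul_def)

text \<open>Linearity over functions in the third argument is the hypothesis of
  \<open>Riesz\<close>. Linearity in the first argument and the extra term in the second become the
  corresponding axioms of a connection.\<close>

lemma
  assumes "X \<in> \<Gamma>" "Y \<in> \<Gamma>" "Z \<in> \<Gamma>"
  shows koszul_add1: "X' \<in> \<Gamma> \<Longrightarrow> koszul (X + X') Y Z = koszul X Y Z + koszul X' Y Z"
    and koszul_add2: "Y' \<in> \<Gamma> \<Longrightarrow> koszul X (Y + Y') Z = koszul X Y Z + koszul X Y' Z"
    and koszul_add3: "Z' \<in> \<Gamma> \<Longrightarrow> koszul X Y (Z + Z') = koszul X Y Z + koszul X Y Z'"
    and koszul_scale1: "f \<in> S \<Longrightarrow> koszul (f *\<^sub>F X) Y Z = f * koszul X Y Z"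
    and koszul_scale2: "f \<in> S \<Longrightarrow> koszul X (f *\<^sub>F Y) Z = f * koszul X Y Z + 2 * (deriv_along X f * G Y Z)"
    and koszul_scale3: "f \<in> S \<Longrightarrow> koszul X Y (f *\<^sub>F Z) = f * koszul X Y Z"
  using assms by (simp_all add: koszul_def vf_expand G_sym[of Y X] G_sym[of Z X] G_sym[of Z Y] algebra_simps)

lemma koszul_metric:
  assumes "X \<in> \<Gamma>" "Y \<in> \<Gamma>" "Z \<in> \<Gamma>"
  shows "koszul X Y Z + koszul X Z Y = 2 * deriv_along X (G Y Z)"
  using assms by (simp add: koszul_def bracket_anticommute[of Y Z] G_sym[of Z X] G_sym[of Z Y]
      G_uminus_left algebra_simps)

lemma koszul_torsion:
  assumes "X \<in> \<Gamma>" "Y \<in> \<Gamma>" "Z \<in> \<Gamma>"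
  shows "koszul X Y Z - koszul Y X Z = 2 * G (bracket X Y) Z"
  using assms by (simp add: koszul_def bracket_anticommute[of X Y] G_sym[of Y X]
      G_uminus_left algebra_simps)

definition is_levi_civita :: "'a connection \<Rightarrow> bool" where
  "is_levi_civita D \<longleftrightarrow> linear_connection A D \<and> parallel_metric A D g \<and>
     (\<forall>X\<in>\<Gamma>. \<forall>Y\<in>\<Gamma>. torsion D X Y = 0)"

lemma is_levi_civita_koszul:
  assumes D: "is_levi_civita D" and "X \<in> \<Gamma>" "Y \<in> \<Gamma>" "Z \<in> \<Gamma>"
  shows "2 * G (D X Y) Z = koszul X Y Z"
proof -
  have lin: "linear_connection A D" and par: "parallel_metric A D g"
    and br: "\<And>X Y. X \<in> \<Gamma> \<Longrightarrow> Y \<in> \<Gamma> \<Longrightarrow> bracket X Y = D X Y - D Y X"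
    using D unfolding is_levi_civita_def torsion_eq_0_iff by auto
  note [simp] = conn_vf[OF lin]
  show ?thesis
    using assms(2-4)
    by (simp add: koszul_def br parallel_metricD[OF par] G_linear
        G_sym[of X "D _ _"] G_sym[of Y "D _ _"] G_sym[of Z "D _ _"] algebra_simps)
qed

lemma is_levi_civita_unique:
  assumes "is_levi_civita D" "is_levi_civita D'"
  shows "D = D'"
proof (intro ext)
  fix X Y :: "'a vfield" and p f
  have lin: "linear_connection A D" "linear_connection A D'"
    using assms by (auto simp: is_levi_civita_def)
  have "D X Y = D' X Y"
  proof (cases "X \<in> \<Gamma> \<and> Y \<in> \<Gamma>")
    case True
    then have XY: "X \<in> \<Gamma>" "Y \<in> \<Gamma>" by auto
    have "G (D X Y) Z = G (D' X Y) Z" if Z: "Z \<in> \<Gamma>" for Z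
      by (rule double_cancel)
        (simp only: is_levi_civita_koszul[OF assms(1) XY Z] is_levi_civita_koszul[OF assms(2) XY Z])
    then show ?thesis by (rule G_eqI[OF conn_vf[OF lin(1) XY] conn_vf[OF lin(2) XY]])
  next
    case False
    then have "X \<notin> \<Gamma> \<or> Y \<notin> \<Gamma>" by blast
    then show ?thesis using conn_outside[OF lin(1)] conn_outside[OF lin(2)] by simp
  qed
  then show "D X Y p f = D' X Y p f" by simp
qed

text \<open>For fixed \<open>X\<close> and \<open>Y\<close>, half of the Koszul expression is
  represented by a vector field through \<open>Riesz\<close>. Every axiom is then checked by pairing
  with a test field and doubling, which turns it into a property of \<open>koszul\<close>.\<close>

lemma is_levi_civita_ex: "\<exists>D. is_levi_civita D"
proof -
  have "\<exists>W\<in>\<Gamma>. \<forall>Z\<in>\<Gamma>. G W Z = (\<lambda>_. 1/2) * koszul X Y Z" if "X \<in> \<Gamma>" "Y \<in> \<Gamma>" for X Y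
    using that by (intro Riesz) (auto simp: smooth_linear_def koszul_smooth koszul_add3 koszul_scale3 algebra_simps)
  then have "\<forall>X Y. \<exists>W. X \<in> \<Gamma> \<longrightarrow> Y \<in> \<Gamma> \<longrightarrow> W \<in> \<Gamma> \<and> (\<forall>Z\<in>\<Gamma>. G W Z = (\<lambda>_. 1/2) * koszul X Y Z)" by blast
  then obtain W where W: "\<And>X Y. X \<in> \<Gamma> \<Longrightarrow> Y \<in> \<Gamma> \<Longrightarrow> W X Y \<in> \<Gamma>"
    "\<And>X Y Z. X \<in> \<Gamma> \<Longrightarrow> Y \<in> \<Gamma> \<Longrightarrow> Z \<in> \<Gamma> \<Longrightarrow> G (W X Y) Z = (\<lambda>_. 1/2) * koszul X Y Z"
    by (metis (no_types))
  \<comment> \<open>The value 0 outside the vector fields is the convention of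
    \<open>linear_connection\<close>; it makes uniqueness an equality of functions.\<close>
  define D where "D X Y = (if X \<in> \<Gamma> \<and> Y \<in> \<Gamma> then W X Y else 0)" for X Y
  have vf [simp]: "D X Y \<in> \<Gamma>" if "X \<in> \<Gamma>" "Y \<in> \<Gamma>" for X Y using that W by (simp add: D_def)
  have D: "2 * G (D X Y) Z = koszul X Y Z" if "X \<in> \<Gamma>" "Y \<in> \<Gamma>" "Z \<in> \<Gamma>" for X Y Z
  proof
    fix p
    show "(2 * G (D X Y) Z) p = koszul X Y Z p" using that W(2)[OF that] by (simp add: D_def)
  qed
  have "linear_connection A D"
    unfolding linear_connection_def
  proof (intro conjI ballI allI impI)
    fix X Y Z f assume XYZ: "X \<in> \<Gamma>" "Y \<in> \<Gamma>" "Z \<in> \<Gamma>"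
    show "D (X + Y) Z = D X Z + D Y Z"
      by (rule G_eqI, use XYZ in simp, use XYZ in simp, rule double_cancel)
        (use XYZ in \<open>simp add: G_linear D koszul_add1 distrib_left\<close>)
    show "D X (Y + Z) = D X Y + D X Z"
      by (rule G_eqI, use XYZ in simp, use XYZ in simp, rule double_cancel)
        (use XYZ in \<open>simp add: G_linear D koszul_add2 distrib_left\<close>)
  next
    fix f X Y assume f: "f \<in> S" and XY: "X \<in> \<Gamma>" "Y \<in> \<Gamma>"
    show "D (f *\<^sub>F X) Y = f *\<^sub>F D X Y"
      by (rule G_eqI, use f XY in simp, use f XY in simp, rule double_cancel)
        (use f XY in \<open>simp add: G_linear D koszul_scale1 mult.left_commute[of 2]\<close>)
    show "D X (f *\<^sub>F Y) = deriv_along X f *\<^sub>F Y + f *\<^sub>F D X Y"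
      by (rule G_eqI, use f XY in simp, use f XY in simp, rule double_cancel)
        (use f XY in \<open>simp add: G_linear D koszul_scale2 distrib_left mult.left_commute[of 2]\<close>)
  qed (auto simp: D_def W(1))
  moreover have "parallel_metric A D g"
    unfolding parallel_metric_def
  proof (intro ballI)
    fix X Y Z assume XYZ: "X \<in> \<Gamma>" "Y \<in> \<Gamma>" "Z \<in> \<Gamma>"
    have "2 * deriv_along X (G Y Z) = 2 * G (D X Y) Z + 2 * G (D X Z) Y"
      using XYZ by (simp add: D koszul_metric)
    then have "2 * deriv_along X (G Y Z) = 2 * (G (D X Y) Z + G Y (D X Z))"
      using XYZ by (simp only: distrib_left G_sym[of Y "D X Z"] vf)
    then have "deriv_along X (G Y Z) = G (D X Y) Z + G Y (D X Z)" by (rule double_cancel)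
    then show "deriv_along X (G Y Z) - G (D X Y) Z - G Y (D X Z) = 0"
      by (simp only: diff_diff_eq right_minus_eq)
  qed
  moreover have "torsion D X Y = 0" if "X \<in> \<Gamma>" "Y \<in> \<Gamma>" for X Y
    unfolding torsion_eq_0_iff
    by (rule G_eqI, use that in simp, use that in simp, rule double_cancel)
      (use that in \<open>simp add: G_linear right_diff_distrib D koszul_torsion\<close>)
  ultimately show ?thesis unfolding is_levi_civita_def by blast
qed

lemma levi_civita_eqI: "is_levi_civita D \<Longrightarrow> levi_civita A g = D"
  unfolding levi_civita_def is_levi_civita_def[symmetric]
  by (rule the_equality) (auto intro: is_levi_civita_unique)

lemma levi_civita: "is_levi_civita (levi_civita A g)"
  using is_levi_civita_ex levi_civita_eqI by metis

end

section \<open>Almost contact metric structures\<close>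

lemma scale_vfield_0 [simp]: "f *\<^sub>F 0 = 0" "0 *\<^sub>F X = 0"
  by (auto simp: fun_eq_iff)

locale almost_contact = riemannian_manifold A g
  for A :: "('a::{t2_space, second_countable_topology}, 'e::euclidean_space) atlas"
    and g :: "'a \<Rightarrow> 'a tvec \<Rightarrow> 'a tvec \<Rightarrow> real" +
  fixes \<phi> :: "'a \<Rightarrow> 'a tvec \<Rightarrow> 'a tvec" and \<xi> :: "'a vfield"
    and \<eta> :: "'a \<Rightarrow> 'a tvec \<Rightarrow> real" and \<alpha> :: real
  assumes acm: "almost_contact_metric A \<phi> \<xi> \<eta> g" and \<alpha>: "\<alpha> > 0"
begin

abbreviation "F \<equiv> app \<phi>"
abbreviation "e \<equiv> app \<eta>"
abbreviation "L \<equiv> lie_endo \<xi> \<phi>"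
abbreviation "H \<equiv> h_prime \<alpha> \<phi> \<xi>"

text \<open>A constant of its own, so that the simplifier treats \<open>\<alpha>\<close> as an element of the ring of functions.\<close>

definition a :: "'a \<Rightarrow> real" where "a = (\<lambda>_. \<alpha>)"

lemma a_apply [simp]: "a p = \<alpha>"
  by (simp add: a_def)

lemma a_smooth [simp]: "a \<in> S"
  by (simp add: a_def)

lemma a_cancel: "a * f = a * h \<Longrightarrow> f = h"
  using \<alpha> by (simp add: fun_eq_iff)

lemma xi_vf [simp]: "\<xi> \<in> \<Gamma>"
  using acm by (simp add: almost_contact_metric_def)

lemma F_vf [simp]: "X \<in> \<Gamma> \<Longrightarrow> F X \<in> \<Gamma>"
  using acm by (simp add: almost_contact_metric_def endo_field_def)

lemma e_smooth [simp]: "X \<in> \<Gamma> \<Longrightarrow> e X \<in> S"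
  using acm by (simp add: almost_contact_metric_def one_form_def)

lemma
  assumes "u \<in> T p"
  shows phi_add: "v \<in> T p \<Longrightarrow> \<phi> p (u + v) = \<phi> p u + \<phi> p v"
    and phi_scale: "\<phi> p (c *\<^sub>T u) = c *\<^sub>T \<phi> p u"
    and phi_vf: "\<phi> p u \<in> T p"
    and eta_add: "v \<in> T p \<Longrightarrow> \<eta> p (u + v) = \<eta> p u + \<eta> p v"
    and eta_scale: "\<eta> p (c *\<^sub>T u) = c * \<eta> p u"
    and phi_phi: "\<phi> p (\<phi> p u) = - u + \<eta> p u *\<^sub>T \<xi> p"
    and eta_phi: "\<eta> p (\<phi> p u) = 0"
    and phi_compat: "v \<in> T p \<Longrightarrow> g p (\<phi> p u) (\<phi> p v) = g p u v - \<eta> p u * \<eta> p v"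
  using acm assms unfolding almost_contact_metric_def endo_field_def one_form_def by simp_all

lemma F_add: "X \<in> \<Gamma> \<Longrightarrow> Y \<in> \<Gamma> \<Longrightarrow> F (X + Y) = F X + F Y"
  by (rule ext) (simp add: app_def phi_add)

lemma F_scale: "X \<in> \<Gamma> \<Longrightarrow> F (f *\<^sub>F X) = f *\<^sub>F F X"
  by (rule ext) (simp add: app_def phi_scale)

lemma e_add: "X \<in> \<Gamma> \<Longrightarrow> Y \<in> \<Gamma> \<Longrightarrow> e (X + Y) = e X + e Y"
  by (rule ext) (simp add: app_def eta_add)

lemma e_scale: "X \<in> \<Gamma> \<Longrightarrow> e (f *\<^sub>F X) = f * e X"
  by (rule ext) (simp add: app_def eta_scale)

lemma F_minus: "X \<in> \<Gamma> \<Longrightarrow> Y \<in> \<Gamma> \<Longrightarrow> F (X - Y) = F X - F Y"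
  using F_add[of "X - Y" Y] by (simp add: eq_diff_eq)

lemma e_minus: "X \<in> \<Gamma> \<Longrightarrow> Y \<in> \<Gamma> \<Longrightarrow> e (X - Y) = e X - e Y"
  using e_add[of "X - Y" Y] by (simp add: eq_diff_eq)

lemma F_0 [simp]: "F 0 = 0" and e_0 [simp]: "e 0 = 0"
  using F_minus[of 0 0] e_minus[of 0 0] by simp_all

lemma F_F: "X \<in> \<Gamma> \<Longrightarrow> F (F X) = e X *\<^sub>F \<xi> - X"
  by (rule ext) (simp add: app_def phi_phi)

lemma e_F [simp]: "X \<in> \<Gamma> \<Longrightarrow> e (F X) = 0"
  by (rule ext) (simp add: app_def eta_phi)

lemma e_xi [simp]: "e \<xi> = 1" and F_xi [simp]: "F \<xi> = 0"
  using acm by (auto simp: app_def fun_eq_iff almost_contact_metric_def)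

lemma G_F_F: "X \<in> \<Gamma> \<Longrightarrow> Y \<in> \<Gamma> \<Longrightarrow> G (F X) (F Y) = G X Y - e X * e Y"
  by (rule ext) (simp add: app_def app2_def phi_compat)

lemma G_0 [simp]: "X \<in> \<Gamma> \<Longrightarrow> G 0 X = 0" "X \<in> \<Gamma> \<Longrightarrow> G X 0 = 0"
  using G_minus_left[of 0 0 X] G_minus_right[of 0 0 X] by simp_all

lemma G_xi_left: "X \<in> \<Gamma> \<Longrightarrow> G \<xi> X = e X"
  using G_F_F[of \<xi> X] by simp

lemma G_xi_right: "X \<in> \<Gamma> \<Longrightarrow> G X \<xi> = e X"
  using G_xi_left G_sym[of X \<xi>] by simp

text \<open>Compatibility for \<open>X\<close> and \<open>F Y\<close>: there \<open>F (F Y)\<close>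
  is \<open>e Y *\<^sub>F \<xi> - Y\<close>, and \<open>F X\<close> is orthogonal to \<xi>.\<close>

lemma F_skew: "X \<in> \<Gamma> \<Longrightarrow> Y \<in> \<Gamma> \<Longrightarrow> G (F X) Y = - G X (F Y)"
  using G_F_F[of X "F Y"] by (simp add: F_F G_linear G_xi_right minus_equation_iff[of "G (F X) Y"] eq_commute)

lemma bracket_0 [simp]: "X \<in> \<Gamma> \<Longrightarrow> bracket X 0 = 0"
  by (rule vf_eqI) (auto simp: deriv_along_bracket)

lemma bracket_self [simp]: "bracket X X = 0"
  by (simp add: bracket_def fun_eq_iff)

lemma bracket_minus_right: "X \<in> \<Gamma> \<Longrightarrow> Y \<in> \<Gamma> \<Longrightarrow> Z \<in> \<Gamma> \<Longrightarrow> bracket Z (X - Y) = bracket Z X - bracket Z Y"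
  using bracket_add_right[of "X - Y" Y Z] by (simp add: eq_diff_eq)

lemma L_vf [simp]: "X \<in> \<Gamma> \<Longrightarrow> L X \<in> \<Gamma>"
  by (simp add: lie_endo_def)

lemma L_add: "X \<in> \<Gamma> \<Longrightarrow> Y \<in> \<Gamma> \<Longrightarrow> L (X + Y) = L X + L Y"
  by (simp add: lie_endo_def F_add bracket_add_right)

lemma L_minus: "X \<in> \<Gamma> \<Longrightarrow> Y \<in> \<Gamma> \<Longrightarrow> L (X - Y) = L X - L Y"
  by (simp add: lie_endo_def F_minus bracket_minus_right)

lemma L_scale: "f \<in> S \<Longrightarrow> X \<in> \<Gamma> \<Longrightarrow> L (f *\<^sub>F X) = f *\<^sub>F L X"
  by (simp add: lie_endo_def F_add F_scale bracket_scale_right) (auto simp: fun_eq_iff algebra_simps)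

lemma L_xi [simp]: "L \<xi> = 0" and L_0 [simp]: "L 0 = 0"
  by (simp_all add: lie_endo_def)

lemma H_eq: "H X = (\<lambda>_. 1 / (2 * \<alpha>)) *\<^sub>F L (F X)"
  by (simp add: h_prime_def)

lemma H_vf [simp]: "X \<in> \<Gamma> \<Longrightarrow> H X \<in> \<Gamma>"
  by (simp add: H_eq)

lemma H_add: "X \<in> \<Gamma> \<Longrightarrow> Y \<in> \<Gamma> \<Longrightarrow> H (X + Y) = H X + H Y"
  by (simp add: H_eq F_add L_add) (auto simp: fun_eq_iff algebra_simps)

lemma H_minus: "X \<in> \<Gamma> \<Longrightarrow> Y \<in> \<Gamma> \<Longrightarrow> H (X - Y) = H X - H Y"
  by (simp add: H_eq F_minus L_minus) (auto simp: fun_eq_iff algebra_simps)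

lemma H_scale: "f \<in> S \<Longrightarrow> X \<in> \<Gamma> \<Longrightarrow> H (f *\<^sub>F X) = f *\<^sub>F H X"
  by (simp add: H_eq F_scale L_scale) (auto simp: fun_eq_iff algebra_simps)

lemma H_xi [simp]: "H \<xi> = 0"
  by (simp add: H_eq)

lemma L_F_eq: "L (F X) = (2 * a) *\<^sub>F H X"
  using \<alpha> by (auto simp: H_eq fun_eq_iff)

definition B :: "'a vfield \<Rightarrow> 'a vfield" where "B X = X + H X"

lemma B_vf [simp]: "X \<in> \<Gamma> \<Longrightarrow> B X \<in> \<Gamma>"
  by (simp add: B_def)

lemma B_xi [simp]: "B \<xi> = \<xi>"
  by (simp add: B_def)

lemma B_add: "X \<in> \<Gamma> \<Longrightarrow> Y \<in> \<Gamma> \<Longrightarrow> B (X + Y) = B X + B Y"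
  and B_minus: "X \<in> \<Gamma> \<Longrightarrow> Y \<in> \<Gamma> \<Longrightarrow> B (X - Y) = B X - B Y"
  and B_scale: "f \<in> S \<Longrightarrow> X \<in> \<Gamma> \<Longrightarrow> B (f *\<^sub>F X) = f *\<^sub>F B X"
  by (auto simp: B_def H_add H_minus H_scale fun_eq_iff algebra_simps)

definition H_symmetric :: bool where
  "H_symmetric \<longleftrightarrow> (\<forall>X\<in>\<Gamma>. \<forall>Y\<in>\<Gamma>. G (H X) Y = G X (H Y))"

lemma H_symmetricD: "H_symmetric \<Longrightarrow> X \<in> \<Gamma> \<Longrightarrow> Y \<in> \<Gamma> \<Longrightarrow> G (H X) Y = G X (H Y)"
  by (simp add: H_symmetric_def)

lemma e_H:
  assumes H_symmetric "X \<in> \<Gamma>"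
  shows "e (H X) = 0"
proof -
  have "e (H X) = G (H X) \<xi>" using assms by (simp add: G_xi_right)
  also have "\<dots> = G X (H \<xi>)" using assms by (simp only: H_symmetricD xi_vf)
  finally show ?thesis using assms by simp
qed

lemma e_B: "H_symmetric \<Longrightarrow> X \<in> \<Gamma> \<Longrightarrow> e (B X) = e X"
  by (simp add: B_def e_add e_H)

lemma G_B_sym: "H_symmetric \<Longrightarrow> X \<in> \<Gamma> \<Longrightarrow> Y \<in> \<Gamma> \<Longrightarrow> G (B X) Y = G X (B Y)"
  by (simp add: B_def G_linear H_symmetricD)

definition eta_closed :: bool where
  "eta_closed \<longleftrightarrow> (\<forall>X\<in>\<Gamma>. \<forall>Y\<in>\<Gamma>. ext_deriv1 e X Y = 0)"

lemma eta_closedD: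
  assumes eta_closed "X \<in> \<Gamma>" "Y \<in> \<Gamma>"
  shows "e (bracket X Y) = deriv_along X (e Y) - deriv_along Y (e X)"
proof -
  have "deriv_along X (e Y) - deriv_along Y (e X) - e (bracket X Y) = 0"
    using assms unfolding eta_closed_def ext_deriv1_def by blast
  then show ?thesis by (simp only: right_minus_eq)
qed

lemma deriv_1 [simp]: "X \<in> \<Gamma> \<Longrightarrow> deriv_along X 1 = 0"
  by (simp add: one_fun_def deriv_along_const)

text \<open>Take the Lie derivative along \<xi> of \<phi>^2 = -I + \<eta> (x) \<xi>. Since \<eta> is
  closed and \<eta>(\<xi>) = 1, the Lie derivative of \<eta> vanishes, and so does that of the right
  side.\<close>

lemma L_F_anticommute:
  assumes eta_closed "X \<in> \<Gamma>"
  shows "F (L X) = - L (F X)"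
proof -
  have "e (bracket \<xi> X) = deriv_along \<xi> (e X)"
    using eta_closedD[OF assms(1) xi_vf assms(2)] assms(2) by simp
  then show ?thesis
    using assms(2)
    by (simp add: lie_endo_def F_minus F_F bracket_minus_right bracket_scale_right)
qed

lemma F_H:
  assumes eta_closed "X \<in> \<Gamma>"
  shows "F (H X) = - H (F X)"
proof -
  have "F (L (F X)) = - L (F (F X))" using L_F_anticommute[OF assms(1)] assms(2) by simp
  then have "F (H X) = (\<lambda>_. 1 / (2 * \<alpha>)) *\<^sub>F - L (F (F X))"
    using assms(2) by (simp add: H_eq F_scale)
  then show ?thesis by (simp add: H_eq) (auto simp: fun_eq_iff)
qed

section \<open>The torsion conditions in closed form\<close>

definition \<tau> :: "'a connection \<Rightarrow> 'a connection" where
  "\<tau> D X Y = D X Y - D Y X - bracket X Y"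

text \<open>\<open>\<tau>\<close> is the torsion in the usual normalization; computations use it to
  avoid the factor 1/2 in \<open>torsion\<close>.\<close>

lemma torsion_\<tau>: "torsion D X Y = (1/2) *\<^sub>C \<tau> D X Y" and \<tau>_torsion: "\<tau> D X Y = 2 *\<^sub>C torsion D X Y"
  by (auto simp: torsion_def \<tau>_def fun_eq_iff)

lemma bracket_\<tau>: "bracket X Y = D X Y - D Y X - \<tau> D X Y"
  by (simp add: \<tau>_def)

definition torsion_formula :: "'a connection \<Rightarrow> bool" where
  "torsion_formula D \<longleftrightarrow> (\<forall>X\<in>\<Gamma>. \<forall>Y\<in>\<Gamma>. \<tau> D X Y = (a * e X) *\<^sub>F B Y - (a * e Y) *\<^sub>F B X)"

lemma torsion_formulaD:
  "torsion_formula D \<Longrightarrow> X \<in> \<Gamma> \<Longrightarrow> Y \<in> \<Gamma> \<Longrightarrow> \<tau> D X Y = (a * e X) *\<^sub>F B Y - (a * e Y) *\<^sub>F B X"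
  by (simp add: torsion_formula_def)

definition hor :: "'a vfield \<Rightarrow> 'a vfield" where "hor X = X - e X *\<^sub>F \<xi>"

lemma horizontal_iff: "X \<in> horizontal_fields A \<eta> \<longleftrightarrow> X \<in> \<Gamma> \<and> e X = 0"
  by (auto simp: horizontal_fields_def app_def fun_eq_iff)

lemma hor_vf [simp]: "X \<in> \<Gamma> \<Longrightarrow> hor X \<in> \<Gamma>"
  by (simp add: hor_def)

lemma e_hor [simp]: "X \<in> \<Gamma> \<Longrightarrow> e (hor X) = 0"
  by (simp add: hor_def e_minus e_scale)

lemma hor_eq: "X = hor X + e X *\<^sub>F \<xi>"
  by (simp add: hor_def)

lemma \<tau>_linear:
  assumes "linear_connection A D" "X \<in> \<Gamma>" "Y \<in> \<Gamma>"
  shows "Z \<in> \<Gamma> \<Longrightarrow> \<tau> D (X + Z) Y = \<tau> D X Y + \<tau> D Z Y"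
    and "Z \<in> \<Gamma> \<Longrightarrow> \<tau> D X (Y + Z) = \<tau> D X Y + \<tau> D X Z"
    and "f \<in> S \<Longrightarrow> \<tau> D (f *\<^sub>F X) Y = f *\<^sub>F \<tau> D X Y"
    and "f \<in> S \<Longrightarrow> \<tau> D X (f *\<^sub>F Y) = f *\<^sub>F \<tau> D X Y"
  using assms(2,3)
  by (auto simp: \<tau>_def conn_add_left[OF assms(1)] conn_add_right[OF assms(1)] conn_scale_left[OF assms(1)]
      conn_scale_right[OF assms(1)] bracket_add_left bracket_add_right bracket_scale_left bracket_scale_right
      fun_eq_iff algebra_simps)

lemma \<tau>_anti: "\<tau> D Y X = - \<tau> D X Y"
  by (simp add: \<tau>_def bracket_anticommute[of X Y])

text \<open>Torsion is tensorial and skew, so the splitting of each field into its horizontal part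
  and a multiple of \<xi> reduces it to the pairs of fields on which conditions a) and b) prescribe
  it.\<close>

lemma \<tau>_hor:
  assumes D: "linear_connection A D" and XY: "X \<in> \<Gamma>" "Y \<in> \<Gamma>"
  shows "\<tau> D X Y = \<tau> D (hor X) (hor Y) + e X *\<^sub>F \<tau> D \<xi> (hor Y) - e Y *\<^sub>F \<tau> D \<xi> (hor X)"
proof -
  have "\<tau> D \<xi> \<xi> = 0" by (simp add: \<tau>_def)
  have "\<tau> D X Y = \<tau> D (hor X + e X *\<^sub>F \<xi>) (hor Y + e Y *\<^sub>F \<xi>)"
    by (simp only: hor_eq[symmetric])
  also have "\<dots> = \<tau> D (hor X) (hor Y) + e Y *\<^sub>F \<tau> D (hor X) \<xi> + e X *\<^sub>F \<tau> D \<xi> (hor Y)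
      + e X *\<^sub>F e Y *\<^sub>F \<tau> D \<xi> \<xi>"
    using XY by (simp add: \<tau>_linear[OF D]) (auto simp: fun_eq_iff algebra_simps)
  finally show ?thesis
    unfolding \<open>\<tau> D \<xi> \<xi> = 0\<close> \<tau>_anti[of D "hor X" \<xi>] by (auto simp: fun_eq_iff)
qed

text \<open>By \<open>\<tau>_hor\<close>, a) and b) determine the whole torsion; passing from
  \<open>B (hor X)\<close> to \<open>B X\<close> is harmless because \<open>B \<xi> = \<xi>\<close>
  and the two \<xi>-terms cancel. In c) the operator is a multiple of
  \<open>B X - e X *\<^sub>F \<xi>\<close>, whose part without h' is symmetric anyway, so c) amounts
  to symmetry of h'.\<close>

lemma canonical_iff:
  "canonical_connection A \<alpha> \<phi> \<xi> \<eta> g D \<longleftrightarrow>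
     linear_connection A D \<and> parallel_endo A D \<phi> \<and> parallel_metric A D g \<and> parallel_form A D \<eta> \<and>
     torsion_formula D \<and> H_symmetric" (is "?C \<longleftrightarrow> ?R")
proof
  assume C: ?C
  then have D: "linear_connection A D" by (simp add: canonical_connection_def)
  have c: "\<forall>X\<in>horizontal_fields A \<eta>. \<forall>Y\<in>horizontal_fields A \<eta>. torsion D X Y = 0"
      "\<forall>X\<in>horizontal_fields A \<eta>. 2 *\<^sub>C torsion D \<xi> X = \<alpha> *\<^sub>C (X + H X)"
      "\<forall>X\<in>\<Gamma>. \<forall>Y\<in>\<Gamma>. G (torsion D \<xi> X) Y = G X (torsion D \<xi> Y)"
    using C unfolding canonical_connection_def by blast+
  have hh: "\<tau> D X Y = 0" if "X \<in> \<Gamma>" "Y \<in> \<Gamma>" "e X = 0" "e Y = 0" for X Y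
  proof -
    have "torsion D X Y = 0" using c(1) that horizontal_iff by blast
    then show ?thesis unfolding \<tau>_torsion by simp
  qed
  have xh: "\<tau> D \<xi> X = a *\<^sub>F B X" if "X \<in> \<Gamma>" "e X = 0" for X
  proof -
    have "X \<in> horizontal_fields A \<eta>" using that by (simp add: horizontal_iff)
    from bspec[OF c(2) this] show ?thesis unfolding \<tau>_torsion a_def B_def .
  qed
  have tf: "torsion_formula D"
    unfolding torsion_formula_def
  proof (intro ballI)
    fix X Y assume XY: "X \<in> \<Gamma>" "Y \<in> \<Gamma>"
    have "\<tau> D X Y = e X *\<^sub>F a *\<^sub>F B (hor Y) - e Y *\<^sub>F a *\<^sub>F B (hor X)"
      unfolding \<tau>_hor[OF D XY] using XY by (simp add: hh xh)
    also have "\<dots> = (a * e X) *\<^sub>F B Y - (a * e Y) *\<^sub>F B X"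
      using XY by (simp add: hor_def B_minus B_scale) (auto simp: fun_eq_iff algebra_simps)
    finally show "\<tau> D X Y = (a * e X) *\<^sub>F B Y - (a * e Y) *\<^sub>F B X" .
  qed
  have "G (H X) Y = G X (H Y)" if XY: "X \<in> \<Gamma>" "Y \<in> \<Gamma>" for X Y
  proof -
    have t: "torsion D \<xi> Z = (\<lambda>_. 1/2) *\<^sub>F (a *\<^sub>F B Z - (a * e Z) *\<^sub>F \<xi>)" if "Z \<in> \<Gamma>" for Z
      using that torsion_formulaD[OF tf xi_vf that] by (simp add: torsion_\<tau>)
    have "G (torsion D \<xi> X) Y = G X (torsion D \<xi> Y)"
      using c(3) XY by blast
    then have "(\<lambda>_. 1/2) * (a * (G X Y + G (H X) Y) - a * e X * e Y)
        = (\<lambda>_. 1/2) * (a * (G X Y + G X (H Y)) - a * e Y * e X)"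
      using XY by (simp add: t G_linear G_xi_left G_xi_right B_def)
    then have "a * G (H X) Y = a * G X (H Y)" by (simp add: fun_eq_iff algebra_simps)
    then show ?thesis by (rule a_cancel)
  qed
  then show ?R using C tf by (simp add: canonical_connection_def H_symmetric_def)
next
  assume R: ?R
  then have tf: "torsion_formula D" and sym: H_symmetric by auto
  have "torsion D X Y = 0" if "X \<in> horizontal_fields A \<eta>" "Y \<in> horizontal_fields A \<eta>" for X Y
    using that torsion_formulaD[OF tf] by (auto simp: horizontal_iff torsion_\<tau> fun_eq_iff)
  moreover have "2 *\<^sub>C torsion D \<xi> X = \<alpha> *\<^sub>C (X + H X)" if "X \<in> horizontal_fields A \<eta>" for X
    using that torsion_formulaD[OF tf, of \<xi> X] unfolding \<tau>_torsion[symmetric]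
    by (simp add: horizontal_iff B_def) (auto simp: fun_eq_iff)
  moreover have "G (torsion D \<xi> X) Y = G X (torsion D \<xi> Y)" if XY: "X \<in> \<Gamma>" "Y \<in> \<Gamma>" for X Y
    using XY torsion_formulaD[OF tf xi_vf]
    by (simp add: torsion_\<tau> G_linear G_xi_left G_xi_right G_B_sym[OF sym] mult_ac)
  ultimately show ?C using R by (simp add: canonical_connection_def)
qed

section \<open>From the connection to the Kenmotsu and integrability conditions\<close>

abbreviation "\<Phi> \<equiv> fundamental_form \<phi> g"

lemma Phi_eq: "\<Phi> X Y = G X (F Y)"
  by (simp add: fundamental_form_def)

lemma Phi_skew: "X \<in> \<Gamma> \<Longrightarrow> Y \<in> \<Gamma> \<Longrightarrow> G Y (F X) = - G X (F Y)"
  using F_skew[of X Y] G_sym[of "F X" Y] by simp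

definition kenmotsu_form :: bool where
  "kenmotsu_form \<longleftrightarrow> (\<forall>X\<in>\<Gamma>. \<forall>Y\<in>\<Gamma>. \<forall>Z\<in>\<Gamma>. ext_deriv2 \<Phi> X Y Z = 2 * a * wedge12 e \<Phi> X Y Z)"

lemma almost_kenmotsu_iff: "almost_kenmotsu A \<alpha> \<phi> \<xi> \<eta> g \<longleftrightarrow> eta_closed \<and> kenmotsu_form"
proof -
  have "(\<lambda>p. 2 * \<alpha> * f p) = 2 * a * f" for f :: "'a \<Rightarrow> real" by auto
  then show ?thesis using acm by (simp add: almost_kenmotsu_def eta_closed_def kenmotsu_form_def)
qed

lemma parallel_formD:
  assumes "parallel_form A D \<eta>" "X \<in> \<Gamma>" "Y \<in> \<Gamma>"
  shows "e (D X Y) = deriv_along X (e Y)"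
proof -
  have "deriv_along X (e Y) - e (D X Y) = 0" using assms unfolding parallel_form_def by blast
  then show ?thesis by (simp only: right_minus_eq)
qed

lemma parallel_endoD:
  assumes "parallel_endo A D \<phi>" "X \<in> \<Gamma>" "Y \<in> \<Gamma>"
  shows "D X (F Y) = F (D X Y)"
proof -
  have "D X (F Y) - F (D X Y) = 0" using assms unfolding parallel_endo_def by blast
  then show ?thesis by (simp only: right_minus_eq)
qed

text \<open>\<xi> is the metric dual of \<eta>, and both the metric and \<eta> are parallel.\<close>

lemma parallel_xi:
  assumes D: "linear_connection A D" "parallel_metric A D g" "parallel_form A D \<eta>" and X: "X \<in> \<Gamma>"
  shows "D X \<xi> = 0"
proof (rule G_eqI)
  fix Y assume Y: "Y \<in> \<Gamma>"
  show "G (D X \<xi>) Y = G 0 Y"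
    using parallel_metricD[OF D(2) X xi_vf Y] X Y
    by (simp add: G_xi_left conn_vf[OF D(1)] parallel_formD[OF D(3)])
qed (use X conn_vf[OF D(1)] in auto)

text \<open>The exterior derivative of a parallel form contains only torsion terms. For \<eta> these
  are multiples of \<open>e X * e Y\<close> that cancel, as \<eta> is preserved by \<open>B\<close>.
  For \<Phi> the identity part of \<open>B\<close> contributes each term of the wedge product twice,
  and the h' part cancels by \<open>HF\<close>.\<close>

lemma canonical_imp_kenmotsu:
  assumes "canonical_connection A \<alpha> \<phi> \<xi> \<eta> g D"
  shows "almost_kenmotsu A \<alpha> \<phi> \<xi> \<eta> g"
proof -
  have D: "linear_connection A D" and F: "parallel_endo A D \<phi>" and g: "parallel_metric A D g"
    and e: "parallel_form A D \<eta>" and tf: "torsion_formula D" and sym: H_symmetric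
    using assms by (auto simp: canonical_iff)
  note [simp] = conn_vf[OF D]
  have cl: eta_closed
    unfolding eta_closed_def ext_deriv1_def
  proof (intro ballI)
    fix X Y assume XY: "X \<in> \<Gamma>" "Y \<in> \<Gamma>"
    then show "deriv_along X (e Y) - deriv_along Y (e X) - e (bracket X Y) = 0"
      by (simp add: bracket_\<tau>[of X Y D] torsion_formulaD[OF tf] e_minus e_scale e_B[OF sym]
          parallel_formD[OF e])
  qed
  \<comment> \<open>h' is symmetric and anticommutes with the skew \<phi>, so \<phi> h' is symmetric
    too.\<close>
  have HF: "G (H Z) (F Y) = G (H Y) (F Z)" if "Y \<in> \<Gamma>" "Z \<in> \<Gamma>" for Y Z
  proof -
    have "G (H Y) (F Z) = G Y (H (F Z))" using that by (simp add: H_symmetricD[OF sym])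
    also have "\<dots> = G Y (- F (H Z))" using that by (simp add: F_H[OF cl])
    also have "\<dots> = - G Y (F (H Z))" using that G_minus_right[of 0 "F (H Z)" Y] by simp
    also have "\<dots> = G (H Z) (F Y)" using that Phi_skew[of "H Z" Y] by simp
    finally show ?thesis by simp
  qed
  have kenmotsu_form
    unfolding kenmotsu_form_def
  proof (intro ballI)
    fix X Y Z assume XYZ: "X \<in> \<Gamma>" "Y \<in> \<Gamma>" "Z \<in> \<Gamma>"
    have d: "deriv_along U (\<Phi> V W) = G (D U V) (F W) - G (D U W) (F V)"
      if "U \<in> \<Gamma>" "V \<in> \<Gamma>" "W \<in> \<Gamma>" for U V W
      using that by (simp add: Phi_eq parallel_metricD[OF g] parallel_endoD[OF F] Phi_skew[of "D U W" V])
    have b: "\<Phi> (bracket U V) W = G (D U V) (F W) - G (D V U) (F W)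
        - a * (e U * (G V (F W) + G (H V) (F W)) - e V * (G U (F W) + G (H U) (F W)))"
      if "U \<in> \<Gamma>" "V \<in> \<Gamma>" "W \<in> \<Gamma>" for U V W
      using that by (simp add: Phi_eq bracket_\<tau>[of U V D] torsion_formulaD[OF tf] G_linear B_def algebra_simps)
    show "ext_deriv2 \<Phi> X Y Z = 2 * a * wedge12 e \<Phi> X Y Z"
      using XYZ by (simp add: ext_deriv2_def wedge12_def d b) (simp add: Phi_eq
          HF[of Y Z] HF[of Z X] HF[of X Y] Phi_skew[of Y Z] Phi_skew[of Z X] Phi_skew[of X Y] algebra_simps)
  qed
  then show ?thesis using cl by (simp add: almost_kenmotsu_iff)
qed

text \<open>On horizontal fields the bracket is \<open>D X Y - D Y X\<close>. Since \<phi> commutes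
  with \<open>D\<close>, all terms cancel by \<phi>^2 = -I on the distribution.\<close>

lemma canonical_imp_CR:
  assumes "canonical_connection A \<alpha> \<phi> \<xi> \<eta> g D"
  shows "CR_integrable A \<phi> \<eta>"
proof -
  have D: "linear_connection A D" and F: "parallel_endo A D \<phi>"
    and e: "parallel_form A D \<eta>" and tf: "torsion_formula D"
    using assms by (auto simp: canonical_iff)
  have cl: eta_closed using canonical_imp_kenmotsu[OF assms] by (simp add: almost_kenmotsu_iff)
  note [simp] = conn_vf[OF D]
  have br: "bracket X Y = D X Y - D Y X" if "X \<in> \<Gamma>" "Y \<in> \<Gamma>" "e X = 0" "e Y = 0" for X Y
    unfolding bracket_\<tau>[of X Y D] using that by (simp add: torsion_formulaD[OF tf])
  have eD: "e (D X Y) = 0" if "X \<in> \<Gamma>" "Y \<in> \<Gamma>" "e Y = 0" for X Y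
    using that by (simp add: parallel_formD[OF e])
  show ?thesis
    unfolding CR_integrable_def
  proof (intro ballI conjI)
    fix X Y assume "X \<in> horizontal_fields A \<eta>" "Y \<in> horizontal_fields A \<eta>"
    then have XY: "X \<in> \<Gamma>" "Y \<in> \<Gamma>" "e X = 0" "e Y = 0" by (auto simp: horizontal_iff)
    show "bracket (F X) (F Y) - bracket X Y \<in> horizontal_fields A \<eta>"
      using XY by (simp add: horizontal_iff e_minus eta_closedD[OF cl])
    show "bracket (F X) (F Y) - bracket X Y - F (bracket (F X) Y + bracket X (F Y)) = 0"
      using XY by (simp add: br parallel_endoD[OF F] F_add F_minus F_F eD)
  qed
qed

section \<open>The Lie derivative of the metric along \<xi>, symmetry of h', and the covariant
  derivative of \<xi>\<close>

definition lie_metric :: "'a vfield \<Rightarrow> 'a vfield \<Rightarrow> 'a \<Rightarrow> real" where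
  "lie_metric X Y = deriv_along \<xi> (G X Y) - G (bracket \<xi> X) Y - G X (bracket \<xi> Y)"

lemma lie_metric_minus: "X \<in> \<Gamma> \<Longrightarrow> Y \<in> \<Gamma> \<Longrightarrow> Z \<in> \<Gamma> \<Longrightarrow> lie_metric X (Y - Z) = lie_metric X Y - lie_metric X Z"
  by (simp add: lie_metric_def G_linear deriv_along_diff bracket_minus_right algebra_simps)

lemma lie_metric_scale: "f \<in> S \<Longrightarrow> X \<in> \<Gamma> \<Longrightarrow> Y \<in> \<Gamma> \<Longrightarrow> lie_metric X (f *\<^sub>F Y) = f * lie_metric X Y"
  by (simp add: lie_metric_def G_linear deriv_along_mult bracket_scale_right algebra_simps)

lemma lie_metric_sym: "X \<in> \<Gamma> \<Longrightarrow> Y \<in> \<Gamma> \<Longrightarrow> lie_metric X Y = lie_metric Y X"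
  by (simp add: lie_metric_def G_sym[of Y X] G_sym[of Y "bracket \<xi> X"] G_sym[of "bracket \<xi> Y" X])

text \<open>The condition \<open>d\<Phi> = 2 \<alpha> \<eta> \<and> \<Phi>\<close> with first argument \<open>\<xi>\<close>.\<close>

lemma kenmotsu_lie_metric_F:
  assumes kenmotsu_form and XY: "X \<in> \<Gamma>" "Y \<in> \<Gamma>"
  shows "lie_metric X (F Y) = 2 * a * G X (F Y) - G X (L Y)"
proof -
  have "ext_deriv2 \<Phi> \<xi> X Y = 2 * a * wedge12 e \<Phi> \<xi> X Y"
    using assms by (simp add: kenmotsu_form_def)
  \<comment> \<open>Cartan's formula: \<xi> contracts \<Phi> to 0, so this is the Lie derivative of
    \<Phi> along \<xi>.\<close>
  moreover have "ext_deriv2 \<Phi> \<xi> X Y = deriv_along \<xi> (G X (F Y)) - G (bracket \<xi> X) (F Y) - G X (F (bracket \<xi> Y))"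
    using XY by (simp add: ext_deriv2_def Phi_eq G_xi_left bracket_anticommute[of Y \<xi>]
        G_uminus_left Phi_skew[of X "bracket \<xi> Y"])
  moreover have "wedge12 e \<Phi> \<xi> X Y = G X (F Y)"
    using XY by (simp add: wedge12_def Phi_eq G_xi_left)
  ultimately have "deriv_along \<xi> (G X (F Y)) - G (bracket \<xi> X) (F Y) - G X (F (bracket \<xi> Y)) = 2 * a * G X (F Y)"
    by metis
  \<comment> \<open>The Leibniz rule for the Lie derivative of \<Phi>, a contraction of
    \<open>g\<close> with \<phi>.\<close>
  moreover have "lie_metric X (F Y) = deriv_along \<xi> (G X (F Y)) - G (bracket \<xi> X) (F Y) - G X (F (bracket \<xi> Y)) - G X (L Y)"
    using XY by (simp add: lie_metric_def lie_endo_def G_linear algebra_simps)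
  ultimately show ?thesis by metis
qed

text \<open>The preceding identity is applied to \<open>F Y\<close> in place of \<open>Y\<close>.
  Then \<open>F (F Y)\<close> returns \<open>- Y\<close> up to a multiple of \<xi>, on which the Lie
  derivative of the metric vanishes by closedness of \<eta>, and \<open>L (F Y)\<close> is
  \<open>2 * a\<close> times h'.\<close>

lemma kenmotsu_lie_metric:
  assumes eta_closed kenmotsu_form and XY: "X \<in> \<Gamma>" "Y \<in> \<Gamma>"
  shows "lie_metric X Y = 2 * a * (G X (B Y) - e X * e Y)"
proof -
  have xi: "lie_metric X \<xi> = 0"
    using XY eta_closedD[OF assms(1) xi_vf XY(1)] by (simp add: lie_metric_def G_xi_right)
  have "lie_metric X (F (F Y)) = - lie_metric X Y"
    using XY by (simp add: F_F lie_metric_minus lie_metric_scale xi)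
  moreover have "lie_metric X (F (F Y)) = 2 * a * G X (F (F Y)) - G X (L (F Y))"
    using XY kenmotsu_lie_metric_F[OF assms(2)] by simp
  moreover have "\<dots> = - (2 * a * (G X (B Y) - e X * e Y))"
    using XY by (simp add: F_F L_F_eq B_def G_linear G_xi_right algebra_simps)
  ultimately show ?thesis by (metis minus_minus)
qed

text \<open>The Lie derivative of a symmetric tensor is symmetric; in its formula h' is the only
  term whose symmetry is in question, and its coefficient \<open>2 * a\<close> can be
  cancelled.\<close>

lemma kenmotsu_H_symmetric:
  assumes eta_closed kenmotsu_form
  shows H_symmetric
  unfolding H_symmetric_def
proof (intro ballI)
  fix X Y assume XY: "X \<in> \<Gamma>" "Y \<in> \<Gamma>"
  have "2 * (a * (G X (B Y) - e X * e Y)) = 2 * (a * (G Y (B X) - e Y * e X))"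
    using lie_metric_sym[OF XY] XY by (simp add: kenmotsu_lie_metric[OF assms] mult.assoc)
  then have "a * (G X (B Y) - e X * e Y) = a * (G Y (B X) - e Y * e X)" by (rule double_cancel)
  then have "G X (B Y) - e X * e Y = G Y (B X) - e Y * e X" by (rule a_cancel)
  then show "G (H X) Y = G X (H Y)"
    using XY by (simp add: B_def G_linear G_sym[of Y X] G_sym[of Y "H X"] mult.commute)
qed

abbreviation "LC \<equiv> levi_civita A g"

lemma LC_linear: "linear_connection A LC" and LC_metric: "parallel_metric A LC g"
  and LC_bracket: "X \<in> \<Gamma> \<Longrightarrow> Y \<in> \<Gamma> \<Longrightarrow> LC X Y - LC Y X = bracket X Y"
  using levi_civita unfolding is_levi_civita_def torsion_eq_0_iff by auto

text \<open>With \<xi> as second argument the Koszul expression is the Lie derivative of the metric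
  plus the exterior derivative of \<eta>, and the latter is 0.\<close>

lemma kenmotsu_LC_xi:
  assumes eta_closed kenmotsu_form and X: "X \<in> \<Gamma>"
  shows "LC X \<xi> = a *\<^sub>F B X - (a * e X) *\<^sub>F \<xi>"
proof (rule G_eqI)
  fix Y assume Y: "Y \<in> \<Gamma>"
  note sym = kenmotsu_H_symmetric[OF assms(1,2)]
  have "2 * G (LC X \<xi>) Y = koszul X \<xi> Y"
    by (rule is_levi_civita_koszul[OF levi_civita X xi_vf Y])
  also have "\<dots> = lie_metric X Y"
    using X Y eta_closedD[OF assms(1) X Y]
    by (simp add: koszul_def lie_metric_def G_xi_left G_xi_right bracket_anticommute[of X \<xi>] G_uminus_left
       G_sym[of X "bracket \<xi> Y"])
  also have "\<dots> = 2 * G (a *\<^sub>F B X - (a * e X) *\<^sub>F \<xi>) Y"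
    using X Y by (simp add: kenmotsu_lie_metric[OF assms(1,2)] G_linear G_xi_left G_B_sym[OF sym] algebra_simps)
  finally show "G (LC X \<xi>) Y = G (a *\<^sub>F B X - (a * e X) *\<^sub>F \<xi>) Y" by (rule double_cancel)
qed (use X conn_vf[OF LC_linear] in auto)

section \<open>The connection defined by the formula\<close>

definition canonical :: "'a connection" where
  "canonical X Y = (if X \<in> \<Gamma> \<and> Y \<in> \<Gamma> then LC X Y + (a * G (B X) Y) *\<^sub>F \<xi> - (a * e Y) *\<^sub>F B X else 0)"

lemma canonical_eq:
  "X \<in> \<Gamma> \<Longrightarrow> Y \<in> \<Gamma> \<Longrightarrow> canonical X Y = LC X Y + (a * G (B X) Y) *\<^sub>F \<xi> - (a * e Y) *\<^sub>F B X"
  by (simp add: canonical_def)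

lemma canonical_linear: "linear_connection A canonical"
  unfolding linear_connection_def
  by (auto simp: canonical_eq conn_vf[OF LC_linear] conn_add_left[OF LC_linear] conn_add_right[OF LC_linear]
      conn_scale_left[OF LC_linear] conn_scale_right[OF LC_linear] G_linear B_add B_scale e_add e_scale
      fun_eq_iff algebra_simps) (auto simp: canonical_def)

text \<open>The added tensor pairs with \<open>Z\<close> to
  \<open>a * (G (B X) Y * e Z - e Y * G (B X) Z)\<close>, which is skew in \<open>Y\<close> and
  \<open>Z\<close>.\<close>

lemma canonical_metric: "parallel_metric A canonical g"
  unfolding parallel_metric_def
proof (intro ballI)
  fix X Y Z assume XYZ: "X \<in> \<Gamma>" "Y \<in> \<Gamma>" "Z \<in> \<Gamma>"
  then show "deriv_along X (G Y Z) - G (canonical X Y) Z - G Y (canonical X Z) = 0"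
    using G_sym[of Y "B X"]
    by (simp add: canonical_eq parallel_metricD[OF LC_metric] conn_vf[OF LC_linear] G_linear G_xi_left G_xi_right
        algebra_simps)
qed

text \<open>The Levi-Civita part has no torsion, and symmetry of \<open>B\<close> cancels the
  \<xi>-components of the added tensor.\<close>

lemma canonical_torsion:
  assumes H_symmetric
  shows "torsion_formula canonical"
  unfolding torsion_formula_def
proof (intro ballI)
  fix X Y assume XY: "X \<in> \<Gamma>" "Y \<in> \<Gamma>"
  have "G (B X) Y = G (B Y) X"
    using G_B_sym[OF assms XY] G_sym[of X "B Y"] XY by simp
  then show "\<tau> canonical X Y = (a * e X) *\<^sub>F B Y - (a * e Y) *\<^sub>F B X"
    using XY by (simp add: \<tau>_def canonical_eq LC_bracket[symmetric])
qed

text \<open>By the formula for \<open>LC X \<xi>\<close>, the added tensor cancels the derivative of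
  \<xi>. A parallel \<xi> and a parallel metric make the dual form \<eta> parallel.\<close>

lemma canonical_form:
  assumes eta_closed kenmotsu_form
  shows "parallel_form A canonical \<eta>"
  unfolding parallel_form_def
proof (intro ballI)
  fix X Y assume XY: "X \<in> \<Gamma>" "Y \<in> \<Gamma>"
  note vf = conn_vf[OF canonical_linear]
  have "canonical X \<xi> = 0"
    using XY e_B[OF kenmotsu_H_symmetric[OF assms] XY(1)]
    by (simp add: canonical_eq kenmotsu_LC_xi[OF assms] G_xi_right)
  then have "deriv_along X (e Y) = e (canonical X Y)"
    using parallel_metricD[OF canonical_metric XY(1) xi_vf XY(2)] XY vf by (simp add: G_xi_left)
  then show "deriv_along X (e Y) - e (canonical X Y) = 0" by (simp only: right_minus_eq)
qed

lemma canonical_endo: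
  assumes cl: eta_closed and kf: kenmotsu_form and CR: "CR_integrable A \<phi> \<eta>"
  shows "parallel_endo A canonical \<phi>"
proof -
  note lin = canonical_linear and met = canonical_metric and form = canonical_form[OF cl kf]
    and tf = canonical_torsion[OF kenmotsu_H_symmetric[OF cl kf]]
  note [simp] = conn_vf[OF lin]
  \<comment> \<open>The covariant derivative of \<phi>. It is shown to vanish with \<xi> in either
    slot, then on the distribution.\<close>
  define P where "P X Y = canonical X (F Y) - F (canonical X Y)" for X Y
  have P_vf [simp]: "P X Y \<in> \<Gamma>" if "X \<in> \<Gamma>" "Y \<in> \<Gamma>" for X Y using that by (simp add: P_def)
  have DF: "canonical X (F Y) = P X Y + F (canonical X Y)" for X Y by (simp add: P_def)
  have xi0: "canonical X \<xi> = 0" if "X \<in> \<Gamma>" for X by (rule parallel_xi[OF lin met form that])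
  have br: "bracket X Y = canonical X Y - canonical Y X" if "X \<in> \<Gamma>" "Y \<in> \<Gamma>" "e X = 0" "e Y = 0" for X Y
    unfolding bracket_\<tau>[of X Y canonical] using that by (simp add: torsion_formulaD[OF tf])
  have eD: "e (canonical X Y) = 0" if "X \<in> \<Gamma>" "Y \<in> \<Gamma>" "e Y = 0" for X Y
    using that by (simp add: parallel_formD[OF form])
  have P_xi_right: "P X \<xi> = 0" if "X \<in> \<Gamma>" for X
  proof -
    have "canonical X 0 = 0"
      using conn_scale_right[OF lin smooth_0 that vf_0] that by simp
    then show ?thesis using that xi0 by (simp add: P_def)
  qed
  \<comment> \<open>As \<xi> is parallel, the derivative along \<xi> is the bracket plus the
    torsion. So \<open>P \<xi>\<close> is \<open>L\<close> plus \<open>a\<close> times the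
    commutator of \<open>B\<close> with \<open>F\<close>, that is plus \<open>2 * a\<close> times h'
    \<phi>, and this equals \<open>- L\<close>.\<close>
  have P_xi_left: "P \<xi> Y = 0" if Y: "Y \<in> \<Gamma>" for Y
  proof -
    have D: "canonical \<xi> W = bracket \<xi> W + a *\<^sub>F B W - (a * e W) *\<^sub>F \<xi>" if "W \<in> \<Gamma>" for W
      using torsion_formulaD[OF tf xi_vf that] that xi0
      by (simp add: bracket_\<tau>[of \<xi> W canonical])
    have "P \<xi> Y = L Y + (2 * a) *\<^sub>F H (F Y)"
      using Y by (simp add: P_def D lie_endo_def B_def F_add F_minus F_scale F_H[OF cl])
        (auto simp: fun_eq_iff algebra_simps)
    also have "\<dots> = L Y + L (F (F Y))" by (simp only: L_F_eq)
    also have "\<dots> = 0"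
      using Y by (simp add: F_F L_minus L_scale)
    finally show ?thesis .
  qed
  \<comment> \<open>\<phi> is skew for the parallel metric, hence so is its covariant
    derivative.\<close>
  have P_skew: "G (P X Y) Z = - G (P X Z) Y" if "X \<in> \<Gamma>" "Y \<in> \<Gamma>" "Z \<in> \<Gamma>" for X Y Z
  proof -
    have s: "G (F Y) Z = - G (F Z) Y" using that F_skew[of Y Z] G_sym[of Y "F Z"] by simp
    have "deriv_along X (- G (F Z) Y) = - deriv_along X (G (F Z) Y)"
      using that deriv_along_diff[of X 0 "G (F Z) Y"] by simp
    then have "G (canonical X (F Y)) Z + G (F Y) (canonical X Z)
        = - (G (canonical X (F Z)) Y + G (F Z) (canonical X Y))"
      unfolding parallel_metricD[OF met that(1) F_vf[OF that(2)] that(3), symmetric]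
        parallel_metricD[OF met that(1) F_vf[OF that(3)] that(2), symmetric] s .
    then have "G (canonical X (F Y)) Z
        = - (G (canonical X (F Z)) Y + G (F Z) (canonical X Y)) - G (F Y) (canonical X Z)"
      by (simp only: eq_diff_eq)
    moreover have "G (F (canonical X U)) V = - G (F V) (canonical X U)" if "U \<in> \<Gamma>" "V \<in> \<Gamma>" for U V
      using that \<open>X \<in> \<Gamma>\<close> by (simp add: F_skew[of "canonical X U"] G_sym[of "F V"])
    ultimately show ?thesis
      using that by (simp add: P_def G_linear)
  qed
  \<comment> \<open>Differentiate \<phi>^2 = -I on the distribution, which the connection
    preserves.\<close>
  have P_F: "P X (F Y) = - F (P X Y)" if "X \<in> \<Gamma>" "Y \<in> \<Gamma>" "e Y = 0" for X Y
  proof -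
    have "canonical X (- Y) = - canonical X Y"
      using conn_add_right[OF lin that(1) _ that(2), of "- Y"] conn_scale_right[OF lin smooth_0 that(1) vf_0] that
      by (simp add: eq_neg_iff_add_eq_0)
    then show ?thesis using that by (simp add: P_def F_minus F_F eD)
  qed
  have e_P: "e (P X Y) = 0" if "X \<in> \<Gamma>" "Y \<in> \<Gamma>" for X Y
    using that by (simp add: P_def e_minus parallel_formD[OF form])
  \<comment> \<open>The wedge product vanishes on the distribution, so \<Phi> has zero exterior
    derivative there. With vanishing torsion this derivative is a cyclic sum of values of
    \<open>P\<close>; skewness brings it to the stated order.\<close>
  have cyc: "G (P X Y) Z + G (P Y Z) X + G (P Z X) Y = 0"
    if "X \<in> \<Gamma>" "Y \<in> \<Gamma>" "Z \<in> \<Gamma>" "e X = 0" "e Y = 0" "e Z = 0" for X Y Z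
  proof -
    have d: "deriv_along U (\<Phi> V W) = G (canonical U V) (F W) - G (canonical U W) (F V) + G (P U W) V"
      if "U \<in> \<Gamma>" "V \<in> \<Gamma>" "W \<in> \<Gamma>" for U V W
      using that by (simp add: Phi_eq parallel_metricD[OF met] DF G_add_right
          Phi_skew[of "canonical U W" V] G_sym[of V "P U W"])
    have "ext_deriv2 \<Phi> X Y Z = 0"
      using that kf by (simp add: kenmotsu_form_def wedge12_def)
    moreover have "ext_deriv2 \<Phi> X Y Z = G (P X Z) Y + G (P Y X) Z + G (P Z Y) X"
      using that by (simp add: ext_deriv2_def d) (simp add: br Phi_eq G_linear algebra_simps)
    ultimately have "G (P X Z) Y + G (P Y X) Z + G (P Z Y) X = 0" by simp
    then show ?thesis
      using that P_skew[of X Z Y] P_skew[of Y X Z] P_skew[of Z Y X]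
      by (simp add: fun_eq_iff) (smt (verit))
  qed
  \<comment> \<open>Brackets of horizontal fields are written through the torsion-free expression.
    In the integrability identity everything except the terms with \<open>P\<close> then
    cancels.\<close>
  have nij: "G (P (F X) Y) Z + G (P X Y) (F Z) = G (P (F Y) X) Z + G (P Y X) (F Z)"
    if "X \<in> \<Gamma>" "Y \<in> \<Gamma>" "Z \<in> \<Gamma>" "e X = 0" "e Y = 0" for X Y Z
  proof -
    have "X \<in> horizontal_fields A \<eta>" "Y \<in> horizontal_fields A \<eta>" using that by (auto simp: horizontal_iff)
    then have "bracket (F X) (F Y) - bracket X Y - F (bracket (F X) Y + bracket X (F Y)) = 0"
      using CR unfolding CR_integrable_def by blast
    moreover have "bracket (F X) (F Y) - bracket X Y - F (bracket (F X) Y + bracket X (F Y))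
        = P (F X) Y - P (F Y) X + F (P Y X) - F (P X Y)"
      using that by (simp add: br DF F_add F_minus F_F eD) 
    ultimately have "G (P (F X) Y - P (F Y) X + F (P Y X) - F (P X Y)) Z = G 0 Z" by metis
    then have "G (P (F X) Y) Z - G (P (F Y) X) Z - G (P Y X) (F Z) + G (P X Y) (F Z) = 0"
      using that by (simp add: G_linear F_skew)
    then show ?thesis by (simp add: algebra_simps)
  qed
  have P_hor: "P X Y = 0" if h: "X \<in> \<Gamma>" "e X = 0" "Y \<in> \<Gamma>" "e Y = 0" for X Y
  proof -
    have zero: "G (P X Y) (F Z) p = 0"
      if h: "X \<in> \<Gamma>" "e X = 0" "Y \<in> \<Gamma>" "e Y = 0" "Z \<in> \<Gamma>" "e Z = 0" for X Y Z p
    proof -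
      text \<open>\<open>q\<close> is symmetric in the first two and skew in the last two arguments, hence zero.\<close>
      define hz where "hz X \<longleftrightarrow> X \<in> \<Gamma> \<and> e X = 0" for X
      define s where "s X Y Z = G (P X Y) Z p" for X Y Z
      define q where "q X Y Z = s (F X) Y Z + s X Y (F Z)" for X Y Z
      have F_hz: "hz (F X)" if "hz X" for X using that by (simp add: hz_def)
      have s1: "s X Y Z = - s X Z Y" if "hz X" "hz Y" "hz Z" for X Y Z
        using that P_skew[of X Y Z] by (simp add: hz_def s_def)
      have s2: "s X (F Y) Z = s X Y (F Z)" if "hz X" "hz Y" "hz Z" for X Y Z
        using that by (simp add: hz_def s_def P_F G_uminus_left F_skew)
      have s3: "s X Y Z + s Y Z X + s Z X Y = 0" if "hz X" "hz Y" "hz Z" for X Y Z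
        using that cyc[of X Y Z, THEN fun_cong, of p] by (simp add: hz_def s_def)
      have q1: "q X Y Z = q Y X Z" if "hz X" "hz Y" "hz Z" for X Y Z
        using that nij[of X Y Z, THEN fun_cong, of p] by (simp add: hz_def s_def q_def)
      have q2: "q X Y Z = - q X Z Y" if "hz X" "hz Y" "hz Z" for X Y Z
        using s1[of "F X" Y Z] s1[of X Y "F Z"] s2[of X Z Y] that F_hz by (simp add: q_def)
      have q0: "q X Y Z = 0" if "hz X" "hz Y" "hz Z" for X Y Z
        using that q1[of X Y Z] q2[of Y X Z] q1[of Y Z X] q2[of Z Y X] q1[of Z X Y] q2[of X Z Y] by simp
      \<comment> \<open>The cyclic identity for \<open>X\<close>, \<open>Y\<close>,
        \<open>F Z\<close>: \<open>s2\<close> moves \<phi> to the last argument in the second term,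
        and the vanishing of \<open>q Z X Y\<close> does so in the third at the cost of a
        sign.\<close>
      have t: "s X Y (F Z) + s Y Z (F X) - s Z X (F Y) = 0" if "hz X" "hz Y" "hz Z" for X Y Z
        using that s3[of X Y "F Z"] s2[of Y Z X] q0[of Z X Y] F_hz by (simp add: q_def)
      have hXYZ: "hz X" "hz Y" "hz Z" using h by (auto simp: hz_def)
      then have "s X Y (F Z) = 0"
        \<comment> \<open>The sum of these two instances is \<open>2 * s X Y (F Z)\<close>.\<close>
        using t[of X Y Z] t[of Z X Y] by simp
      then show ?thesis by (simp add: s_def)
    qed
    show ?thesis
    proof (rule G_eqI)
      fix Z assume Z: "Z \<in> \<Gamma>"
      have FF: "F (F (hor Z)) = e Z *\<^sub>F \<xi> - Z" using Z by (simp add: F_F) (simp add: hor_def)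
      \<comment> \<open>Any \<open>Z\<close> is a multiple of \<xi> minus the \<phi>-image of a
        horizontal field: \<open>zero\<close> treats the image, \<open>e_P\<close> the multiple of
        \<xi>.\<close>
      have Z_eq: "Z = e Z *\<^sub>F \<xi> - F (F (hor Z))" unfolding FF by simp
      have "G (P X Y) (F (F (hor Z))) = 0"
        using zero[OF h, of "F (hor Z)"] Z by (simp add: fun_eq_iff)
      then have "G (P X Y) (e Z *\<^sub>F \<xi> - F (F (hor Z))) = 0"
        using h Z by (simp add: G_linear G_xi_right e_P)
      then show "G (P X Y) Z = G 0 Z" using Z by (simp only: Z_eq[symmetric] G_0)
    qed (use h in auto)
  qed
  have P_add: "P (X + X') Y = P X Y + P X' Y" "P Y (X + X') = P Y X + P Y X'"
    if "X \<in> \<Gamma>" "X' \<in> \<Gamma>" "Y \<in> \<Gamma>" for X X' Y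
    using that by (simp_all add: P_def conn_add_left[OF lin] conn_add_right[OF lin] F_add)
  have P_scale: "P (f *\<^sub>F X) Y = f *\<^sub>F P X Y" "P Y (f *\<^sub>F X) = f *\<^sub>F P Y X"
    if "X \<in> \<Gamma>" "Y \<in> \<Gamma>" "f \<in> S" for X Y f
    using that by (auto simp: P_def conn_scale_left[OF lin] conn_scale_right[OF lin] F_scale F_add
        fun_eq_iff algebra_simps)
  have "P X Y = 0" if XY: "X \<in> \<Gamma>" "Y \<in> \<Gamma>" for X Y
  proof -
    have "P X Y = P (hor X + e X *\<^sub>F \<xi>) (hor Y + e Y *\<^sub>F \<xi>)" by (simp only: hor_eq[symmetric])
    also have "\<dots> = 0"
      using XY by (simp add: P_add P_scale P_xi_left P_xi_right P_hor)
    finally show ?thesis .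
  qed
  then show ?thesis by (simp add: parallel_endo_def P_def)
qed

section \<open>Existence and uniqueness of the connection\<close>

lemma canonical_exists:
  assumes "almost_kenmotsu A \<alpha> \<phi> \<xi> \<eta> g" "CR_integrable A \<phi> \<eta>"
  shows "canonical_connection A \<alpha> \<phi> \<xi> \<eta> g canonical"
proof -
  have k: eta_closed kenmotsu_form using assms(1) by (auto simp: almost_kenmotsu_iff)
  show ?thesis
    using canonical_linear canonical_metric canonical_endo[OF k assms(2)] canonical_form[OF k]
      canonical_torsion[OF kenmotsu_H_symmetric[OF k]] kenmotsu_H_symmetric[OF k]
    by (simp add: canonical_iff)
qed

text \<open>The subtracted tensor is skew for \<open>g\<close> and carries all of the torsion. What
  remains is metric and torsion-free, so it is the Levi-Civita connection.\<close>

lemma canonical_unique: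
  assumes "canonical_connection A \<alpha> \<phi> \<xi> \<eta> g D"
  shows "D = canonical"
proof -
  have D: "linear_connection A D" and met: "parallel_metric A D g"
    and tf: "torsion_formula D" and sym: H_symmetric
    using assms by (auto simp: canonical_iff)
  note vf = conn_vf[OF D]
  define N where "N X Y = (if X \<in> \<Gamma> \<and> Y \<in> \<Gamma> then
      D X Y - (a * G (B X) Y) *\<^sub>F \<xi> + (a * e Y) *\<^sub>F B X else 0)" for X Y
  have N: "N X Y = D X Y - (a * G (B X) Y) *\<^sub>F \<xi> + (a * e Y) *\<^sub>F B X" if "X \<in> \<Gamma>" "Y \<in> \<Gamma>" for X Y
    using that by (simp add: N_def)
  have "linear_connection A N"
    unfolding linear_connection_def
    by (auto simp: N vf conn_add_left[OF D] conn_add_right[OF D]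
        conn_scale_left[OF D] conn_scale_right[OF D] G_linear B_add B_scale e_add e_scale
        fun_eq_iff algebra_simps) (auto simp: N_def)
  moreover have "parallel_metric A N g"
    unfolding parallel_metric_def
  proof (intro ballI)
    fix X Y Z assume XYZ: "X \<in> \<Gamma>" "Y \<in> \<Gamma>" "Z \<in> \<Gamma>"
    then show "deriv_along X (G Y Z) - G (N X Y) Z - G Y (N X Z) = 0"
      using G_sym[of Y "B X"]
      by (simp add: N parallel_metricD[OF met] vf G_linear G_xi_left G_xi_right algebra_simps)
  qed
  moreover have "torsion N X Y = 0" if XY: "X \<in> \<Gamma>" "Y \<in> \<Gamma>" for X Y
  proof -
    have "G (B X) Y = G (B Y) X"
      using G_B_sym[OF sym XY] G_sym[of X "B Y"] XY by simp
    then show ?thesis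
      unfolding torsion_eq_0_iff
      using XY by (simp add: N bracket_\<tau>[of X Y D] torsion_formulaD[OF tf])
  qed
  ultimately have N_LC: "LC = N" by (intro levi_civita_eqI) (simp add: is_levi_civita_def)
  show ?thesis
  proof (intro ext)
    fix X Y :: "'a vfield" and p f
    show "D X Y p f = canonical X Y p f"
    proof (cases "X \<in> \<Gamma> \<and> Y \<in> \<Gamma>")
      case True
      then show ?thesis by (simp add: canonical_eq N_LC N)
    next
      case False
      then have "D X Y = 0" using conn_outside[OF D] by blast
      moreover have "canonical X Y = 0" unfolding canonical_def using False by (rule if_not_P)
      ultimately show ?thesis by simp
    qed
  qed
qed

section \<open>Invariance under homothetic deformations\<close>

context
  fixes \<beta> :: real
  assumes \<beta>: "\<beta> > 0"
begin

abbreviation "\<xi>' \<equiv> deformed_xi \<beta> \<xi>"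
abbreviation "\<eta>' \<equiv> deformed_eta \<beta> \<eta>"
abbreviation "g' \<equiv> deformed_metric \<beta> \<eta> g"

lemma deformed_G: "app2 g' X Y = (\<lambda>_. \<beta>) * G X Y + (\<lambda>_. \<beta> * (\<beta> - 1)) * e X * e Y"
  by (auto simp: app2_def app_def deformed_metric_def)

lemma deformed_e: "app \<eta>' X = (\<lambda>_. \<beta>) * e X"
  by (auto simp: app_def deformed_eta_def)

lemma deformed_riemannian: "riemannian_metric A g'"
proof -
  have "g' p v v > 0" if "v \<in> T p" "v \<noteq> 0" for p v
  proof (cases "\<eta> p v = 0")
    case True
    then show ?thesis using g_pos[OF that] \<beta> by (simp add: deformed_metric_def)
  next
    case False
    \<comment> \<open>For \<beta> < 1 the coefficient of \<eta>^2 is negative. Positivity comes from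
      the regrouping \<beta> (g(v,v) - \<eta>(v)^2) + \<beta>^2 \<eta>(v)^2, in which the first
      bracket is the square norm of \<phi> v.\<close>
    have "g p (\<phi> p v) (\<phi> p v) \<ge> 0"
      using g_pos[OF phi_vf[OF that(1)]] g_zero_left[of 0 p] by (cases "\<phi> p v = 0") auto
    then have "g p v v - \<eta> p v * \<eta> p v \<ge> 0" using phi_compat[OF that(1) that(1)] by simp
    then have "\<beta> * (g p v v - \<eta> p v * \<eta> p v) \<ge> 0" using \<beta> by simp
    moreover have "(\<beta> * \<eta> p v) * (\<beta> * \<eta> p v) > 0" using False \<beta> by (metis less_irrefl mult_eq_0_iff not_real_square_gt_zero)
    ultimately show ?thesis by (simp add: deformed_metric_def algebra_simps)
  qed
  moreover have "app2 g' X Y \<in> S" if "X \<in> \<Gamma>" "Y \<in> \<Gamma>" for X Y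
    unfolding deformed_G using that by (intro smooth_add smooth_mult) auto
  ultimately show ?thesis
    unfolding riemannian_metric_def
    by (auto simp: deformed_metric_def g_add_left g_scale_left eta_add eta_scale algebra_simps intro: g_sym)
qed

lemma deformed_acm: "almost_contact_metric A \<phi> \<xi>' \<eta>' g'"
proof -
  have acm': "endo_field A \<phi>" "\<And>p. \<phi> p (\<xi> p) = 0" "\<And>p. \<eta> p (\<xi> p) = 1"
    using acm by (auto simp: almost_contact_metric_def)
  have "one_form A \<eta>'"
    unfolding one_form_def deformed_e
    by (auto simp: deformed_eta_def eta_add eta_scale algebra_simps intro!: smooth_mult)
  moreover have "\<xi>' \<in> \<Gamma>" by (simp add: deformed_xi_def)
  ultimately show ?thesis
    unfolding almost_contact_metric_def
    using acm' \<beta> deformed_riemannian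
    by (auto simp: deformed_xi_def deformed_eta_def deformed_metric_def phi_phi phi_scale[OF vf_tangent]
        eta_scale[OF vf_tangent] eta_phi phi_compat fun_eq_iff algebra_simps)
qed

text \<open>The deformed structure is again of the same kind, with constant
  \<open>\<alpha> / \<beta>\<close>, so the characterization and uniqueness proved above apply to
  it.\<close>

interpretation deformed: almost_contact A g' \<phi> \<xi>' \<eta>' "\<alpha> / \<beta>"
  by unfold_locales (use deformed_riemannian deformed_acm \<alpha> \<beta> in auto)

text \<open>The Lie derivative along the deformed field has the constant factor
  \<open>1 / \<beta>\<close>, which cancels against \<open>\<alpha> / \<beta>\<close> in the
  denominator of h'.\<close>

lemma deformed_H:
  assumes "X \<in> \<Gamma>"
  shows "deformed.H X = H X"
proof -
  have "lie_endo \<xi>' \<phi> Y = (\<lambda>_. 1 / \<beta>) *\<^sub>F L Y" if "Y \<in> \<Gamma>" for Y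
    using that by (simp add: lie_endo_def deformed_xi_def bracket_scale_left deriv_along_const F_scale)
      (auto simp: fun_eq_iff algebra_simps)
  then show ?thesis using assms \<alpha> \<beta> by (simp add: deformed.H_eq H_eq) (auto simp: fun_eq_iff)
qed

text \<open>The torsion formula contains \<alpha> and \<eta> only through their product, which the
  deformation preserves. The new metric is a constant combination of the parallel tensors
  \<open>g\<close> and \<eta> (x) \<eta>, and h' is symmetric for it because \<eta> vanishes on its
  image.\<close>

lemma canonical_deformed:
  assumes "canonical_connection A \<alpha> \<phi> \<xi> \<eta> g D"
  shows "canonical_connection A (\<alpha> / \<beta>) \<phi> \<xi>' \<eta>' g' D"
proof -
  have D: "linear_connection A D" and F: "parallel_endo A D \<phi>" and met: "parallel_metric A D g"
    and form: "parallel_form A D \<eta>" and tf: "torsion_formula D" and sym: H_symmetric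
    using assms by (auto simp: canonical_iff)
  note [simp] = conn_vf[OF D]
  have "parallel_form A D \<eta>'"
    unfolding parallel_form_def deformed_e
    by (auto simp: deriv_along_mult deriv_along_const parallel_formD[OF form])
  moreover have "parallel_metric A D g'"
    unfolding parallel_metric_def deformed_G
    by (auto simp: deriv_along_add deriv_along_mult deriv_along_const parallel_formD[OF form]
        parallel_metricD[OF met] algebra_simps)
  moreover have "deformed.torsion_formula D"
    unfolding deformed.torsion_formula_def
    using \<beta> by (auto simp: torsion_formulaD[OF tf] deformed.B_def B_def deformed_H deformed_e fun_eq_iff)
  moreover have "deformed.H_symmetric"
    unfolding deformed.H_symmetric_def
    by (auto simp: deformed_G deformed_H e_H[OF sym] H_symmetricD[OF sym])
  ultimately show ?thesis using D F by (simp add: deformed.canonical_iff)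
qed

lemma canonical_deformed_iff:
  assumes "canonical_connection A \<alpha> \<phi> \<xi> \<eta> g D"
  shows "canonical_connection A (\<alpha> / \<beta>) \<phi> \<xi>' \<eta>' g' D' \<longleftrightarrow> D' = D"
  using canonical_deformed[OF assms] deformed.canonical_unique by metis

end

end

theorem theorem6:
  fixes A :: "('a::{t2_space, second_countable_topology}, 'e::euclidean_space) atlas"
    and \<phi> :: "'a \<Rightarrow> 'a tvec \<Rightarrow> 'a tvec" and \<xi> :: "'a vfield"
    and \<eta> :: "'a \<Rightarrow> 'a tvec \<Rightarrow> real" and g :: "'a \<Rightarrow> 'a tvec \<Rightarrow> 'a tvec \<Rightarrow> real"
    and \<alpha> :: real and n :: nat
  assumes "\<alpha> > 0"
    and "smooth_atlas A" and "DIM('e) = 2 * n + 1"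
    and "almost_contact_metric A \<phi> \<xi> \<eta> g"
  shows "((almost_kenmotsu A \<alpha> \<phi> \<xi> \<eta> g \<and> CR_integrable A \<phi> \<eta>) \<longleftrightarrow>
            (\<exists>D. canonical_connection A \<alpha> \<phi> \<xi> \<eta> g D)) \<and>
         (\<forall>D. canonical_connection A \<alpha> \<phi> \<xi> \<eta> g D \<longrightarrow>
            (\<forall>D'. canonical_connection A \<alpha> \<phi> \<xi> \<eta> g D' \<longrightarrow> D' = D) \<and>
            (\<forall>X\<in>vector_fields A. \<forall>Y\<in>vector_fields A.
               D X Y = levi_civita A g X Y
                 + (\<lambda>p. \<alpha> * app2 g (X + h_prime \<alpha> \<phi> \<xi> X) Y p) *\<^sub>F \<xi>
                 - (\<lambda>p. \<alpha> * app \<eta> Y p) *\<^sub>F (X + h_prime \<alpha> \<phi> \<xi> X)) \<and>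
            (\<forall>\<beta>>0. \<forall>D'. canonical_connection A (\<alpha> / \<beta>) \<phi> (deformed_xi \<beta> \<xi>)
                 (deformed_eta \<beta> \<eta>) (deformed_metric \<beta> \<eta> g) D' \<longleftrightarrow> D' = D))"
proof -
  interpret almost_contact A g \<phi> \<xi> \<eta> \<alpha>
    by unfold_locales (use assms in \<open>auto simp: almost_contact_metric_def\<close>)
  \<comment> \<open>Constants are rewritten as the function \<open>a\<close> to match the form of
    \<open>canonical_eq\<close>.\<close>
  have scale: "(\<lambda>p. \<alpha> * f p) = a * f" for f :: "'a \<Rightarrow> real" by auto
  show ?thesis
  proof (intro conjI allI impI iffI ballI)
    assume "almost_kenmotsu A \<alpha> \<phi> \<xi> \<eta> g \<and> CR_integrable A \<phi> \<eta>"
    then show "\<exists>D. canonical_connection A \<alpha> \<phi> \<xi> \<eta> g D" using canonical_exists by blast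
  next
    assume "\<exists>D. canonical_connection A \<alpha> \<phi> \<xi> \<eta> g D"
    then show "almost_kenmotsu A \<alpha> \<phi> \<xi> \<eta> g" "CR_integrable A \<phi> \<eta>"
      using canonical_imp_kenmotsu canonical_imp_CR by blast+
  next
    fix D D' assume "canonical_connection A \<alpha> \<phi> \<xi> \<eta> g D" "canonical_connection A \<alpha> \<phi> \<xi> \<eta> g D'"
    then show "D' = D" using canonical_unique by blast
  next
    fix D X Y assume "canonical_connection A \<alpha> \<phi> \<xi> \<eta> g D" "X \<in> vector_fields A" "Y \<in> vector_fields A"
    then show "D X Y = levi_civita A g X Y
                 + (\<lambda>p. \<alpha> * app2 g (X + h_prime \<alpha> \<phi> \<xi> X) Y p) *\<^sub>F \<xi>
                 - (\<lambda>p. \<alpha> * app \<eta> Y p) *\<^sub>F (X + h_prime \<alpha> \<phi> \<xi> X)"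
      unfolding scale B_def[symmetric] using canonical_unique canonical_eq by simp
  next
    fix D \<beta> D' assume D: "canonical_connection A \<alpha> \<phi> \<xi> \<eta> g D" and \<beta>: "(0::real) < \<beta>"
    note iff = canonical_deformed_iff[OF \<beta> D, of D']
    show "D' = D" if "canonical_connection A (\<alpha> / \<beta>) \<phi> (deformed_xi \<beta> \<xi>)
                 (deformed_eta \<beta> \<eta>) (deformed_metric \<beta> \<eta> g) D'" using iff that by blast
    show "canonical_connection A (\<alpha> / \<beta>) \<phi> (deformed_xi \<beta> \<xi>)
                 (deformed_eta \<beta> \<eta>) (deformed_metric \<beta> \<eta> g) D'" if "D' = D" using iff that by blast
  qed
qed

end
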